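(* Let $\mathcal{T}$ be a tanglegram having exactly one cross-responsible set $X$. If $\mathcal{T}[X]$ is isomorphic to $\mathcal{K}_1$, then $\operatorname{crt}(\mathcal{T})=1$.
   Context: A rooted tree is a tree with at least two vertices and a designated root of degree $1$; leaves are non-root vertices of degree $1$; a rooted binary tree is a rooted tree in which all non-root, non-leaf vertices have degree $3$. For a set $S$ of leaves of a rooted binary tree $T$, $T[S]$ is obtained from the union of the root-to-$s$ paths ($s\in S$) by suppressing degree-$2$ vertices. A tanglegram $\mathcal{T}=(L_{\mathcal{T}},R_{\mathcal{T}},\sigma_{\mathcal{T}})$ consists of two rooted binary trees with equally many leaves and a perfect matching $\sigma_{\mathcal{T}}$ between their leaf sets. For $Z\subseteq\sigma_{\mathcal{T}}$, $\mathcal{T}[Z]$ has left tree $L_{\mathcal{T}}[S_1]$, right tree $R_{\mathcal{T}}[S_2]$ and matching $Z$, where $S_1,S_2$ are the left and right leaves covered by $Z$. Tanglegrams are isomorphic if there is a graph isomorphism mapping left root to left root and right root to right root. A plane drawing of a rooted tree is a straight-line crossing-free drawing with all leaves on a line (the leaf-line), all other vertices in one open half-plane of it, and each vertex strictly closer to the leaf-line than its proper ancestors. A layout of $\mathcal{T}$ is a straight-line drawing where both trees are drawn as plane drawings with parallel leaf-lines, both trees lie outside the strip between the leaf-lines, and matching edges are straight segments. Its crossing number is the number of unordered pairs of crossing matching edges; $\operatorname{crt}(\mathcal{T})$ is the minimum over all layouts. $\mathcal{K}_1$ is the size-$4$ tanglegram in which each tree has root adjacent to an internal vertex whose two children each have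 two leaf children, with left cherries $\{l_1,l_2\},\{l_3,l_4\}$, right cherries $\{r_1,r_2\},\{r_3,r_4\}$ and matching $l_1r_1, l_2r_3, l_3r_2, l_4r_4$. $\mathcal{K}_2$ is the size-$4$ tanglegram whose left tree is: root adjacent to $v_1$, $v_1$ has children leaf $l_1$ and $v_2$, $v_2$ has children leaf $l_2$ and $v_3$, $v_3$ has leaf children $l_3,l_4$; right tree analogously with $w_1,w_2,w_3$ and leaves $r_1$ (child of $w_1$), $r_2$ (child of $w_2$), $r_3,r_4$ (children of $w_3$); matching $l_1r_4, l_2r_2, l_3r_3, l_4r_1$. A set $Y\subseteq\sigma_{\mathcal{T}}$ is cross-responsible if $\mathcal{T}[Y]$ is isomorphic to $\mathcal{K}_1$ or $\mathcal{K}_2$. *)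

theory Defs
  imports "HOL-Analysis.Analysis"
begin

section \<open>Graphs and trees\<close>

record 'a ugraph =
  verts :: "'a set"
  edges :: "'a set set"

definition simple_graph :: "('a, 'm) ugraph_scheme \<Rightarrow> bool" where
  "simple_graph G \<longleftrightarrow>
     finite (verts G) \<and> (\<forall>e\<in>edges G. \<exists>u\<in>verts G. \<exists>v\<in>verts G. u \<noteq> v \<and> e = {u, v})"

definition deg :: "('a, 'm) ugraph_scheme \<Rightarrow> 'a \<Rightarrow> nat" where
  "deg G v = card {e \<in> edges G. v \<in> e}"

definition path_edges :: "'a list \<Rightarrow> 'a set set" where
  "path_edges xs = {{xs ! i, xs ! Suc i} | i. Suc i < length xs}"

definition path_betw :: "('a, 'm) ugraph_scheme \<Rightarrow> 'a \<Rightarrow> 'a list \<Rightarrow> 'a \<Rightarrow> bool" where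
  "path_betw G u xs v \<longleftrightarrow>
     xs \<noteq> [] \<and> hd xs = u \<and> last xs = v \<and> distinct xs \<and>
     set xs \<subseteq> verts G \<and> path_edges xs \<subseteq> edges G"

definition connected_graph :: "('a, 'm) ugraph_scheme \<Rightarrow> bool" where
  "connected_graph G \<longleftrightarrow>
     verts G \<noteq> {} \<and> (\<forall>u\<in>verts G. \<forall>v\<in>verts G. \<exists>xs. path_betw G u xs v)"

definition acyclic_graph :: "('a, 'm) ugraph_scheme \<Rightarrow> bool" where
  "acyclic_graph G \<longleftrightarrow>
     \<not> (\<exists>u xs v. path_betw G u xs v \<and> length xs \<ge> 3 \<and> {u, v} \<in> edges G)"

definition tree_graph :: "('a, 'm) ugraph_scheme \<Rightarrow> bool" where
  "tree_graph G \<longleftrightarrow> simple_graph G \<and> connected_graph G \<and> acyclic_graph G"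

record 'a rtree = "'a ugraph" +
  rt :: 'a

definition rooted_tree :: "'a rtree \<Rightarrow> bool" where
  "rooted_tree T \<longleftrightarrow>
     tree_graph T \<and> card (verts T) \<ge> 2 \<and> rt T \<in> verts T \<and> deg T (rt T) = 1"

definition leaves :: "'a rtree \<Rightarrow> 'a set" where
  "leaves T = {v \<in> verts T. v \<noteq> rt T \<and> deg T v = 1}"

definition rooted_binary_tree :: "'a rtree \<Rightarrow> bool" where
  "rooted_binary_tree T \<longleftrightarrow>
     rooted_tree T \<and> (\<forall>v\<in>verts T. v \<noteq> rt T \<and> v \<notin> leaves T \<longrightarrow> deg T v = 3)"

definition proper_ancestor :: "'a rtree \<Rightarrow> 'a \<Rightarrow> 'a \<Rightarrow> bool" where
  "proper_ancestor T u v \<longleftrightarrow> u \<noteq> v \<and> (\<exists>xs. path_betw T (rt T) xs v \<and> u \<in> set xs)"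

definition root_paths_union :: "'a rtree \<Rightarrow> 'a set \<Rightarrow> 'a rtree" where
  "root_paths_union T S =
     \<lparr>verts = \<Union> {set xs | xs s. s \<in> S \<and> path_betw T (rt T) xs s},
      edges = \<Union> {path_edges xs | xs s. s \<in> S \<and> path_betw T (rt T) xs s},
      rt = rt T\<rparr>"

text \<open>
  All vertices of degree 2 are suppressed simultaneously: two remaining vertices become adjacent
  iff they are joined by a path all of whose interior vertices have degree 2. In a tree no
  parallel edges or loops can arise.
\<close>

definition suppress_deg2 :: "'a rtree \<Rightarrow> 'a rtree" where
  "suppress_deg2 T =
     \<lparr>verts = {v \<in> verts T. deg T v \<noteq> 2},
      edges = {{u, v} | u v. u \<noteq> v \<and> deg T u \<noteq> 2 \<and> deg T v \<noteq> 2 \<and>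
                 (\<exists>xs. path_betw T u xs v \<and> (\<forall>w\<in>set xs - {u, v}. deg T w = 2))},
      rt = rt T\<rparr>"

definition induced_rtree :: "'a rtree \<Rightarrow> 'a set \<Rightarrow> 'a rtree" where
  "induced_rtree T S = suppress_deg2 (root_paths_union T S)"


section \<open>Tanglegrams\<close>

record ('a, 'b) tanglegram =
  ltree :: "'a rtree"
  rtree :: "'b rtree"
  matching :: "('a \<times> 'b) set"

definition is_tanglegram :: "('a, 'b) tanglegram \<Rightarrow> bool" where
  "is_tanglegram T \<longleftrightarrow>
     rooted_binary_tree (ltree T) \<and> rooted_binary_tree (rtree T) \<and>
     card (leaves (ltree T)) = card (leaves (rtree T)) \<and>
     matching T \<subseteq> leaves (ltree T) \<times> leaves (rtree T) \<and>
     (\<forall>l\<in>leaves (ltree T). \<exists>!r. (l, r) \<in> matching T) \<and>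
     (\<forall>r\<in>leaves (rtree T). \<exists>!l. (l, r) \<in> matching T)"

definition subtanglegram :: "('a, 'b) tanglegram \<Rightarrow> ('a \<times> 'b) set \<Rightarrow> ('a, 'b) tanglegram" where
  "subtanglegram T Z =
     \<lparr>ltree = induced_rtree (ltree T) (fst ` Z),
      rtree = induced_rtree (rtree T) (snd ` Z),
      matching = Z\<rparr>"

definition underlying_graph :: "('a, 'b) tanglegram \<Rightarrow> ('a + 'b) ugraph" where
  "underlying_graph T =
     \<lparr>verts = Inl ` verts (ltree T) \<union> Inr ` verts (rtree T),
      edges = (\<lambda>e. Inl ` e) ` edges (ltree T) \<union> (\<lambda>e. Inr ` e) ` edges (rtree T) \<union>
              {{Inl l, Inr r} | l r. (l, r) \<in> matching T}\<rparr>"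

definition graph_iso :: "('a \<Rightarrow> 'b) \<Rightarrow> ('a, 'm) ugraph_scheme \<Rightarrow> ('b, 'n) ugraph_scheme \<Rightarrow> bool" where
  "graph_iso f G H \<longleftrightarrow>
     bij_betw f (verts G) (verts H) \<and>
     (\<forall>u\<in>verts G. \<forall>v\<in>verts G. {u, v} \<in> edges G \<longleftrightarrow> {f u, f v} \<in> edges H)"

definition tanglegram_isomorphic ::
  "('a, 'b) tanglegram \<Rightarrow> ('c, 'd) tanglegram \<Rightarrow> bool" where
  "tanglegram_isomorphic T U \<longleftrightarrow>
     (\<exists>f. graph_iso f (underlying_graph T) (underlying_graph U) \<and>
          f (Inl (rt (ltree T))) = Inl (rt (ltree U)) \<and>
          f (Inr (rt (rtree T))) = Inr (rt (rtree U)))"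


section \<open>Layouts and the tangle crossing number\<close>

text \<open>
  The leaf-line is \<open>{x. n \<bullet> x = c}\<close> and the tree lies on the side \<open>n \<bullet> x < c\<close>. Two distinct edges
  may meet only in the image of a common end vertex. As every vertex of a rooted tree lies on an
  edge, this also keeps vertices off the edges not incident to them.
\<close>

definition plane_drawing ::
  "'a rtree \<Rightarrow> ('a \<Rightarrow> real \<times> real) \<Rightarrow> real \<times> real \<Rightarrow> real \<Rightarrow> bool" where
  "plane_drawing T p n c \<longleftrightarrow>
     inj_on p (verts T) \<and>
     (\<forall>e\<in>edges T. \<forall>f\<in>edges T. e \<noteq> f \<longrightarrow>
        convex hull (p ` e) \<inter> convex hull (p ` f) = p ` (e \<inter> f)) \<and>
     n \<noteq> 0 \<and>
     (\<forall>v\<in>leaves T. n \<bullet> p v = c) \<and>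
     (\<forall>v\<in>verts T - leaves T. n \<bullet> p v < c) \<and>
     (\<forall>u\<in>verts T. \<forall>v\<in>verts T. proper_ancestor T u v \<longrightarrow>
        infdist (p v) {x. n \<bullet> x = c} < infdist (p u) {x. n \<bullet> x = c})"

text \<open>
  The leaf-lines are \<open>{x. n \<bullet> x = c}\<close> and \<open>{x. n \<bullet> x = d}\<close> with \<open>c < d\<close>; the left tree lies in
  \<open>{x. n \<bullet> x \<le> c}\<close> and the right tree in \<open>{x. n \<bullet> x \<ge> d}\<close>. Since \<open>n\<close> is an arbitrary nonzero
  vector, the choice \<open>c < d\<close> loses no generality.
\<close>

definition is_layout ::
  "('a, 'b) tanglegram \<Rightarrow> ('a \<Rightarrow> real \<times> real) \<Rightarrow> ('b \<Rightarrow> real \<times> real) \<Rightarrow> bool" where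
  "is_layout T p q \<longleftrightarrow>
     (\<exists>n c d. c < d \<and> plane_drawing (ltree T) p n c \<and> plane_drawing (rtree T) q (- n) (- d))"

definition matching_segment ::
  "('a \<Rightarrow> real \<times> real) \<Rightarrow> ('b \<Rightarrow> real \<times> real) \<Rightarrow> 'a \<times> 'b \<Rightarrow> (real \<times> real) set" where
  "matching_segment p q e = closed_segment (p (fst e)) (q (snd e))"

text \<open>
  In a layout distinct matching edges have distinct ends on two distinct parallel lines, so their
  segments meet iff they cross.
\<close>

definition layout_crossings ::
  "('a, 'b) tanglegram \<Rightarrow> ('a \<Rightarrow> real \<times> real) \<Rightarrow> ('b \<Rightarrow> real \<times> real) \<Rightarrow> nat" where
  "layout_crossings T p q =
     card {{e, f} | e f. e \<in> matching T \<and> f \<in> matching T \<and> e \<noteq> f \<and>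
                         matching_segment p q e \<inter> matching_segment p q f \<noteq> {}}"

definition crt :: "('a, 'b) tanglegram \<Rightarrow> nat" where
  "crt T = (LEAST k. \<exists>p q. is_layout T p q \<and> layout_crossings T p q = k)"


section \<open>Cross-responsible sets\<close>

datatype kvertex = Root | Inner nat | Leaf nat

definition balanced_rtree4 :: "kvertex rtree" where
  "balanced_rtree4 =
     \<lparr>verts = {Root, Inner 1, Inner 2, Inner 3, Leaf 1, Leaf 2, Leaf 3, Leaf 4},
      edges = {{Root, Inner 1}, {Inner 1, Inner 2}, {Inner 1, Inner 3},
               {Inner 2, Leaf 1}, {Inner 2, Leaf 2}, {Inner 3, Leaf 3}, {Inner 3, Leaf 4}},
      rt = Root\<rparr>"

definition caterpillar_rtree4 :: "kvertex rtree" where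
  "caterpillar_rtree4 =
     \<lparr>verts = {Root, Inner 1, Inner 2, Inner 3, Leaf 1, Leaf 2, Leaf 3, Leaf 4},
      edges = {{Root, Inner 1}, {Inner 1, Leaf 1}, {Inner 1, Inner 2},
               {Inner 2, Leaf 2}, {Inner 2, Inner 3}, {Inner 3, Leaf 3}, {Inner 3, Leaf 4}},
      rt = Root\<rparr>"

definition K1 :: "(kvertex, kvertex) tanglegram" where
  "K1 = \<lparr>ltree = balanced_rtree4, rtree = balanced_rtree4,
         matching = {(Leaf 1, Leaf 1), (Leaf 2, Leaf 3), (Leaf 3, Leaf 2), (Leaf 4, Leaf 4)}\<rparr>"

definition K2 :: "(kvertex, kvertex) tanglegram" where
  "K2 = \<lparr>ltree = caterpillar_rtree4, rtree = caterpillar_rtree4,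
         matching = {(Leaf 1, Leaf 4), (Leaf 2, Leaf 2), (Leaf 3, Leaf 3), (Leaf 4, Leaf 1)}\<rparr>"

definition cross_responsible :: "('a, 'b) tanglegram \<Rightarrow> ('a \<times> 'b) set \<Rightarrow> bool" where
  "cross_responsible T Y \<longleftrightarrow>
     Y \<subseteq> matching T \<and>
     (tanglegram_isomorphic (subtanglegram T Y) K1 \<or> tanglegram_isomorphic (subtanglegram T Y) K2)"

end

theory Submission
  imports Defs "HOL-Library.Sublist"
begin

text \<open>Put all leaf pairs of the tanglegram and the common root \<open>None\<close> on one footing: each tree becomes
  a system of splits of this set of points, and a drawing of the tree amounts to a circular order of
  the points in which no split alternates. \<open>\<K>\<^sub>1\<close> and \<open>\<K>\<^sub>2\<close> then become a single
  obstruction \<open>obs\<close>, to which the root belongs.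

  If two split systems admit no obstruction at all, they have a common circular order: cut along a
  split with at least three points on both sides and glue orders of the two halves, until every split
  has a side of at most two points. If they admit an obstruction, then they admit one through any
  prescribed point, by exchange; so it is enough to know the obstructions containing the root.

  If the only one comes from \<open>\<K>\<^sub>1\<close> with edges \<open>1, 2, 3, 4\<close>, exchange also forces \<open>12\<close>, \<open>34\<close> to be
  exact splits of the left tree and \<open>13\<close>, \<open>24\<close> of the right one. Without \<open>2\<close> and \<open>3\<close> there is a common
  order, in which \<open>1\<close> and \<open>4\<close> may be taken adjacent, and \<open>\<dots>1 2 3 4\<dots>\<close> on the left with \<open>\<dots>1 3 2 4\<dots>\<close> on
  the right produces a drawing in which only \<open>2\<close> and \<open>3\<close> cross. Conversely a layout without crossings would order
  the four edges alike on both sides, whereas disjoint paths of a plane tree cannot interlace on the leaf-line.\<close>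

section \<open>Circular orders of split systems\<close>

text \<open>The threshold of three points comes from the gluing: each half keeps two points of the
  other half as stand-ins, so it is smaller than the whole only if the other half has at least three
  points. The obstacle there is the other system, whose splits may cross the cut; two stand-ins
  suffice because, without obstructions, all crossing splits separate the same two ends. Systems
  that cannot be cut further have at most six points, and on five or six points each is given by
  disjoint pairs. Two such families of pairs form a graph of maximal degree two, in which a cycle of
  length four is an obstruction and everything else fits on a circle. Uniqueness enters through the
  exchange: a point that could replace one of \<open>1, 2, 3, 4\<close> would give a second
  cross-responsible set, so every further point behaves like the root. The isomorphisms of the
  definition act on the union of both trees and the matching and fix only the two roots. That they
  respect the two sides and the leaves has to be recovered from the neighbours of each
  vertex.\<close>

text \<open>The last clause says that the unrooted tree is binary: each quadruple is split two against two.\<close>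

definition split_system :: "'a set \<Rightarrow> 'a set set \<Rightarrow> bool" where
  "split_system N A \<longleftrightarrow>
     (\<forall>G\<in>A. - G \<in> A) \<and>
     (\<forall>G\<in>A. \<forall>H\<in>A. N \<inter> G \<inter> H = {} \<or> N \<inter> G \<subseteq> H \<or> N \<inter> H \<subseteq> G \<or> N \<subseteq> G \<union> H) \<and>
     (\<forall>a\<in>N. \<forall>b\<in>N. \<forall>c\<in>N. \<forall>d\<in>N. distinct [a, b, c, d] \<longrightarrow>
        (\<exists>G\<in>A. a \<in> G \<and> (b \<in> G \<and> c \<notin> G \<and> d \<notin> G \<or> b \<notin> G \<and> c \<in> G \<and> d \<notin> G \<or> b \<notin> G \<and> c \<notin> G \<and> d \<in> G)))"

text \<open>Rotating the pattern by two positions reproduces it and rotating it by one exchanges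
  inside and outside, so for a complement-closed \<open>A\<close> the list is in effect read
  cyclically. Patterns that start outside \<open>G\<close> are then excluded as well, see
  \<open>circ_noalt\<close>.\<close>

definition circ :: "'a set set \<Rightarrow> 'a list \<Rightarrow> bool" where
  "circ A xs \<longleftrightarrow>
     (\<forall>G\<in>A. \<forall>a b c d. subseq [a, b, c, d] xs \<longrightarrow> \<not> (a \<in> G \<and> b \<notin> G \<and> c \<in> G \<and> d \<notin> G))"

definition sep :: "'a set set \<Rightarrow> 'a set \<Rightarrow> 'a set \<Rightarrow> bool" where
  "sep A P Q \<longleftrightarrow> (\<exists>G\<in>A. P \<subseteq> G \<and> Q \<inter> G = {})"

text \<open>For \<open>M = {m}\<close>: the trees \<open>m(ab)(cd)\<close> and \<open>m(ac)(bd)\<close> on five points. Rooted at \<open>m\<close> they form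
  \<open>\<K>\<^sub>1\<close>, and rooted at any of \<open>a, b, c, d\<close> they form \<open>\<K>\<^sub>2\<close>.\<close>

definition obs :: "'a set set \<Rightarrow> 'a set set \<Rightarrow> 'a set \<Rightarrow> 'a \<Rightarrow> 'a \<Rightarrow> 'a \<Rightarrow> 'a \<Rightarrow> bool" where
  "obs A B M a b c d \<longleftrightarrow>
     sep A {a, b} ({c, d} \<union> M) \<and> sep A {c, d} ({a, b} \<union> M) \<and>
     sep B {a, c} ({b, d} \<union> M) \<and> sep B {b, d} ({a, c} \<union> M)"

lemma split_system_compl: "split_system N A \<Longrightarrow> G \<in> A \<Longrightarrow> - G \<in> A"
  by (simp add: split_system_def)

lemma split_system_compat:
  assumes "split_system N A" "G \<in> A" "H \<in> A"
  obtains "N \<inter> G \<inter> H = {}" | "N \<inter> G \<subseteq> H" | "N \<inter> H \<subseteq> G" | "N \<subseteq> G \<union> H"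
  using assms unfolding split_system_def by blast

lemma split_system_resolve:
  assumes "split_system N A" "{a, b, c, d} \<subseteq> N" "distinct [a, b, c, d]"
  obtains "sep A {a, b} {c, d}" | "sep A {a, c} {b, d}" | "sep A {a, d} {b, c}"
proof -
  obtain G where "G \<in> A" "a \<in> G"
      "b \<in> G \<and> c \<notin> G \<and> d \<notin> G \<or> b \<notin> G \<and> c \<in> G \<and> d \<notin> G \<or> b \<notin> G \<and> c \<notin> G \<and> d \<in> G"
    using assms unfolding split_system_def by (metis insert_subset)
  then show thesis
    using that unfolding sep_def by (metis Int_insert_left_if0 Int_empty_left empty_subsetI insert_subset)
qed

text \<open>Splits stay sets over the whole type and are compared only inside \<open>N\<close>;
  passing to fewer points therefore leaves \<open>A\<close> itself unchanged.\<close>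

lemma split_system_mono:
  assumes A: "split_system N A" and sub: "N' \<subseteq> N"
  shows "split_system N' A"
  unfolding split_system_def
proof (intro conjI ballI impI)
  fix G assume "G \<in> A"
  then show "- G \<in> A" using A split_system_compl by blast
next
  fix G H assume "G \<in> A" "H \<in> A"
  from split_system_compat[OF A this] sub
  show "N' \<inter> G \<inter> H = {} \<or> N' \<inter> G \<subseteq> H \<or> N' \<inter> H \<subseteq> G \<or> N' \<subseteq> G \<union> H" by blast
next
  fix a b c d assume *: "a \<in> N'" "b \<in> N'" "c \<in> N'" "d \<in> N'" "distinct [a, b, c, d]"
  with sub have "a \<in> N" "b \<in> N" "c \<in> N" "d \<in> N" by auto
  with A *(5) show "\<exists>G\<in>A. a \<in> G \<and>
      (b \<in> G \<and> c \<notin> G \<and> d \<notin> G \<or> b \<notin> G \<and> c \<in> G \<and> d \<notin> G \<or> b \<notin> G \<and> c \<notin> G \<and> d \<in> G)"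
    unfolding split_system_def by simp
qed

lemma sep_sym:
  assumes "\<forall>G\<in>A. - G \<in> A" "sep A P Q"
  shows "sep A Q P"
proof -
  obtain G where "G \<in> A" "P \<subseteq> G" "Q \<inter> G = {}"
    using assms(2) unfolding sep_def by blast
  then show ?thesis
    unfolding sep_def using assms(1) by (intro bexI[of _ "- G"]) auto
qed

lemma sep_mono: "sep A P Q \<Longrightarrow> P' \<subseteq> P \<Longrightarrow> Q' \<subseteq> Q \<Longrightarrow> sep A P' Q'"
  unfolding sep_def by blast

lemma obs_distinct: "obs A B {m} a b c d \<Longrightarrow> distinct [m, a, b, c, d]"
  unfolding obs_def sep_def by auto

text \<open>The points \<open>a, b, c, d\<close> form a table of two rows, \<open>a b\<close> over
  \<open>c d\<close>: rows are separated by \<open>A\<close>, columns by \<open>B\<close>. The three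
  symmetries are the transpose, which exchanges \<open>A\<close> and \<open>B\<close>, the exchange
  of the rows, and the exchange of the columns.\<close>

lemma obs_swap: "obs A B M a b c d \<longleftrightarrow> obs B A M a c b d"
  unfolding obs_def by auto

lemma obs_rows: "obs A B M a b c d \<longleftrightarrow> obs A B M c d a b"
  unfolding obs_def by (auto simp: insert_commute)

lemma obs_cols: "obs A B M a b c d \<longleftrightarrow> obs A B M b a d c"
  unfolding obs_def by (auto simp: insert_commute)

section \<open>Rotating, cutting and gluing circular orders\<close>

lemma subseq_rev: "subseq (rev xs) (rev ys) \<longleftrightarrow> subseq xs ys"
proof -
  have *: "subseq (rev xs) (rev ys)" if "subseq xs ys" for xs ys :: "'a list"
    using that by (induction rule: list_emb.induct) (auto intro: list_emb_append_mono)
  show ?thesis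
    using *[of xs ys] *[of "rev xs" "rev ys"] by auto
qed

lemma subseq4_append:
  assumes "subseq [a, b, c, d] (xs @ ys)"
  shows "subseq [a, b, c, d] xs \<or> subseq [a, b, c] xs \<and> subseq [d] ys \<or>
    subseq [a, b] xs \<and> subseq [c, d] ys \<or> subseq [a] xs \<and> subseq [b, c, d] ys \<or> subseq [a, b, c, d] ys"
  using assms unfolding subseq_append_iff by (auto simp: Cons_eq_append_conv)

lemma subseq4_pairs:
  assumes "subseq [a, b, c, d] xs"
  shows "subseq [a, b] xs" "subseq [b, c] xs" "subseq [c, d] xs"
  using assms by (auto intro: subseq_order.order_trans[of _ "[a, b, c, d]"])

lemma subseq3_pairs:
  assumes "subseq [a, b, c] xs"
  shows "subseq [a, b] xs" "subseq [b, c] xs"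
  using assms by (auto intro: subseq_order.order_trans[of _ "[a, b, c]"])

lemma circ_noalt:
  assumes "circ A xs" "\<forall>G\<in>A. - G \<in> A" "G \<in> A" "subseq [a, b, c, d] xs"
  shows "\<not> (a \<in> G \<and> b \<notin> G \<and> c \<in> G \<and> d \<notin> G)" "\<not> (a \<notin> G \<and> b \<in> G \<and> c \<notin> G \<and> d \<in> G)"
proof -
  show "\<not> (a \<in> G \<and> b \<notin> G \<and> c \<in> G \<and> d \<notin> G)"
    using assms(1,3,4) unfolding circ_def by simp
  have "- G \<in> A" using assms(2,3) by simp
  with assms(1,4) have "\<not> (a \<in> - G \<and> b \<notin> - G \<and> c \<in> - G \<and> d \<notin> - G)"
    unfolding circ_def by blast
  then show "\<not> (a \<notin> G \<and> b \<in> G \<and> c \<notin> G \<and> d \<in> G)"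
    by simp
qed

lemma circ_rev:
  assumes "circ A xs" "\<forall>G\<in>A. - G \<in> A"
  shows "circ A (rev xs)"
  unfolding circ_def
proof (intro ballI allI impI)
  fix G a b c d
  assume "G \<in> A" "subseq [a, b, c, d] (rev xs)"
  then have "subseq [d, c, b, a] xs"
    using subseq_rev[of "[d, c, b, a]" xs] by simp
  then show "\<not> (a \<in> G \<and> b \<notin> G \<and> c \<in> G \<and> d \<notin> G)"
    using circ_noalt(2)[OF assms \<open>G \<in> A\<close>] by blast
qed

text \<open>A pattern that straddles the cut is a rotation of a pattern of the original list.
  Rotation by one or three positions turns inside into outside, which is where closure under
  complement is used.\<close>

lemma circ_rotate:
  assumes "circ A (xs @ ys)" "\<forall>G\<in>A. - G \<in> A"
  shows "circ A (ys @ xs)"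
  unfolding circ_def
proof (intro ballI allI impI)
  fix G a b c d
  assume G: "G \<in> A" and "subseq [a, b, c, d] (ys @ xs)"
  then consider "subseq [a, b, c, d] ys" | "subseq [a, b, c] ys" "subseq [d] xs" |
    "subseq [a, b] ys" "subseq [c, d] xs" | "subseq [a] ys" "subseq [b, c, d] xs" | "subseq [a, b, c, d] xs"
    using subseq4_append by metis
  then consider "subseq [a, b, c, d] (xs @ ys)" | "subseq ([d] @ [a, b, c]) (xs @ ys)" |
    "subseq ([c, d] @ [a, b]) (xs @ ys)" | "subseq ([b, c, d] @ [a]) (xs @ ys)"
    by cases (use list_emb_append_mono subseq_drop_many subseq_rev_drop_many in blast)+
  then show "\<not> (a \<in> G \<and> b \<notin> G \<and> c \<in> G \<and> d \<notin> G)"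
    using circ_noalt[OF assms G] by cases (auto, blast+)
qed

lemma circ_short:
  assumes "length xs < 4"
  shows "circ A xs"
proof -
  have "\<not> subseq [a, b, c, d] xs" for a b c d
    using assms by (intro not_subseq_length) simp
  then show ?thesis unfolding circ_def by simp
qed

text \<open>The points of the far side of a split are seen from \<open>S\<close> as two adjacent points \<open>p\<close>, \<open>q\<close>
  of the circular order, so the order can be cut between them.\<close>

lemma circ_cut:
  assumes "circ A xs" "\<forall>G\<in>A. - G \<in> A" "distinct xs" "set xs = S \<union> {p, q}"
    and "p \<noteq> q" "p \<notin> S" "q \<notin> S" "Z \<in> A" "S \<subseteq> Z" "p \<notin> Z" "q \<notin> Z"
  obtains ys where "set ys = S" "distinct ys"
    "\<And>C. \<forall>G\<in>C. - G \<in> C \<Longrightarrow> circ C xs \<Longrightarrow> circ C (p # ys @ [q])"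
proof -
  obtain us vs where xs: "xs = us @ p # vs"
    using assms(4) by (metis UnI2 insertI1 split_list)
  have rot: "circ C (p # (vs @ us))" if "\<forall>G\<in>C. - G \<in> C" "circ C xs" for C
    using circ_rotate[of C us "p # vs"] that xs by simp
  then have c: "circ A (p # (vs @ us))" using assms(1,2) by blast
  have "q \<in> set (vs @ us)"
    using assms(4,5) xs by auto
  then obtain ws zs where wz: "vs @ us = ws @ q # zs"
    by (metis split_list)
  have dist: "distinct (p # vs @ us)" and st: "set (p # vs @ us) = S \<union> {p, q}"
    using xs assms(3,4) by auto
  then have S: "set ws \<union> set zs = S" and d: "distinct (ws @ zs)"
    using wz assms(5-7) by auto
  \<comment> \<open>Points of \<open>S\<close> on both sides of \<open>q\<close> would alternate
    with \<open>p\<close> and \<open>q\<close> with respect to \<open>Z\<close>.\<close>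
  have "ws = [] \<or> zs = []"
  proof (rule ccontr)
    assume "\<not> (ws = [] \<or> zs = [])"
    then obtain w z ws' zs' where "ws = w # ws'" "zs = z # zs'"
      by (meson list.exhaust)
    then have "subseq [p, w, q, z] (p # ws @ q # zs)" "w \<in> S" "z \<in> S"
      using S by (auto simp: subseq_drop_many)
    then show False
      using circ_noalt(2)[OF c assms(2,8)] assms wz by (metis subsetD)
  qed
  then show thesis
  proof
    assume [simp]: "ws = []"
    have "circ C (p # rev zs @ [q])" if C: "\<forall>G\<in>C. - G \<in> C" "circ C xs" for C
    proof -
      have "circ C ((rev zs @ [q]) @ [p])"
        using circ_rev[OF rot[OF C] C(1)] wz by simp
      then show ?thesis
        using circ_rotate[OF _ C(1)] by fastforce
    qed
    then show thesis
      using that[of "rev zs"] S d by simp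
  next
    assume "zs = []"
    then show thesis
      using that[of ws] S d rot wz by simp
  qed
qed

text \<open>To a split that misses \<open>xs\<close>, the whole block \<open>xs\<close> looks like
  the single point \<open>l\<close>. A pattern starting inside \<open>G\<close> lies in
  \<open>rev ys\<close> altogether; in a pattern starting outside only the first point can lie in
  \<open>xs\<close>, and \<open>l\<close> takes its place.\<close>

lemma circ_glue_side:
  assumes "circ A (l # ys @ [r])" "\<forall>G\<in>A. - G \<in> A" "G \<in> A"
    and "l \<notin> G" "set xs \<inter> G = {}" "subseq [a, b, c, d] (xs @ rev ys)"
  shows "\<not> (a \<in> G \<and> b \<notin> G \<and> c \<in> G \<and> d \<notin> G)" "\<not> (a \<notin> G \<and> b \<in> G \<and> c \<notin> G \<and> d \<in> G)"
proof -
  have notin: "u \<notin> G" if "subseq (u # us) xs" for u us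
  proof -
    have "u \<in> set xs" using list_emb_set[OF that] by (metis list.set_intros(1))
    then show ?thesis using assms(5) by auto
  qed
  have notin2: "v \<notin> G" if "subseq (u # v # us) xs" for u v us
    using notin[OF subseq_Cons'[OF that]] .
  have "subseq [b, c, d] (rev ys)" if "a \<in> G \<or> b \<in> G"
    using subseq4_append[OF assms(6)] notin notin2 subseq_Cons' that by metis
  moreover have "subseq [a, b, c, d] (rev ys)" if "a \<in> G"
    using subseq4_append[OF assms(6)] notin that by metis
  moreover have sub: "subseq (l # rev us) (l # ys @ [r])" if "subseq us (rev ys)" for us
    using that subseq_rev[of us "rev ys"] by (simp add: subseq_rev_drop_many)
  ultimately show "\<not> (a \<in> G \<and> b \<notin> G \<and> c \<in> G \<and> d \<notin> G)"
    using subseq_Cons'[OF sub] circ_noalt[OF assms(1-3), of d c b a] by fastforce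
  show "\<not> (a \<notin> G \<and> b \<in> G \<and> c \<notin> G \<and> d \<in> G)"
    using \<open>a \<in> G \<or> b \<in> G \<Longrightarrow> subseq [b, c, d] (rev ys)\<close> sub[of "[b, c, d]"] assms(4)
      circ_noalt[OF assms(1-3), of l d c b] by fastforce
qed

text \<open>Splits that do not cross the cut are covered by \<open>circ_glue_side\<close>. A
  crossing split has, up to complement, \<open>l\<close> and \<open>l'\<close> inside and
  \<open>r\<close> and \<open>r'\<close> outside; then its inner points form an initial run of
  \<open>xs\<close> and of \<open>ys\<close>, and after the reversal of \<open>ys\<close> the two
  runs are adjacent on the circle.\<close>

lemma circ_glue:
  assumes C: "\<forall>G\<in>C. - G \<in> C"
    and c1: "circ C (l' # xs @ [r'])" and c2: "circ C (l # ys @ [r])"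
    and S: "set xs = S" "set ys = S'" "l \<in> S" "r \<in> S" "l' \<in> S'" "r' \<in> S'"
    and cross: "\<And>G. G \<in> C \<Longrightarrow> S \<inter> G = {} \<or> S \<subseteq> G \<or> S' \<inter> G = {} \<or> S' \<subseteq> G \<or>
      {l, l'} \<subseteq> G \<and> {r, r'} \<inter> G = {} \<or> {r, r'} \<subseteq> G \<and> {l, l'} \<inter> G = {}"
  shows "circ C (xs @ rev ys)"
proof -
  have A: "\<not> (a \<in> G \<and> b \<notin> G \<and> c \<in> G \<and> d \<notin> G)" "\<not> (a \<notin> G \<and> b \<in> G \<and> c \<notin> G \<and> d \<in> G)"
    if G: "G \<in> C" and sub: "subseq [a, b, c, d] (xs @ rev ys)" and "S \<inter> G = {} \<or> S' \<inter> G = {}"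
    for G a b c d
  proof -
    have sub': "subseq [d, c, b, a] (ys @ rev xs)"
      using sub subseq_rev[of "[d, c, b, a]" "ys @ rev xs"] by simp
    have "\<not> (a \<in> G \<and> b \<notin> G \<and> c \<in> G \<and> d \<notin> G) \<and> \<not> (a \<notin> G \<and> b \<in> G \<and> c \<notin> G \<and> d \<in> G)"
      using that(3)
    proof
      assume "S \<inter> G = {}"
      then show ?thesis
        using circ_glue_side[OF c2 C G _ _ sub] S by blast
    next
      assume "S' \<inter> G = {}"
      then show ?thesis
        using circ_glue_side[OF c1 C G _ _ sub'] S by blast
    qed
    then show "\<not> (a \<in> G \<and> b \<notin> G \<and> c \<in> G \<and> d \<notin> G)" "\<not> (a \<notin> G \<and> b \<in> G \<and> c \<notin> G \<and> d \<in> G)"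
      by auto
  qed
  have B: "\<not> (a \<in> G \<and> b \<notin> G \<and> c \<in> G \<and> d \<notin> G)" "\<not> (a \<notin> G \<and> b \<in> G \<and> c \<notin> G \<and> d \<in> G)"
    if G: "G \<in> C" and sub: "subseq [a, b, c, d] (xs @ rev ys)"
      and lr: "{l, l'} \<subseteq> G" "{r, r'} \<inter> G = {}"
    for G a b c d
  proof -
    have P: "u \<in> G" if "subseq [u, v] xs" "v \<in> G" for u v
    proof -
      have "subseq ([l', u, v] @ [r']) ((l' # xs) @ [r'])"
        using that by (intro list_emb_append_mono) auto
      then show ?thesis using circ_noalt[OF c1 C G, of l' u v r'] lr that by auto
    qed
    have Q: "u \<in> G" if "subseq [u, v] ys" "v \<in> G" for u v
    proof -
      have "subseq ([l, u, v] @ [r]) ((l # ys) @ [r])"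
        using that by (intro list_emb_append_mono) auto
      then show ?thesis using circ_noalt[OF c2 C G, of l u v r] lr that by auto
    qed
    have rv: "subseq [v, u] ys" if "subseq [u, v] (rev ys)" for u v
      using that subseq_rev[of "[v, u]" ys] by simp
    \<comment> \<open>Wherever the four points are cut into a part in \<open>xs\<close> and a part
      in \<open>rev ys\<close>, one of these two pairs stays together. By \<open>P\<close> and
      \<open>Q\<close> one cannot move from outside to inside within \<open>xs\<close>, nor from
      inside to outside within \<open>rev ys\<close>.\<close>
    have D: "subseq [b, c] xs \<or> subseq [c, d] (rev ys)"
      using subseq4_append[OF sub] subseq4_pairs[of a b c d xs] subseq4_pairs[of a b c d "rev ys"]
        subseq3_pairs[of a b c xs] subseq3_pairs[of b c d "rev ys"] by argo
    have E: "subseq [a, b] xs \<or> subseq [b, c] (rev ys)"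
      using subseq4_append[OF sub] subseq4_pairs[of a b c d xs] subseq4_pairs[of a b c d "rev ys"]
        subseq3_pairs[of a b c xs] subseq3_pairs[of b c d "rev ys"] by argo
    show "\<not> (a \<in> G \<and> b \<notin> G \<and> c \<in> G \<and> d \<notin> G)"
      using D P[of b c] Q[of d c] rv[of c d] by blast
    show "\<not> (a \<notin> G \<and> b \<in> G \<and> c \<notin> G \<and> d \<in> G)"
      using E P[of a b] Q[of c b] rv[of b c] by blast
  qed
  show ?thesis
    unfolding circ_def
  proof (intro ballI allI impI)
    fix G a b c d
    assume G: "G \<in> C" and sub: "subseq [a, b, c, d] (xs @ rev ys)"
    have G': "- G \<in> C" using C G by blast
    consider "S \<inter> G = {} \<or> S' \<inter> G = {}" | "S \<inter> - G = {} \<or> S' \<inter> - G = {}"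
      | "{l, l'} \<subseteq> G" "{r, r'} \<inter> G = {}" | "{l, l'} \<subseteq> - G" "{r, r'} \<inter> - G = {}"
      using cross[OF G] by blast
    then show "\<not> (a \<in> G \<and> b \<notin> G \<and> c \<in> G \<and> d \<notin> G)"
    proof cases
      case 1 then show ?thesis using A[OF G sub] by blast
    next
      case 2 then show ?thesis using A[OF G' sub] by blast
    next
      case 3 then show ?thesis using B[OF G sub] by blast
    next
      case 4 then show ?thesis using B[OF G' sub] by blast
    qed
  qed
qed

section \<open>Splits of one system that cross a split of the other\<close>

text \<open>The disjoint sides \<open>G\<close> and \<open>H\<close> are the columns of the table
  and the complement of \<open>Z\<close> gives the row \<open>c d\<close>. The split
  \<open>K\<close> for the row \<open>a b\<close> leaves out \<open>m\<close> in \<open>S\<close>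
  and \<open>y\<close> in \<open>S'\<close>, so compatibility with \<open>Z\<close> forces it into
  \<open>Z\<close>, away from \<open>c\<close> and \<open>d\<close>.\<close>

lemma obs_of_mixed:
  assumes A: "split_system N A" and Z: "Z \<in> A" "N \<inter> Z = S" "S' = N - S"
    and G: "G \<in> B" "H \<in> B" "N \<inter> G \<inter> H = {}"
    and "a \<in> S \<inter> G" "c \<in> S' \<inter> G" "b \<in> S \<inter> H" "d \<in> S' \<inter> H"
    and m: "m \<in> S" "m \<notin> G" "m \<notin> H" and y: "y \<in> S'" "sep A {a, b} {m, y}"
  shows "obs A B {m} a b c d"
proof -
  obtain K where K: "K \<in> A" "{a, b} \<subseteq> K" "{m, y} \<inter> K = {}"
    using y(2) unfolding sep_def by auto
  have "N \<inter> K \<subseteq> Z"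
    by (rule split_system_compat[OF A K(1) Z(1)]) (use assms K in blast)+
  then have "sep A {a, b} ({c, d} \<union> {m})"
    unfolding sep_def using K assms by (intro bexI[of _ K]) auto
  moreover have "sep A {c, d} ({a, b} \<union> {m})"
    unfolding sep_def using assms by (intro bexI[of _ "- Z"] split_system_compl[OF A]) auto
  moreover have "sep B {a, c} ({b, d} \<union> {m})"
    unfolding sep_def using assms by (intro bexI[of _ G]) auto
  moreover have "sep B {b, d} ({a, c} \<union> {m})"
    unfolding sep_def using assms by (intro bexI[of _ H]) auto
  ultimately show ?thesis unfolding obs_def by auto
qed

text \<open>Choose one point of \<open>S\<close> and one of \<open>S'\<close> in each of the three
  sides. \<open>A\<close> resolves \<open>x1, x2, x3, y1\<close> two against two; the
  \<open>x\<close> that is grouped with \<open>y1\<close> becomes \<open>m\<close>, and the sides of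
  the other two become the columns.\<close>

lemma obs_of_three_mixed:
  assumes A: "split_system N A" and Z: "Z \<in> A" "N \<inter> Z = S" "S' = N - S"
    and G: "G1 \<in> B" "G2 \<in> B" "G3 \<in> B"
      "N \<inter> G1 \<inter> G2 = {}" "N \<inter> G1 \<inter> G3 = {}" "N \<inter> G2 \<inter> G3 = {}"
    and mixed: "S \<inter> G1 \<noteq> {}" "S' \<inter> G1 \<noteq> {}" "S \<inter> G2 \<noteq> {}" "S' \<inter> G2 \<noteq> {}" "S \<inter> G3 \<noteq> {}" "S' \<inter> G3 \<noteq> {}"
  obtains m a b c d where "{m, a, b, c, d} \<subseteq> N" "obs A B {m} a b c d"
proof -
  obtain x1 y1 x2 y2 x3 y3 where
    x: "x1 \<in> S \<inter> G1" "x2 \<in> S \<inter> G2" "x3 \<in> S \<inter> G3" and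
    y: "y1 \<in> S' \<inter> G1" "y2 \<in> S' \<inter> G2" "y3 \<in> S' \<inter> G3"
    using mixed by blast
  have N: "{x1, x2, x3, y1, y2, y3} \<subseteq> N" using x y Z by blast
  have "distinct [x1, x2, x3, y1]" using x y Z G(4-6) by auto
  with A _ show thesis
  proof (rule split_system_resolve)
    show "{x1, x2, x3, y1} \<subseteq> N" using N by simp
  next
    assume "sep A {x1, x2} {x3, y1}"
    then have "obs A B {x3} x1 x2 y1 y2"
      using x y G N Z by (intro obs_of_mixed[OF A Z G(1,2,4)]) auto
    then show thesis using that N by blast
  next
    assume "sep A {x1, x3} {x2, y1}"
    then have "obs A B {x2} x1 x3 y1 y3"
      using x y G N Z by (intro obs_of_mixed[OF A Z G(1,3,5)]) auto
    then show thesis using that N by blast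
  next
    assume "sep A {x1, y1} {x2, x3}"
    then have "sep A {x2, x3} {x1, y1}" using sep_sym split_system_compl[OF A] by blast
    then have "obs A B {x1} x2 x3 y2 y3"
      using x y G N Z by (intro obs_of_mixed[OF A Z G(2,3,6)]) auto
    then show thesis using that N by blast
  qed
qed

text \<open>The splits of \<open>B\<close> crossing a given split of \<open>A\<close> form a chain, for otherwise three of their
  sides would be disjoint. A minimal crossing side and the complement of a maximal one provide
  the two ends of the chain.\<close>

lemma crossing_ends:
  assumes A: "split_system N A" and B: "split_system N B" and fin: "finite N"
    and Z: "Z \<in> A" "N \<inter> Z = S" "S' = N - S"
    and free: "\<And>m a b c d. {m, a, b, c, d} \<subseteq> N \<Longrightarrow> \<not> obs A B {m} a b c d"
    and card: "2 \<le> card S" "2 \<le> card S'"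
  obtains l r l' r' where "l \<in> S" "r \<in> S" "l' \<in> S'" "r' \<in> S'" "l \<noteq> r" "l' \<noteq> r'"
    "\<And>G. G \<in> B \<Longrightarrow> S \<inter> G = {} \<or> S \<subseteq> G \<or> S' \<inter> G = {} \<or> S' \<subseteq> G \<or>
      {l, l'} \<subseteq> G \<and> {r, r'} \<inter> G = {} \<or> {r, r'} \<subseteq> G \<and> {l, l'} \<inter> G = {}"
proof -
  define crossing where
    "crossing G \<longleftrightarrow> G \<in> B \<and> \<not> (S \<inter> G = {} \<or> S \<subseteq> G \<or> S' \<inter> G = {} \<or> S' \<subseteq> G)" for G
  have N: "N = S \<union> S'" using Z by blast
  have compl: "crossing (- G)" if "crossing G" for G
    using that split_system_compl[OF B] unfolding crossing_def by blast
  show thesis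
  proof (cases "\<exists>G. crossing G")
    case False
    obtain l r where "l \<in> S" "r \<in> S" "l \<noteq> r"
      using card(1) by (metis card_2_iff' obtain_subset_with_card_n subsetD)
    moreover obtain l' r' where "l' \<in> S'" "r' \<in> S'" "l' \<noteq> r'"
      using card(2) by (metis card_2_iff' obtain_subset_with_card_n subsetD)
    ultimately show thesis
      using that[of l r l' r'] False unfolding crossing_def by blast
  next
    case True
    obtain G where G: "crossing G" "\<And>H. crossing H \<Longrightarrow> card (N \<inter> G) \<le> card (N \<inter> H)"
      using True ex_has_least_nat[of crossing _ "\<lambda>G. card (N \<inter> G)"] by blast
    have min: "N \<inter> H = N \<inter> G" if "crossing H" "N \<inter> H \<subseteq> G" for H
      using that G(2)[OF that(1)] fin by (intro card_seteq) auto
    \<comment> \<open>By minimality a crossing side contained in \<open>G\<close> agrees with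
      \<open>G\<close> on \<open>N\<close>. Applied to \<open>H\<close> and to \<open>- H\<close>,
      this leaves \<open>G\<close> uncut.\<close>
    have side: "N \<inter> G \<subseteq> H \<or> N \<inter> G \<subseteq> - H" if "crossing H" for H
    proof -
      have GH: "G \<in> B" "H \<in> B" using that G(1) unfolding crossing_def by auto
      show ?thesis
      proof (rule split_system_compat[OF B GH])
        assume "N \<inter> H \<subseteq> G"
        then show ?thesis using min[OF that] by blast
      next
        assume "N \<subseteq> G \<union> H"
        then have "N \<inter> - H \<subseteq> G" by blast
        then show ?thesis using min[OF compl[OF that]] by blast
      qed blast+
    qed
    have "\<exists>H. (crossing H \<and> N \<inter> G \<subseteq> H) \<and>
        (\<forall>H'. crossing H' \<and> N \<inter> G \<subseteq> H' \<longrightarrow> card (N \<inter> H') \<le> card (N \<inter> H))"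
      by (rule ex_has_greatest_nat[of _ G _ "Suc (card N)"])
        (use G(1) fin in \<open>auto simp: less_Suc_eq_le intro: card_mono\<close>)
    then obtain H where H: "crossing H" "N \<inter> G \<subseteq> H"
      "\<And>H'. crossing H' \<and> N \<inter> G \<subseteq> H' \<Longrightarrow> card (N \<inter> H') \<le> card (N \<inter> H)"
      by blast
    have up: "N \<inter> H' \<subseteq> H" if H': "crossing H'" "N \<inter> G \<subseteq> H'" for H'
    proof (rule ccontr)
      assume no: "\<not> N \<inter> H' \<subseteq> H"
      have "\<not> N \<inter> H \<subseteq> H'"
      proof
        assume "N \<inter> H \<subseteq> H'"
        then have "N \<inter> H \<subseteq> N \<inter> H'" by blast
        moreover have "card (N \<inter> H') \<le> card (N \<inter> H)" using H(3) H' by blast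
        ultimately have "N \<inter> H = N \<inter> H'" using fin by (intro card_seteq) auto
        then show False using no by blast
      qed
      moreover have "N \<inter> G \<noteq> {}"
        using G(1) N unfolding crossing_def by blast
      then have "N \<inter> H \<inter> H' \<noteq> {}"
        using H'(2) H(2) by blast
      moreover have HB: "H \<in> B" "H' \<in> B" using H(1) H'(1) unfolding crossing_def by auto
      \<comment> \<open>The only remaining case of compatibility; it makes \<open>G\<close>,
        \<open>- H\<close> and \<open>- H'\<close> pairwise disjoint inside \<open>N\<close>, three
        crossing sides as in \<open>obs_of_three_mixed\<close>.\<close>
      ultimately have cov: "N \<subseteq> H \<union> H'"
        using no by (metis split_system_compat[OF B HB])
      have "crossing (- H)" "crossing (- H')"
        using compl H(1) H'(1) by auto
      moreover have "N \<inter> G \<inter> - H = {}" "N \<inter> G \<inter> - H' = {}" "N \<inter> - H \<inter> - H' = {}"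
        using H(2) H'(2) cov by auto
      ultimately obtain m a b c d where "{m, a, b, c, d} \<subseteq> N" "obs A B {m} a b c d"
        using obs_of_three_mixed[OF A Z, of G B "- H" "- H'"] G(1)
        unfolding crossing_def by metis
      then show False using free by blast
    qed
    obtain l l' r r' where lr: "l \<in> S \<inter> G" "l' \<in> S' \<inter> G" "r \<in> S - H" "r' \<in> S' - H"
      using G(1) H(1) unfolding crossing_def by blast
    have "{l, l'} \<subseteq> K \<and> {r, r'} \<inter> K = {} \<or> {r, r'} \<subseteq> K \<and> {l, l'} \<inter> K = {}" if K: "crossing K" for K
      using side[OF K]
    proof
      assume *: "N \<inter> G \<subseteq> K"
      from up[OF K *] * lr N show ?thesis by blast
    next
      assume *: "N \<inter> G \<subseteq> - K"
      from up[OF compl[OF K] *] * lr N show ?thesis by blast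
    qed
    then show thesis
      using that[of l r l' r'] lr H(2) N unfolding crossing_def by blast
  qed
qed

section \<open>Split systems in which every split has a side of at most two points\<close>

definition cherry :: "'a set set \<Rightarrow> 'a set \<Rightarrow> 'a set \<Rightarrow> bool" where
  "cherry A N P \<longleftrightarrow> card P = 2 \<and> (\<exists>G\<in>A. N \<inter> G = P)"

text \<open>The systems to which the cutting step no longer applies. What they allow as a circular
  order is decided by their cherries alone, see \<open>circ_of_cherries\<close>.\<close>

definition thin :: "'a set set \<Rightarrow> 'a set \<Rightarrow> bool" where
  "thin A N \<longleftrightarrow> (\<forall>Z\<in>A. card (N \<inter> Z) \<le> 2 \<or> card (N - Z) \<le> 2)"

text \<open>Two different pairs are not nested, and they cannot cover five points, so compatibility
  leaves only disjointness.\<close>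

lemma cherry_disjoint:
  assumes A: "split_system N A" and N: "5 \<le> card N" and P: "cherry A N P" and Q: "cherry A N Q"
    and ne: "P \<noteq> Q"
  shows "P \<inter> Q = {}"
proof -
  obtain G H where G: "G \<in> A" "N \<inter> G = P" and H: "H \<in> A" "N \<inter> H = Q"
    using P Q unfolding cherry_def by blast
  have card: "card P = 2" "card Q = 2" using P Q unfolding cherry_def by auto
  then have fins: "finite P" "finite Q" by (auto intro: card_ge_0_finite)
  have "\<not> P \<subseteq> Q" "\<not> Q \<subseteq> P"
    using card_seteq[of Q P] card_seteq[of P Q] fins card ne by auto
  moreover have "\<not> N \<subseteq> P \<union> Q"
  proof
    assume "N \<subseteq> P \<union> Q"
    then have "card N \<le> card (P \<union> Q)" using fins by (simp add: card_mono)
    also have "\<dots> \<le> 4" using card_Un_le[of P Q] card by simp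
    finally show False using N by simp
  qed
  ultimately show ?thesis
    using split_system_compat[OF A G(1) H(1)] G(2) H(2) by blast
qed

lemma cherry_subset:
  assumes "cherry A N P" "P \<subseteq> {x, y}"
  shows "P = {x, y}"
  using assms unfolding cherry_def by (auto simp: card_2_iff)

text \<open>Some split divides \<open>Q\<close> two against two. Being thin, it has a side of at
  most two points in all of \<open>N\<close>, and this side is one of the two pairs.\<close>

lemma thin_cherry:
  assumes A: "split_system N A" and thin: "thin A N" and fin: "finite N"
    and Q: "Q \<subseteq> N" "card Q = 4"
  obtains P where "cherry A N P" "P \<subseteq> Q"
proof -
  obtain ys where ys: "set ys = Q" "distinct ys"
    using finite_distinct_list[OF finite_subset[OF Q(1) fin]] by blast
  then have "length ys = 4" using Q(2) distinct_card by fastforce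
  then obtain a b c d where "ys = [a, b, c, d]"
    by (auto simp: numeral_eq_Suc length_Suc_conv)
  then have Qe: "Q = {a, b, c, d}" and d: "distinct [a, b, c, d]" using ys by auto
  note res = that
  have *: thesis if "sep A {w, x} {y, z}" "{w, x, y, z} = Q" "w \<noteq> x" "y \<noteq> z" for w x y z
  proof -
    obtain G where G: "G \<in> A" "{w, x} \<subseteq> G" "{y, z} \<inter> G = {}"
      using \<open>sep A {w, x} {y, z}\<close> unfolding sep_def by blast
    consider "card (N \<inter> G) \<le> 2" | "card (N \<inter> - G) \<le> 2"
      using thin G(1) unfolding thin_def by (metis Diff_eq)
    then show thesis
    proof cases
      case 1
      have "{w, x} = N \<inter> G"
        using 1 G that Q(1) fin by (intro card_seteq) auto
      moreover have "card {w, x} = 2" using that(3) by simp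
      ultimately have "cherry A N {w, x}" unfolding cherry_def using G(1) by blast
      then show thesis using res[of "{w, x}"] that(2) by blast
    next
      case 2
      have "{y, z} = N \<inter> - G"
        using 2 G that Q(1) fin by (intro card_seteq) auto
      moreover have "card {y, z} = 2" using that(4) by simp
      ultimately have "cherry A N {y, z}"
        unfolding cherry_def using split_system_compl[OF A G(1)] by blast
      then show thesis using res[of "{y, z}"] that(2) by blast
    qed
  qed
  show thesis
    by (rule split_system_resolve[OF A _ d])
      (use Qe Q(1) d *[of a b c d] *[of a c b d] *[of a d b c] in auto)
qed

text \<open>Cherries are pairwise disjoint and every four points contain one. This yields two
  cherries; any two of the points left over form a third one, so by disjointness at most two points
  are left over. The two outcomes are the only shapes of such a tree with at least five
  leaves.\<close>

lemma thin_pairs: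
  assumes A: "split_system N A" and thin: "thin A N" and N: "5 \<le> card N"
  obtains (five) p q r s m where "distinct [p, q, r, s, m]" "N = {p, q, r, s, m}"
      "\<And>P. cherry A N P \<longleftrightarrow> P = {p, q} \<or> P = {r, s}"
  | (six) p q r s t u where "distinct [p, q, r, s, t, u]" "N = {p, q, r, s, t, u}"
      "\<And>P. cherry A N P \<longleftrightarrow> P = {p, q} \<or> P = {r, s} \<or> P = {t, u}"
proof -
  have fin: "finite N" using N card.infinite by fastforce
  note disj = cherry_disjoint[OF A N]
  note ex = thin_cherry[OF A thin fin]
  obtain Q where "Q \<subseteq> N" "card Q = 4" using N obtain_subset_with_card_n[of 4 N] by auto
  then obtain P where P: "cherry A N P" using ex by blast
  then obtain p q where pq: "P = {p, q}" "p \<noteq> q" unfolding cherry_def by (auto simp: card_2_iff)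
  have "4 \<le> card (N - {p})" using N fin by (auto simp: card_Diff_singleton_if)
  then obtain Q where Q: "Q \<subseteq> N - {p}" "card Q = 4" by (metis obtain_subset_with_card_n)
  then have "Q \<subseteq> N" by blast
  then obtain P' where "cherry A N P'" "P' \<subseteq> Q" using ex[OF _ Q(2)] by blast
  then have P': "cherry A N P'" "P' \<subseteq> N - {p}" using Q(1) by auto
  then obtain r s where rs: "P' = {r, s}" "r \<noteq> s" unfolding cherry_def by (auto simp: card_2_iff)
  have "P \<inter> P' = {}" using disj[OF P P'(1)] P'(2) pq by auto
  then have d4: "distinct [p, q, r, s]" using pq rs by auto
  have sub: "{p, q, r, s} \<subseteq> N" using P P'(1) pq rs unfolding cherry_def by blast
  define R where "R = N - {p, q, r, s}"
  have "card R = card N - 4" unfolding R_def using card_Diff_subset[OF _ sub] d4 by simp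
  then have "R \<noteq> {}" using N by auto
  then obtain y where y: "y \<in> R" by blast
  \<comment> \<open>The four points \<open>p, r, y, z\<close> contain a cherry but neither
    \<open>q\<close> nor \<open>s\<close>. It is thus neither \<open>{p, q}\<close> nor
    \<open>{r, s}\<close>, so it is disjoint from both and only \<open>{y, z}\<close>
    remains.\<close>
  have pair: "cherry A N {y, z}" if "y \<in> R" "z \<in> R" "y \<noteq> z" for y z
  proof -
    have "card {p, r, y, z} = 4" using that d4 unfolding R_def by auto
    moreover have "{p, r, y, z} \<subseteq> N" using that sub unfolding R_def by auto
    ultimately obtain P'' where P'': "cherry A N P''" "P'' \<subseteq> {p, r, y, z}"
      using ex by blast
    have "p \<notin> P''" "r \<notin> P''"
    proof -
      have *: "q \<notin> P''" "s \<notin> P''" using P''(2) d4 that unfolding R_def by auto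
      then have "P \<noteq> P''" "P' \<noteq> P''" using pq rs by auto
      then show "p \<notin> P''" "r \<notin> P''"
        using disj[OF P P''(1)] disj[OF P'(1) P''(1)] pq rs by auto
    qed
    then have "P'' \<subseteq> {y, z}" using P''(2) by blast
    then show ?thesis using cherry_subset[OF P''(1)] P''(1) by metis
  qed
  have only: "P'' = {p, q} \<or> P'' = {r, s} \<or> P'' \<subseteq> R" if "cherry A N P''" for P''
  proof -
    have "P'' \<subseteq> N" using that unfolding cherry_def by blast
    then show ?thesis using disj[OF P that] disj[OF P'(1) that] unfolding R_def pq rs by blast
  qed
  show thesis
  proof (cases "R = {y}")
    case True
    have ch: "cherry A N P'' \<longleftrightarrow> P'' = {p, q} \<or> P'' = {r, s}" for P''
    proof -
      have "\<not> P'' \<subseteq> {y}" if "cherry A N P''"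
        using card_mono[of "{y}" P''] that unfolding cherry_def by auto
      then show ?thesis using only[of P''] P P'(1) unfolding True pq rs by blast
    qed
    have N: "N = {p, q, r, s, y}" and d: "distinct [p, q, r, s, y]"
      using True sub d4 unfolding R_def by auto
    show thesis by (rule five[OF d N ch])
  next
    case False
    then obtain z where z: "z \<in> R" "z \<noteq> y" using y by blast
    have R: "R = {y, z}"
    proof (rule ccontr)
      assume "R \<noteq> {y, z}"
      then obtain w where w: "w \<in> R" "w \<noteq> y" "w \<noteq> z" using y z by blast
      have "{y, z} \<inter> {y, w} = {}"
        using disj[OF pair[of y z] pair[of y w]] w y z by (auto simp: doubleton_eq_iff)
      then show False by simp
    qed
    have ch: "cherry A N P'' \<longleftrightarrow> P'' = {p, q} \<or> P'' = {r, s} \<or> P'' = {y, z}" for P''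
    proof -
      have "P'' = {y, z}" if "P'' \<subseteq> R" "cherry A N P''"
        using that cherry_subset unfolding R by metis
      moreover have "cherry A N {y, z}" using pair y z by metis
      ultimately show ?thesis using only[of P''] P P'(1) unfolding pq rs by blast
    qed
    have N: "N = {p, q, r, s, y, z}" and d: "distinct [p, q, r, s, y, z]"
      using R z sub d4 unfolding R_def by auto
    show thesis by (rule six[OF d N ch])
  qed
qed

lemma subseq_distinct: "subseq xs ys \<Longrightarrow> distinct ys \<Longrightarrow> distinct xs"
proof (induction rule: list_emb.induct)
  case (list_emb_Cons2 x y xs ys)
  then show ?case using list_emb_set[OF list_emb_Cons2(2)] by auto
qed auto

text \<open>An alternation puts \<open>a, c\<close> on one side and \<open>b, d\<close> on the
  other; in a thin system one of these two pairs is then the whole side.\<close>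

lemma circ_of_cherries:
  assumes A: "split_system N A" and thin: "thin A N" and xs: "set xs = N" "distinct xs"
    and nonalt: "\<And>a b c d. subseq [a, b, c, d] xs \<Longrightarrow> \<not> cherry A N {a, c} \<and> \<not> cherry A N {b, d}"
  shows "circ A xs"
  unfolding circ_def
proof (intro ballI allI impI notI)
  fix G a b c d
  assume G: "G \<in> A" and sub: "subseq [a, b, c, d] xs" and alt: "a \<in> G \<and> b \<notin> G \<and> c \<in> G \<and> d \<notin> G"
  have fin: "finite N" using xs by auto
  have N: "{a, b, c, d} \<subseteq> N" using list_emb_set[OF sub] xs by auto
  have d: "distinct [a, b, c, d]" using subseq_distinct[OF sub] xs by blast
  consider "card (N \<inter> G) \<le> 2" | "card (N \<inter> - G) \<le> 2"
    using thin G unfolding thin_def by (metis Diff_eq)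
  then show False
  proof cases
    case 1
    have "{a, c} = N \<inter> G" using 1 alt N d fin by (intro card_seteq) auto
    moreover have "card {a, c} = 2" using d by simp
    ultimately have "cherry A N {a, c}" unfolding cherry_def using G by blast
    then show False using nonalt sub by blast
  next
    case 2
    have "{b, d} = N \<inter> - G" using 2 alt N d fin by (intro card_seteq) auto
    moreover have "card {b, d} = 2" using d by simp
    ultimately have "cherry A N {b, d}" unfolding cherry_def using split_system_compl[OF A G] by blast
    then show False using nonalt sub by blast
  qed
qed

lemma obs_of_cherries:
  assumes A: "split_system N A" and B: "split_system N B" and m: "{m, a, b, c, d} \<subseteq> N"
    "distinct [m, a, b, c, d]"
    and ch: "cherry A N {a, b}" "cherry A N {c, d}" "cherry B N {a, c}" "cherry B N {b, d}"
  shows "obs A B {m} a b c d"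
proof -
  have *: "sep C {x, y} ({z, w} \<union> {m})"
    if "cherry C N {x, y}" "{x, y, z, w} \<subseteq> N" "distinct [x, y, z, w, m]" for C x y z w
  proof -
    obtain G where "G \<in> C" "N \<inter> G = {x, y}" using \<open>cherry C N {x, y}\<close> unfolding cherry_def by blast
    then show ?thesis unfolding sep_def using that m by (intro bexI[of _ G]) auto
  qed
  show ?thesis
    unfolding obs_def using *[OF ch(1), of c d] *[OF ch(2), of a b] *[OF ch(3), of b d] *[OF ch(4), of a c] m
    by auto
qed

text \<open>Inserts \<open>b\<close> next to its partner \<open>a\<close>. A split that does not
  separate them cannot tell them apart, so an alternation would already occur before the insertion.
  A split that separates them has, by compatibility with the cherry, a single point of
  \<open>N\<close> on one side and cannot alternate.\<close>

lemma circ_twin: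
  assumes A: "split_system N A" and c: "circ A (us @ a # vs)" and G0: "G0 \<in> A" "N \<inter> G0 = {a, b}"
    and zs: "zs = us @ a # b # vs \<or> zs = us @ b # a # vs" "distinct zs" "set zs \<subseteq> N"
  shows "circ A zs"
  unfolding circ_def
proof (intro ballI allI impI notI)
  fix G w x y z
  assume G: "G \<in> A" and sub: "subseq [w, x, y, z] zs" and alt: "w \<in> G \<and> x \<notin> G \<and> y \<in> G \<and> z \<notin> G"
  have N: "{w, x, y, z} \<subseteq> N" using list_emb_set[OF sub] zs by auto
  have d: "distinct [w, x, y, z]" using subseq_distinct[OF sub] zs by blast
  show False
  proof (cases "a \<in> G \<longleftrightarrow> b \<in> G")
    case True
    define f where "f t = (if t = b then a else t)" for t
    have f: "f t \<in> G \<longleftrightarrow> t \<in> G" for t unfolding f_def using True by auto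
    have "map f us = us" "map f vs = vs"
      using zs unfolding f_def by (auto intro!: map_idI)
    then have "map f zs = us @ a # a # vs" using zs unfolding f_def by auto
    then have s: "subseq [f w, f x, f y, f z] (us @ a # a # vs)"
      using subseq_map[OF sub, of f] by simp
    have ne: "f w \<noteq> f x" "f x \<noteq> f y" "f y \<noteq> f z" using f alt by metis+
    \<comment> \<open>An alternating pattern has no equal neighbours and hence uses at most one of
      the two adjacent copies of \<open>a\<close>.\<close>
    have dup: "subseq ts (a # vs)" if "subseq ts (a # a # vs)" "distinct_adj ts" for ts
    proof (cases ts)
      case (Cons t ts')
      show ?thesis
      proof (cases "t = a")
        case True
        then have "subseq ts' (a # vs)" using that Cons by simp
        then show ?thesis
          using that(2) Cons True by (cases ts') (auto simp: distinct_adj_Cons)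
      next
        case False
        then show ?thesis using that Cons by simp
      qed
    qed simp
    have "subseq [f w, f x, f y, f z] (us @ a # vs)"
    proof -
      obtain t1 t2 where t: "[f w, f x, f y, f z] = t1 @ t2" "subseq t1 us" "subseq t2 (a # a # vs)"
        using s by (rule subseq_appendE)
      have "distinct_adj (t1 @ t2)" unfolding t(1)[symmetric] using ne by (simp add: distinct_adj_Cons)
      then have "distinct_adj t2" by (simp add: distinct_adj_append_iff)
      then show ?thesis unfolding t(1) using t dup by (intro list_emb_append_mono) auto
    qed
    then show False
      using c G f alt unfolding circ_def by blast
  next
    case False
    have ab: "a \<in> N" "b \<in> N" using G0 by auto
    have in_G0: "t \<in> G0 \<longleftrightarrow> t = a \<or> t = b" if "t \<in> N" for t using G0(2) that by blast
    show False
    proof (rule split_system_compat[OF A G G0(1)])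
      assume "N \<inter> G \<inter> G0 = {}"
      then show False using False ab in_G0 by blast
    next
      assume "N \<inter> G \<subseteq> G0"
      then have "w \<in> {a, b}" "y \<in> {a, b}" using alt N in_G0 by auto
      then show False using False alt d by auto
    next
      assume "N \<inter> G0 \<subseteq> G"
      then show False using False ab in_G0 by blast
    next
      assume "N \<subseteq> G \<union> G0"
      then have "x \<in> {a, b}" "z \<in> {a, b}" using alt N in_G0 by auto
      then show False using False alt d by auto
    qed
  qed
qed

text \<open>The excluded pairs are the five diagonals of the pentagon \<open>v w x y z\<close>: a
  pair that alternates with another is never a pair of neighbours.\<close>

lemma circ_of_cherries5:
  assumes "split_system N A" "thin A N" "N = {v, w, x, y, z}" "distinct [v, w, x, y, z]"
    and "\<not> cherry A N {v, x}" "\<not> cherry A N {v, y}" "\<not> cherry A N {w, y}" "\<not> cherry A N {w, z}" "\<not> cherry A N {x, z}"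
  shows "circ A [v, w, x, y, z]"
proof (rule circ_of_cherries[OF assms(1,2)])
  fix a b c d
  assume "subseq [a, b, c, d] [v, w, x, y, z]"
  then have "[a, b, c, d] \<in> {[w, x, y, z], [v, x, y, z], [v, w, y, z], [v, w, x, z], [v, w, x, y]}"
    unfolding in_set_subseqs[symmetric] by (auto simp: Let_def)
  then show "\<not> cherry A N {a, c} \<and> \<not> cherry A N {b, d}"
    using assms(5-) by (elim insertE emptyE) simp_all
qed (use assms in auto)

text \<open>The excluded pairs are the nine diagonals of the hexagon
  \<open>u v w x y z\<close>.\<close>

lemma circ_of_cherries6:
  assumes "split_system N A" "thin A N" "N = {u, v, w, x, y, z}" "distinct [u, v, w, x, y, z]"
    and "\<not> cherry A N {u, w}" "\<not> cherry A N {u, x}" "\<not> cherry A N {u, y}" "\<not> cherry A N {v, x}"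
      "\<not> cherry A N {v, y}" "\<not> cherry A N {v, z}" "\<not> cherry A N {w, y}" "\<not> cherry A N {w, z}" "\<not> cherry A N {x, z}"
  shows "circ A [u, v, w, x, y, z]"
proof (rule circ_of_cherries[OF assms(1,2)])
  fix a b c d
  assume "subseq [a, b, c, d] [u, v, w, x, y, z]"
  then have "[a, b, c, d] \<in> {[w, x, y, z], [v, x, y, z], [v, w, y, z], [v, w, x, z], [v, w, x, y],
    [u, x, y, z], [u, w, y, z], [u, w, x, z], [u, w, x, y], [u, v, y, z], [u, v, x, z], [u, v, x, y],
    [u, v, w, z], [u, v, w, y], [u, v, w, x]}"
    unfolding in_set_subseqs[symmetric] by (auto simp: Let_def)
  then show "\<not> cherry A N {a, c} \<and> \<not> cherry A N {b, d}"
    using assms(5-) by (elim insertE emptyE) simp_all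
qed (use assms in auto)

lemma disjoint_union_cancel:
  assumes "Q \<union> X = N" "Q \<union> Y = N" "Q \<inter> X = {}" "Q \<inter> Y = {}"
  shows "X = Y"
  using assms by blast

text \<open>The point \<open>m\<close> is the one outside both cherries. As predicates, this and
  \<open>pairs6\<close> can be relabelled by the symmetries below, so that one system is normalised
  against the other.\<close>

definition pairs5 :: "'a set set \<Rightarrow> 'a set \<Rightarrow> 'a \<Rightarrow> 'a \<Rightarrow> 'a \<Rightarrow> 'a \<Rightarrow> 'a \<Rightarrow> bool" where
  "pairs5 A N m p q r s \<longleftrightarrow> distinct [p, q, r, s, m] \<and> N = {p, q, r, s, m} \<and>
     (\<forall>P. cherry A N P \<longleftrightarrow> P = {p, q} \<or> P = {r, s})"

definition pairs6 :: "'a set set \<Rightarrow> 'a set \<Rightarrow> 'a \<Rightarrow> 'a \<Rightarrow> 'a \<Rightarrow> 'a \<Rightarrow> 'a \<Rightarrow> 'a \<Rightarrow> bool" where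
  "pairs6 A N p q r s t u \<longleftrightarrow> distinct [p, q, r, s, t, u] \<and> N = {p, q, r, s, t, u} \<and>
     (\<forall>P. cherry A N P \<longleftrightarrow> P = {p, q} \<or> P = {r, s} \<or> P = {t, u})"

lemma pairs5_swap: "pairs5 A N m p q r s \<Longrightarrow> pairs5 A N m q p r s" "pairs5 A N m p q r s \<Longrightarrow> pairs5 A N m r s p q"
  unfolding pairs5_def by (auto simp: insert_commute)

lemma pairs5_first:
  assumes "pairs5 A N m p q r s" "x \<in> N" "x \<noteq> m"
  shows "\<exists>q r s. pairs5 A N m x q r s"
proof -
  have "x = p \<or> x = q \<or> x = r \<or> x = s" using assms unfolding pairs5_def by auto
  then show ?thesis using assms(1) pairs5_swap by metis
qed

lemma pairs6_swap: "pairs6 A N p q r s t u \<Longrightarrow> pairs6 A N q p r s t u"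
  "pairs6 A N p q r s t u \<Longrightarrow> pairs6 A N p q s r t u"
  "pairs6 A N p q r s t u \<Longrightarrow> pairs6 A N r s p q t u" "pairs6 A N p q r s t u \<Longrightarrow> pairs6 A N p q t u r s"
  unfolding pairs6_def by (auto simp: insert_commute)

lemma pairs6_second:
  assumes "pairs6 A N p q r s t u" "x \<in> N" "x \<noteq> p" "x \<noteq> q"
  shows "\<exists>s t u. pairs6 A N p q x s t u"
proof -
  have "x = r \<or> x = s \<or> x = t \<or> x = u" using assms unfolding pairs6_def by auto
  then show ?thesis using assms(1) pairs6_swap by metis
qed

lemma pairs6_first:
  assumes "pairs6 A N p q r s t u" "x \<in> N"
  shows "\<exists>q r s t u. pairs6 A N x q r s t u"
proof (cases "x = p \<or> x = q")
  case True
  then show ?thesis using assms(1) pairs6_swap(1) by metis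
next
  case False
  then show ?thesis using pairs6_second[OF assms] pairs6_swap(3) by metis
qed

text \<open>Superimpose the cherries of both systems as edges of a graph. If the unpaired points
  agree, the cherries either coincide or form a cycle of length four that avoids \<open>m\<close>,
  which is an obstruction. Otherwise the graph consists of paths and possibly a doubled edge, and
  traversing these gives the order.\<close>

lemma circular_order_pairs5:
  assumes A: "split_system N A" "thin A N" "pairs5 A N m p q r s"
    and B: "split_system N B" "thin B N" "pairs5 B N m' p' q' r' s'"
    and free: "\<And>m a b c d. {m, a, b, c, d} \<subseteq> N \<Longrightarrow> \<not> obs A B {m} a b c d"
  obtains xs where "distinct xs" "set xs = N" "circ A xs" "circ B xs"
proof (cases "m' = m")
  case True
  note N = A(3)[unfolded pairs5_def]
  note chA = N[THEN conjunct2, THEN conjunct2, rule_format] and N = N[THEN conjunct1] N[THEN conjunct2, THEN conjunct1]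
  obtain q' r' s' where B3: "pairs5 B N m p q' r' s'"
    using pairs5_first[OF B(3), of p] N True by auto
  note N' = B3[unfolded pairs5_def]
  note chB = N'[THEN conjunct2, THEN conjunct2, rule_format] and N' = N'[THEN conjunct1] N'[THEN conjunct2, THEN conjunct1]
  have "q' \<in> N" "q' \<noteq> p" "q' \<noteq> m" using N' by auto
  then consider "q' = q" | "q' = r" | "q' = s" using N by auto
  then show thesis
  proof cases
    case 1
    have "{p, q, m} \<union> {r', s'} = N" unfolding N'(2) 1 by auto
    moreover have "{p, q, m} \<union> {r, s} = N" unfolding N(2) by auto
    ultimately have e: "{r', s'} = {r, s}"
      by (rule disjoint_union_cancel) (use N(1) N'(1) 1 in auto)
    have ch: "cherry B N P \<longleftrightarrow> P = {p, q} \<or> P = {r, s}" for P by (simp only: chB e 1)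
    have Ns: "N = {p, q, r, s, m}" using N(2) by auto
    have "circ A [p, q, r, s, m]"
      by (rule circ_of_cherries5[OF A(1,2) Ns]) (use N(1) in \<open>auto simp: chA doubleton_eq_iff\<close>)
    moreover have "circ B [p, q, r, s, m]"
      by (rule circ_of_cherries5[OF B(1,2) Ns]) (use N(1) in \<open>auto simp: ch doubleton_eq_iff\<close>)
    ultimately show thesis using that[of "[p, q, r, s, m]"] N(1) Ns by auto
  next
    case 2
    have "{p, r, m} \<union> {r', s'} = N" unfolding N'(2) 2 by auto
    moreover have "{p, r, m} \<union> {q, s} = N" unfolding N(2) by auto
    ultimately have e: "{r', s'} = {q, s}"
      by (rule disjoint_union_cancel) (use N(1) N'(1) 2 in auto)
    have "cherry B N {q, s}" "cherry B N {p, r}" by (simp_all add: chB e 2 insert_commute)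
    moreover have "{m, p, q, r, s} \<subseteq> N" "distinct [m, p, q, r, s]" using N by auto
      moreover have "cherry A N {p, q}" "cherry A N {r, s}" by (simp_all add: chA insert_commute)
      ultimately have "obs A B {m} p q r s" by (intro obs_of_cherries[OF A(1) B(1)])
    then show thesis using free N by blast
  next
    case 3
    have "{p, s, m} \<union> {r', s'} = N" unfolding N'(2) 3 by auto
    moreover have "{p, s, m} \<union> {q, r} = N" unfolding N(2) by auto
    ultimately have e: "{r', s'} = {q, r}"
      by (rule disjoint_union_cancel) (use N(1) N'(1) 3 in auto)
    have "cherry B N {q, r}" "cherry B N {p, s}" by (simp_all add: chB e 3 insert_commute)
    moreover have "{m, p, q, s, r} \<subseteq> N" "distinct [m, p, q, s, r]" using N by auto
      moreover have "cherry A N {p, q}" "cherry A N {s, r}" by (simp_all add: chA insert_commute)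
      ultimately have "obs A B {m} p q s r" by (intro obs_of_cherries[OF A(1) B(1)])
    then show thesis using free N by blast
  qed
next
  case False
  have "m' \<in> N" using B(3) unfolding pairs5_def by simp
  then obtain q r s where A3: "pairs5 A N m m' q r s"
    using pairs5_first[OF A(3)] False by metis
  note N = A3[unfolded pairs5_def]
  note chA = N[THEN conjunct2, THEN conjunct2, rule_format] and N = N[THEN conjunct1] N[THEN conjunct2, THEN conjunct1]
  obtain q' r' s' where B3: "pairs5 B N m' q q' r' s'"
    using pairs5_first[OF B(3), of q] N by auto
  note N' = B3[unfolded pairs5_def]
  note chB = N'[THEN conjunct2, THEN conjunct2, rule_format] and N' = N'[THEN conjunct1] N'[THEN conjunct2, THEN conjunct1]
  have "q' \<in> N" "q' \<noteq> m'" "q' \<noteq> q" using N' by auto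
  then consider "q' = r" | "q' = s" | "q' = m" using N by auto
  then show thesis
  proof cases
    case 1
    have "{m', q, r} \<union> {r', s'} = N" unfolding N'(2) 1 by auto
    moreover have "{m', q, r} \<union> {s, m} = N" unfolding N(2) by auto
    ultimately have e: "{r', s'} = {s, m}"
      by (rule disjoint_union_cancel) (use N(1) N'(1) 1 in auto)
    have ch: "cherry B N P \<longleftrightarrow> P = {q, r} \<or> P = {s, m}" for P by (simp only: chB e 1)
    have Ns: "N = {m', q, r, s, m}" using N(2) by auto
    have "circ A [m', q, r, s, m]"
      by (rule circ_of_cherries5[OF A(1,2) Ns]) (use N(1) in \<open>auto simp: chA doubleton_eq_iff\<close>)
    moreover have "circ B [m', q, r, s, m]"
      by (rule circ_of_cherries5[OF B(1,2) Ns]) (use N(1) in \<open>auto simp: ch doubleton_eq_iff\<close>)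
    ultimately show thesis using that[of "[m', q, r, s, m]"] N(1) Ns by auto
  next
    case 2
    have "{m', q, s} \<union> {r', s'} = N" unfolding N'(2) 2 by auto
    moreover have "{m', q, s} \<union> {r, m} = N" unfolding N(2) by auto
    ultimately have e: "{r', s'} = {r, m}"
      by (rule disjoint_union_cancel) (use N(1) N'(1) 2 in auto)
    have ch: "cherry B N P \<longleftrightarrow> P = {q, s} \<or> P = {r, m}" for P by (simp only: chB e 2)
    have Ns: "N = {m', q, s, r, m}" using N(2) by auto
    have "circ A [m', q, s, r, m]"
      by (rule circ_of_cherries5[OF A(1,2) Ns]) (use N(1) in \<open>auto simp: chA doubleton_eq_iff\<close>)
    moreover have "circ B [m', q, s, r, m]"
      by (rule circ_of_cherries5[OF B(1,2) Ns]) (use N(1) in \<open>auto simp: ch doubleton_eq_iff\<close>)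
    ultimately show thesis using that[of "[m', q, s, r, m]"] N(1) Ns by auto
  next
    case 3
    have "{m', q, m} \<union> {r', s'} = N" unfolding N'(2) 3 by auto
    moreover have "{m', q, m} \<union> {r, s} = N" unfolding N(2) by auto
    ultimately have e: "{r', s'} = {r, s}"
      by (rule disjoint_union_cancel) (use N(1) N'(1) 3 in auto)
    have ch: "cherry B N P \<longleftrightarrow> P = {q, m} \<or> P = {r, s}" for P by (simp only: chB e 3)
    have Ns: "N = {m', q, m, r, s}" using N(2) by auto
    have "circ A [m', q, m, r, s]"
      by (rule circ_of_cherries5[OF A(1,2) Ns]) (use N(1) in \<open>auto simp: chA doubleton_eq_iff\<close>)
    moreover have "circ B [m', q, m, r, s]"
      by (rule circ_of_cherries5[OF B(1,2) Ns]) (use N(1) in \<open>auto simp: ch doubleton_eq_iff\<close>)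
    ultimately show thesis using that[of "[m', q, m, r, s]"] N(1) Ns by auto
  qed
qed

text \<open>The cherries are now two perfect matchings of six points. Their union is three doubled
  edges, or a hexagon, each of which is itself the order, or a doubled edge with a cycle of length
  four; in the last case a point of the doubled edge serves as \<open>m\<close> of an
  obstruction.\<close>

lemma circular_order_pairs6:
  assumes A: "split_system N A" "thin A N" "pairs6 A N p q r s t u"
    and B: "split_system N B" "thin B N" "pairs6 B N p' q' r' s' t' u'"
    and free: "\<And>m a b c d. {m, a, b, c, d} \<subseteq> N \<Longrightarrow> \<not> obs A B {m} a b c d"
  obtains xs where "distinct xs" "set xs = N" "circ A xs" "circ B xs"
proof -
  have "p \<in> N" using A(3) unfolding pairs6_def by simp
  then obtain q' r' s' t' u' where B3: "pairs6 B N p q' r' s' t' u'"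
    using pairs6_first[OF B(3)] by blast
  show thesis
  proof (cases "q' = q")
    case True
    note N = A(3)[unfolded pairs6_def]
    note chA = N[THEN conjunct2, THEN conjunct2, rule_format] and N = N[THEN conjunct1] N[THEN conjunct2, THEN conjunct1]
    obtain s' t' u' where "pairs6 B N p q r s' t' u'"
      using pairs6_second[OF B3, of r] N True by auto
    note N' = this[unfolded pairs6_def]
    note chB = N'[THEN conjunct2, THEN conjunct2, rule_format] and N' = N'[THEN conjunct1] N'[THEN conjunct2, THEN conjunct1]
    have "s' \<in> N" "s' \<noteq> p" "s' \<noteq> q" "s' \<noteq> r" using N' by auto
    then consider "s' = s" | "s' = t" | "s' = u" using N by auto
    then show thesis
    proof cases
      case 1
      have "{p, q, r, s} \<union> {t', u'} = N" unfolding N'(2) 1 by auto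
      moreover have "{p, q, r, s} \<union> {t, u} = N" unfolding N(2) by auto
      ultimately have e: "{t', u'} = {t, u}"
        by (rule disjoint_union_cancel) (use N(1) N'(1) 1 in auto)
      have ch: "cherry B N P \<longleftrightarrow> P = {p, q} \<or> P = {r, s} \<or> P = {t, u}" for P by (simp only: chB e 1)
      have Ns: "N = {p, q, r, s, t, u}" using N(2) by auto
      have "circ A [p, q, r, s, t, u]"
        by (rule circ_of_cherries6[OF A(1,2) Ns]) (use N(1) in \<open>auto simp: chA doubleton_eq_iff\<close>)
      moreover have "circ B [p, q, r, s, t, u]"
        by (rule circ_of_cherries6[OF B(1,2) Ns]) (use N(1) in \<open>auto simp: ch doubleton_eq_iff\<close>)
      ultimately show thesis using that[of "[p, q, r, s, t, u]"] N(1) Ns by auto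
    next
      case 2
      have "{p, q, r, t} \<union> {t', u'} = N" unfolding N'(2) 2 by auto
      moreover have "{p, q, r, t} \<union> {s, u} = N" unfolding N(2) by auto
      ultimately have e: "{t', u'} = {s, u}"
        by (rule disjoint_union_cancel) (use N(1) N'(1) 2 in auto)
      have "cherry B N {r, t}" "cherry B N {s, u}" by (simp_all add: chB e 2 insert_commute)
      moreover have "{p, r, s, t, u} \<subseteq> N" "distinct [p, r, s, t, u]" using N by auto
      moreover have "cherry A N {r, s}" "cherry A N {t, u}" by (simp_all add: chA insert_commute)
      ultimately have "obs A B {p} r s t u" by (intro obs_of_cherries[OF A(1) B(1)])
      then show thesis using free N by blast
    next
      case 3
      have "{p, q, r, u} \<union> {t', u'} = N" unfolding N'(2) 3 by auto
      moreover have "{p, q, r, u} \<union> {s, t} = N" unfolding N(2) by auto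
      ultimately have e: "{t', u'} = {s, t}"
        by (rule disjoint_union_cancel) (use N(1) N'(1) 3 in auto)
      have "cherry B N {r, u}" "cherry B N {s, t}" by (simp_all add: chB e 3 insert_commute)
      moreover have "{p, r, s, u, t} \<subseteq> N" "distinct [p, r, s, u, t]" using N by auto
      moreover have "cherry A N {r, s}" "cherry A N {u, t}" by (simp_all add: chA insert_commute)
      ultimately have "obs A B {p} r s u t" by (intro obs_of_cherries[OF A(1) B(1)])
      then show thesis using free N by blast
    qed
  next
    case False
    have q': "q' \<in> N" "q' \<noteq> p" using B3 unfolding pairs6_def by auto
    obtain s t u where A3: "pairs6 A N p q q' s t u"
      using pairs6_second[OF A(3) q' False] by blast
    note N = A3[unfolded pairs6_def]
    note chA = N[THEN conjunct2, THEN conjunct2, rule_format] and N = N[THEN conjunct1] N[THEN conjunct2, THEN conjunct1]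
    obtain s' t' u' where "pairs6 B N p q' q s' t' u'"
      using pairs6_second[OF B3, of q] N by auto
    note N' = this[unfolded pairs6_def]
    note chB = N'[THEN conjunct2, THEN conjunct2, rule_format] and N' = N'[THEN conjunct1] N'[THEN conjunct2, THEN conjunct1]
    have "s' \<in> N" "s' \<noteq> p" "s' \<noteq> q" "s' \<noteq> q'" using N' by auto
    then consider "s' = s" | "s' = t" | "s' = u" using N by auto
    then show thesis
    proof cases
      case 1
      have "cherry B N {p, q'}" "cherry B N {q, s}" by (simp_all add: chB 1)
      moreover have "{t, p, q, q', s} \<subseteq> N" "distinct [t, p, q, q', s]" using N by auto
      moreover have "cherry A N {p, q}" "cherry A N {q', s}" by (simp_all add: chA insert_commute)
      ultimately have "obs A B {t} p q q' s" by (intro obs_of_cherries[OF A(1) B(1)])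
      then show thesis using free N by blast
    next
      case 2
      have "{p, q', q, t} \<union> {t', u'} = N" unfolding N'(2) 2 by auto
      moreover have "{p, q', q, t} \<union> {s, u} = N" unfolding N(2) by auto
      ultimately have e: "{t', u'} = {s, u}"
        by (rule disjoint_union_cancel) (use N(1) N'(1) 2 in auto)
      have ch: "cherry B N P \<longleftrightarrow> P = {p, q'} \<or> P = {q, t} \<or> P = {s, u}" for P by (simp only: chB e 2)
      have Ns: "N = {q', p, q, t, u, s}" using N(2) by auto
      have "circ A [q', p, q, t, u, s]"
        by (rule circ_of_cherries6[OF A(1,2) Ns]) (use N(1) in \<open>auto simp: chA doubleton_eq_iff\<close>)
      moreover have "circ B [q', p, q, t, u, s]"
        by (rule circ_of_cherries6[OF B(1,2) Ns]) (use N(1) in \<open>auto simp: ch doubleton_eq_iff\<close>)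
      ultimately show thesis using that[of "[q', p, q, t, u, s]"] N(1) Ns by auto
    next
      case 3
      have "{p, q', q, u} \<union> {t', u'} = N" unfolding N'(2) 3 by auto
      moreover have "{p, q', q, u} \<union> {s, t} = N" unfolding N(2) by auto
      ultimately have e: "{t', u'} = {s, t}"
        by (rule disjoint_union_cancel) (use N(1) N'(1) 3 in auto)
      have ch: "cherry B N P \<longleftrightarrow> P = {p, q'} \<or> P = {q, u} \<or> P = {s, t}" for P by (simp only: chB e 3)
      have Ns: "N = {q', p, q, u, t, s}" using N(2) by auto
      have "circ A [q', p, q, u, t, s]"
        by (rule circ_of_cherries6[OF A(1,2) Ns]) (use N(1) in \<open>auto simp: chA doubleton_eq_iff\<close>)
      moreover have "circ B [q', p, q, u, t, s]"
        by (rule circ_of_cherries6[OF B(1,2) Ns]) (use N(1) in \<open>auto simp: ch doubleton_eq_iff\<close>)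
      ultimately show thesis using that[of "[q', p, q, u, t, s]"] N(1) Ns by auto
    qed
  qed
qed

section \<open>Existence of a common circular order\<close>

lemma split_system_closed: "split_system N A \<Longrightarrow> \<forall>G\<in>A. - G \<in> A"
  using split_system_compl by blast

text \<open>Each half is enlarged by the two ends that \<open>crossing_ends\<close> provides in the
  other half. The enlarged halves are still smaller than \<open>N\<close>, so they have common
  orders, which are cut at the stand-ins and glued; one pair of lists serves both systems at
  once.\<close>

lemma circular_order_split:
  assumes A: "split_system N A" and B: "split_system N B" and fin: "finite N"
    and free: "\<And>m a b c d. {m, a, b, c, d} \<subseteq> N \<Longrightarrow> \<not> obs A B {m} a b c d"
    and IH: "\<And>N'. N' \<subseteq> N \<Longrightarrow> card N' < card N \<Longrightarrow>
      \<exists>xs. distinct xs \<and> set xs = N' \<and> circ A xs \<and> circ B xs"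
    and Z: "Z \<in> A" "3 \<le> card (N \<inter> Z)" "3 \<le> card (N - Z)"
  shows "\<exists>xs. distinct xs \<and> set xs = N \<and> circ A xs \<and> circ B xs"
proof -
  define S where "S = N \<inter> Z"
  define S' where "S' = N - S"
  have S'_eq: "S' = N - Z" unfolding S_def S'_def by blast
  have cards: "3 \<le> card S" "3 \<le> card S'" using Z unfolding S_def S'_eq by auto
  have N: "N = S \<union> S'" "S \<inter> S' = {}" unfolding S_def S'_def by auto
  have card_N: "card N = card S + card S'"
    using N fin by (metis card_Un_disjoint finite_Un)
  note clA = split_system_closed[OF A] and clB = split_system_closed[OF B]
  obtain l r l' r' where lr: "l \<in> S" "r \<in> S" "l' \<in> S'" "r' \<in> S'" "l \<noteq> r" "l' \<noteq> r'"
    and cross: "\<And>G. G \<in> B \<Longrightarrow> S \<inter> G = {} \<or> S \<subseteq> G \<or> S' \<inter> G = {} \<or> S' \<subseteq> G \<or>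
      {l, l'} \<subseteq> G \<and> {r, r'} \<inter> G = {} \<or> {r, r'} \<subseteq> G \<and> {l, l'} \<inter> G = {}"
  proof (rule crossing_ends[OF A B fin Z(1) S_def[symmetric] S'_def free])
    show "2 \<le> card S" "2 \<le> card S'" using cards by auto
  qed auto
  \<comment> \<open>As \<open>Z\<close> belongs to \<open>A\<close>, compatibility within
    \<open>A\<close> shows that only splits of \<open>B\<close> can cross the cut.\<close>
  have crossA: "S \<inter> G = {} \<or> S \<subseteq> G \<or> S' \<inter> G = {} \<or> S' \<subseteq> G" if "G \<in> A" for G
    using split_system_compat[OF A that Z(1)] unfolding S_def S'_eq by blast
  have "card (S \<union> {l', r'}) \<le> card S + 2"
    using card_Un_le[of S "{l', r'}"] lr(6) by simp
  moreover have "S \<union> {l', r'} \<subseteq> N" using N lr by blast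
  ultimately obtain xs where xs: "distinct xs" "set xs = S \<union> {l', r'}" "circ A xs" "circ B xs"
    using IH[of "S \<union> {l', r'}"] cards card_N by auto
  have "card (S' \<union> {l, r}) \<le> card S' + 2"
    using card_Un_le[of S' "{l, r}"] lr(5) by simp
  moreover have "S' \<union> {l, r} \<subseteq> N" using N lr by blast
  ultimately obtain ys where ys: "distinct ys" "set ys = S' \<union> {l, r}" "circ A ys" "circ B ys"
    using IH[of "S' \<union> {l, r}"] cards card_N by auto
  have "l' \<notin> S" "r' \<notin> S" "l \<notin> S'" "r \<notin> S'" using N lr by auto
  have ZS: "S \<subseteq> Z" "l' \<notin> Z" "r' \<notin> Z" "S' \<subseteq> - Z" "l \<notin> - Z" "r \<notin> - Z"
    using lr unfolding S_def S'_def by auto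
  obtain s where s: "set s = S" "distinct s" "\<And>C. \<forall>G\<in>C. - G \<in> C \<Longrightarrow> circ C xs \<Longrightarrow> circ C (l' # s @ [r'])"
    using circ_cut[OF xs(3) clA xs(1,2) lr(6) \<open>l' \<notin> S\<close> \<open>r' \<notin> S\<close> Z(1) ZS(1-3)] by blast
  have Z': "- Z \<in> A" using clA Z(1) by blast
  obtain t where t: "set t = S'" "distinct t" "\<And>C. \<forall>G\<in>C. - G \<in> C \<Longrightarrow> circ C ys \<Longrightarrow> circ C (l # t @ [r])"
    using circ_cut[OF ys(3) clA ys(1,2) lr(5) \<open>l \<notin> S'\<close> \<open>r \<notin> S'\<close> Z' ZS(4-6)] by blast
  have "circ A (s @ rev t)"
    by (rule circ_glue[OF clA s(3)[OF clA xs(3)] t(3)[OF clA ys(3)] s(1) t(1) lr(1-4)])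
      (use crossA in blast)
  moreover have "circ B (s @ rev t)"
    by (rule circ_glue[OF clB s(3)[OF clB xs(4)] t(3)[OF clB ys(4)] s(1) t(1) lr(1-4) cross])
  moreover have "distinct (s @ rev t)" "set (s @ rev t) = N" using s t N by auto
  ultimately show ?thesis by blast
qed

lemma circ_four:
  assumes "\<forall>G\<in>A. - G \<in> A" "\<not> sep A {a, c} {b, d}"
  shows "circ A [a, b, c, d]"
  unfolding circ_def
proof (intro ballI allI impI notI)
  fix G w x y z
  assume "G \<in> A" "subseq [w, x, y, z] [a, b, c, d]" and alt: "w \<in> G \<and> x \<notin> G \<and> y \<in> G \<and> z \<notin> G"
  moreover from this(2) have "[w, x, y, z] = [a, b, c, d]" by (rule subseq_same_length) simp
  ultimately show False using assms(2) unfolding sep_def by auto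
qed

lemma sep_exclusive:
  assumes "split_system N A" "{a, b, c, d} \<subseteq> N" "sep A {a, b} {c, d}" "sep A {a, c} {b, d}"
  shows False
proof -
  obtain G where G: "G \<in> A" "a \<in> G" "b \<in> G" "c \<notin> G" "d \<notin> G"
    using assms(3) unfolding sep_def by auto
  obtain H where H: "H \<in> A" "a \<in> H" "c \<in> H" "b \<notin> H" "d \<notin> H"
    using assms(4) unfolding sep_def by auto
  have N: "a \<in> N" "b \<in> N" "c \<in> N" "d \<in> N" using assms(2) by auto
  show False
    by (rule split_system_compat[OF assms(1) G(1) H(1)]) (use N G(2-) H(2-) in blast)+
qed

text \<open>There are three ways to pair off four points, and each system realises at most one of
  them. Some pairing is realised by neither, and the order in which exactly its pairs alternate is
  good for both.\<close>

lemma circular_order_four: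
  assumes A: "split_system N A" and B: "split_system N B" and N: "card N = 4"
  shows "\<exists>xs. distinct xs \<and> set xs = N \<and> circ A xs \<and> circ B xs"
proof -
  have "finite N" using N card.infinite by fastforce
  then obtain ys where ys: "set ys = N" "distinct ys"
    using finite_distinct_list by blast
  then have "length ys = 4" using N distinct_card by fastforce
  then obtain a b c d where "ys = [a, b, c, d]"
    by (auto simp: numeral_eq_Suc length_Suc_conv)
  then have Ne: "N = {a, b, c, d}" and d: "distinct [a, b, c, d]" using ys by auto
  note cl = split_system_closed[OF A] split_system_closed[OF B]
  have "\<not> sep C {a, b} {c, d} \<or> \<not> sep C {a, c} {b, d}" "\<not> sep C {a, b} {c, d} \<or> \<not> sep C {a, d} {b, c}"
    "\<not> sep C {a, c} {b, d} \<or> \<not> sep C {a, d} {b, c}" if "split_system N C" for C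
    using sep_exclusive[OF that, of a b c d] sep_exclusive[OF that, of a b d c]
      sep_exclusive[OF that, of a c d b] unfolding Ne by (auto simp: insert_commute)
  from this[OF A] this[OF B] consider
    "\<not> sep A {a, b} {c, d}" "\<not> sep B {a, b} {c, d}" | "\<not> sep A {a, c} {b, d}" "\<not> sep B {a, c} {b, d}"
    | "\<not> sep A {a, d} {b, c}" "\<not> sep B {a, d} {b, c}"
    by blast
  then show ?thesis
  proof cases
    case 1
    then have "circ A [a, c, b, d]" "circ B [a, c, b, d]" by (simp_all add: circ_four cl)
    then show ?thesis using Ne d by (intro exI[of _ "[a, c, b, d]"]) auto
  next
    case 2
    then have "circ A [a, b, c, d]" "circ B [a, b, c, d]" by (simp_all add: circ_four cl)
    then show ?thesis using Ne d by (intro exI[of _ "[a, b, c, d]"]) auto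
  next
    case 3
    then have "circ A [a, b, d, c]" "circ B [a, b, d, c]" by (simp_all add: circ_four cl)
    then show ?thesis using Ne d by (intro exI[of _ "[a, b, d, c]"]) auto
  qed
qed

text \<open>By induction on the number of points. The hypothesis is symmetric in the two systems by
  \<open>obs_swap\<close>, so either may supply the cut. Two thin systems on at least five points
  have the same shape, because the number of points determines it.\<close>

theorem circular_kuratowski:
  assumes "split_system N A" "split_system N B" "finite N"
    and "\<And>m a b c d. {m, a, b, c, d} \<subseteq> N \<Longrightarrow> \<not> obs A B {m} a b c d"
  shows "\<exists>xs. distinct xs \<and> set xs = N \<and> circ A xs \<and> circ B xs"
  using assms
proof (induction "card N" arbitrary: N rule: less_induct)
  case less
  note A = less.prems(1) and B = less.prems(2) and fin = less.prems(3) and free = less.prems(4)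
  have IH: "\<exists>xs. distinct xs \<and> set xs = N' \<and> circ A xs \<and> circ B xs"
    if N': "N' \<subseteq> N" "card N' < card N" for N'
  proof (rule less.hyps[OF N'(2)])
    show "split_system N' A" "split_system N' B" "finite N'"
      using N'(1) A B fin split_system_mono finite_subset by blast+
    show "\<not> obs A B {m} a b c d" if "{m, a, b, c, d} \<subseteq> N'" for m a b c d
      using free[of m a b c d] that N'(1) by blast
  qed
  show ?case
  proof (cases "thin A N \<and> thin B N")
    case False
    then consider Z where "Z \<in> A" "3 \<le> card (N \<inter> Z)" "3 \<le> card (N - Z)"
      | Z where "Z \<in> B" "3 \<le> card (N \<inter> Z)" "3 \<le> card (N - Z)"
      unfolding thin_def by (metis not_less_eq_eq numeral_2_eq_2 numeral_3_eq_3)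
    then show ?thesis
    proof cases
      case 1
      then show ?thesis using circular_order_split[OF A B fin free IH] by blast
    next
      case 2
      have "\<not> obs B A {m} a b c d" if "{m, a, b, c, d} \<subseteq> N" for m a b c d
        using free[of m a c b d] that unfolding obs_swap[of B A] by (simp add: insert_commute)
      moreover have "\<exists>xs. distinct xs \<and> set xs = N' \<and> circ B xs \<and> circ A xs"
        if N': "N' \<subseteq> N" "card N' < card N" for N'
        using IH[OF N'] by blast
      ultimately show ?thesis using circular_order_split[OF B A fin _ _ 2] by blast
    qed
  next
    case True
    then have tA: "thin A N" and tB: "thin B N" by auto
    consider "card N < 4" | "card N = 4" | "5 \<le> card N" by linarith
    then show ?thesis
    proof cases
      case 1
      obtain xs where "set xs = N" "distinct xs" using finite_distinct_list[OF fin] by blast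
      then show ?thesis
        using 1 distinct_card[of xs] by (intro exI[of _ xs]) (auto intro!: circ_short)
    next
      case 2
      then show ?thesis by (rule circular_order_four[OF A B])
    next
      case 3
      show ?thesis
      proof (rule thin_pairs[OF A tA 3])
        fix p q r s m
        assume "distinct [p, q, r, s, m]" "N = {p, q, r, s, m}" "\<And>P. cherry A N P \<longleftrightarrow> P = {p, q} \<or> P = {r, s}"
        then have p5: "pairs5 A N m p q r s" unfolding pairs5_def by simp
        then have "card N = 5" unfolding pairs5_def by auto
        show ?thesis
        proof (rule thin_pairs[OF B tB 3])
          fix p' q' r' s' m'
          assume "distinct [p', q', r', s', m']" "N = {p', q', r', s', m'}"
            "\<And>P. cherry B N P \<longleftrightarrow> P = {p', q'} \<or> P = {r', s'}"
          then have "pairs5 B N m' p' q' r' s'" unfolding pairs5_def by simp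
          then show ?thesis
            using circular_order_pairs5[OF A tA p5 B tB _ free] by metis
        next
          fix p' q' r' s' t' u'
          assume "distinct [p', q', r', s', t', u']" "N = {p', q', r', s', t', u'}"
          then have "card N = 6" by simp
          with \<open>card N = 5\<close> show ?thesis by simp
        qed
      next
        fix p q r s t u
        assume "distinct [p, q, r, s, t, u]" "N = {p, q, r, s, t, u}"
          "\<And>P. cherry A N P \<longleftrightarrow> P = {p, q} \<or> P = {r, s} \<or> P = {t, u}"
        then have p6: "pairs6 A N p q r s t u" unfolding pairs6_def by simp
        then have "card N = 6" unfolding pairs6_def by auto
        show ?thesis
        proof (rule thin_pairs[OF B tB 3])
          fix p' q' r' s' t' u'
          assume "distinct [p', q', r', s', t', u']" "N = {p', q', r', s', t', u'}"
            "\<And>P. cherry B N P \<longleftrightarrow> P = {p', q'} \<or> P = {r', s'} \<or> P = {t', u'}"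
          then have "pairs6 B N p' q' r' s' t' u'" unfolding pairs6_def by simp
          then show ?thesis
            using circular_order_pairs6[OF A tA p6 B tB _ free] by metis
        next
          fix p' q' r' s' m'
          assume "distinct [p', q', r', s', m']" "N = {p', q', r', s', m'}"
          then have "card N = 5" by simp
          with \<open>card N = 6\<close> show ?thesis by simp
        qed
      qed
    qed
  qed
qed

section \<open>Exchanging the points of an obstruction\<close>

text \<open>The point \<open>x\<close> common to both sides rules out disjointness, the point
  \<open>y\<close> outside both rules out that they cover \<open>N\<close>.
  \<open>compat_disjoint\<close> likewise leaves one case of four.\<close>

lemma compat_nested:
  assumes "split_system N A" "G \<in> A" "H \<in> A" "x \<in> N" "x \<in> G" "x \<in> H" "y \<in> N" "y \<notin> G" "y \<notin> H"
  shows "N \<inter> G \<subseteq> H \<or> N \<inter> H \<subseteq> G"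
  by (rule split_system_compat[OF assms(1-3)]) (use assms(4-9) in blast)+

lemma compat_disjoint:
  assumes "split_system N A" "G \<in> A" "H \<in> A" "x \<in> N" "x \<in> G" "x \<notin> H" "y \<in> N" "y \<in> H" "y \<notin> G"
    and "w \<in> N" "w \<notin> G" "w \<notin> H"
  shows "N \<inter> G \<inter> H = {}"
  by (rule split_system_compat[OF assms(1-3)]) (use assms(4-12) in blast)+

text \<open>Only the set of five points is constrained, not their roles, since an exchange may give
  the role of \<open>m\<close> to another point.\<close>

definition obs_via :: "'a set set \<Rightarrow> 'a set set \<Rightarrow> 'a set \<Rightarrow> 'a set \<Rightarrow> bool" where
  "obs_via A B P Q \<longleftrightarrow>
     (\<exists>m a b c d. obs A B {m} a b c d \<and> P \<subseteq> {m, a, b, c, d} \<and> {m, a, b, c, d} \<subseteq> Q)"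

lemma obs_viaI:
  "obs A B {m} a b c d \<Longrightarrow> P \<subseteq> {m, a, b, c, d} \<Longrightarrow> {m, a, b, c, d} \<subseteq> Q \<Longrightarrow> obs_via A B P Q"
  unfolding obs_via_def by blast

lemma obs_viaE:
  assumes "obs_via A B P Q"
  obtains m a b c d where "obs A B {m} a b c d" "P \<subseteq> {m, a, b, c, d}" "{m, a, b, c, d} \<subseteq> Q"
  using assms unfolding obs_via_def by (elim exE conjE) (rule that)

lemma obsI:
  assumes "G1 \<in> A" "{a, b} \<subseteq> G1" "c \<notin> G1" "d \<notin> G1" "m \<notin> G1"
    and "G2 \<in> A" "{c, d} \<subseteq> G2" "a \<notin> G2" "b \<notin> G2" "m \<notin> G2"
    and "H1 \<in> B" "{a, c} \<subseteq> H1" "b \<notin> H1" "d \<notin> H1" "m \<notin> H1"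
    and "H2 \<in> B" "{b, d} \<subseteq> H2" "a \<notin> H2" "c \<notin> H2" "m \<notin> H2"
  shows "obs A B {m} a b c d"
proof -
  have "sep A {a, b} ({c, d} \<union> {m})" unfolding sep_def using assms(1-5) by (intro bexI[of _ G1]) auto
  moreover have "sep A {c, d} ({a, b} \<union> {m})" unfolding sep_def using assms(6-10) by (intro bexI[of _ G2]) auto
  moreover have "sep B {a, c} ({b, d} \<union> {m})" unfolding sep_def using assms(11-15) by (intro bexI[of _ H1]) auto
  moreover have "sep B {b, d} ({a, c} \<union> {m})" unfolding sep_def using assms(16-20) by (intro bexI[of _ H2]) auto
  ultimately show ?thesis unfolding obs_def by blast
qed

lemma sepE2:
  assumes "sep A {x, y} {z, w}"
  obtains G where "G \<in> A" "x \<in> G" "y \<in> G" "z \<notin> G" "w \<notin> G"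
proof -
  obtain G where "G \<in> A" "{x, y} \<subseteq> G" "{z, w} \<inter> G = {}"
    using assms unfolding sep_def by blast
  then show thesis using that[of G] by simp
qed

lemma sepE2_compl:
  assumes "\<forall>G\<in>A. - G \<in> A" "sep A {x, y} {z, w}"
  obtains G where "G \<in> A" "z \<in> G" "w \<in> G" "x \<notin> G" "y \<notin> G"
  using sep_sym[OF assms] by (rule sepE2)

lemma obsE:
  assumes "obs A B {m} a b c d"
  obtains G1 G2 H1 H2 where
    "G1 \<in> A" "a \<in> G1" "b \<in> G1" "c \<notin> G1" "d \<notin> G1" "m \<notin> G1"
    "G2 \<in> A" "c \<in> G2" "d \<in> G2" "a \<notin> G2" "b \<notin> G2" "m \<notin> G2"
    "H1 \<in> B" "a \<in> H1" "c \<in> H1" "b \<notin> H1" "d \<notin> H1" "m \<notin> H1"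
    "H2 \<in> B" "b \<in> H2" "d \<in> H2" "a \<notin> H2" "c \<notin> H2" "m \<notin> H2"
proof -
  from assms have s: "sep A {a, b} ({c, d} \<union> {m})" "sep A {c, d} ({a, b} \<union> {m})"
    "sep B {a, c} ({b, d} \<union> {m})" "sep B {b, d} ({a, c} \<union> {m})"
    unfolding obs_def by auto
  obtain G1 where "G1 \<in> A" "{a, b} \<subseteq> G1" "({c, d} \<union> {m}) \<inter> G1 = {}"
    using s(1) unfolding sep_def by blast
  moreover obtain G2 where "G2 \<in> A" "{c, d} \<subseteq> G2" "({a, b} \<union> {m}) \<inter> G2 = {}"
    using s(2) unfolding sep_def by blast
  moreover obtain H1 where "H1 \<in> B" "{a, c} \<subseteq> H1" "({b, d} \<union> {m}) \<inter> H1 = {}"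
    using s(3) unfolding sep_def by blast
  moreover obtain H2 where "H2 \<in> B" "{b, d} \<subseteq> H2" "({a, c} \<union> {m}) \<inter> H2 = {}"
    using s(4) unfolding sep_def by blast
  ultimately show thesis using that[of G1 G2 H1 H2] by simp
qed

text \<open>The hard case of the exchange: \<open>z\<close> lies in the side \<open>G1\<close> of
  \<open>a, b\<close> but in no other side, and \<open>A\<close> groups it with \<open>a\<close>
  against \<open>b\<close> and \<open>m\<close>. The way \<open>B\<close> resolves
  \<open>a, b, z, m\<close> decides which point gives way to \<open>z\<close>.\<close>

lemma obs_exchange_pair:
  assumes A: "split_system N A" and B: "split_system N B" and N: "{m, a, b, c, d, z} \<subseteq> N"
    and z: "z \<notin> {m, a, b, c, d}" and d: "distinct [m, a, b, c, d]"
    and G1: "G1 \<in> A" "a \<in> G1" "b \<in> G1" "c \<notin> G1" "d \<notin> G1" "m \<notin> G1"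
    and G2: "G2 \<in> A" "c \<in> G2" "d \<in> G2" "a \<notin> G2" "b \<notin> G2" "m \<notin> G2"
    and H1: "H1 \<in> B" "a \<in> H1" "c \<in> H1" "b \<notin> H1" "d \<notin> H1" "m \<notin> H1"
    and H2: "H2 \<in> B" "b \<in> H2" "d \<in> H2" "a \<notin> H2" "c \<notin> H2" "m \<notin> H2"
    and zin: "z \<in> G1" "z \<notin> G2" "z \<notin> H1" "z \<notin> H2" and K: "K \<in> A" "a \<in> K" "z \<in> K" "b \<notin> K" "m \<notin> K"
  shows "obs_via A B {m, z} {m, z, a, b, c, d}"
proof -
  have N': "m \<in> N" "a \<in> N" "b \<in> N" "c \<in> N" "d \<in> N" "z \<in> N" using N by auto
  have cK: "c \<notin> K" using compat_nested[OF A K(1) G1(1), of a m] K G1 N' by blast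
  note clo = split_system_closed[OF B]
  have "{a, b, z, m} \<subseteq> N" "distinct [a, b, z, m]" using z d N by auto
  with B show ?thesis
  proof (rule split_system_resolve)
    \<comment> \<open>Here \<open>d\<close> is dropped and \<open>b\<close> takes over the
      distinguished role, with \<open>m\<close> as an ordinary point. In the other two cases
      \<open>m\<close> keeps its role and \<open>z\<close> replaces \<open>a\<close> or
      \<open>b\<close>.\<close>
    assume "sep B {a, b} {z, m}"
    with clo obtain L where L: "L \<in> B" "z \<in> L" "m \<in> L" "a \<notin> L" "b \<notin> L"
      by (rule sepE2_compl)
    have "c \<notin> L" using compat_nested[OF B L(1) H1(1), of c b] L H1 N' by blast
    then have "obs A B {b} a z c m"
      using K G1 H1 L zin cK split_system_compl[OF A G1(1)]
      by (intro obsI[where ?G1.0 = K and ?G2.0 = "- G1" and ?H1.0 = H1 and ?H2.0 = L]) auto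
    then show ?thesis by (rule obs_viaI) auto
  next
    assume "sep B {a, z} {b, m}"
    then obtain L where L: "L \<in> B" "a \<in> L" "z \<in> L" "b \<notin> L" "m \<notin> L"
      by (rule sepE2)
    have "c \<in> L" using compat_nested[OF B L(1) H1(1), of a m] L H1 N' zin by blast
    moreover have "d \<notin> L" using compat_disjoint[OF B L(1) H2(1), of a b m] L H2 N' zin by blast
    ultimately have "obs A B {m} z b c d"
      using G1 G2 H2 L zin
      by (intro obsI[where ?G1.0 = G1 and ?G2.0 = G2 and ?H1.0 = L and ?H2.0 = H2]) auto
    then show ?thesis by (rule obs_viaI) auto
  next
    assume "sep B {a, m} {b, z}"
    with clo obtain L where L: "L \<in> B" "b \<in> L" "z \<in> L" "a \<notin> L" "m \<notin> L"
      by (rule sepE2_compl)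
    have "d \<in> L" using compat_nested[OF B L(1) H2(1), of b m] L H2 N' zin by blast
    moreover have "c \<notin> L" using compat_disjoint[OF B L(1) H1(1), of b a m] L H1 N' zin by blast
    ultimately have "obs A B {m} a z c d"
      using G1 G2 H1 L zin
      by (intro obsI[where ?G1.0 = G1 and ?G2.0 = G2 and ?H1.0 = H1 and ?H2.0 = L]) auto
    then show ?thesis by (rule obs_viaI) auto
  qed
qed

text \<open>If \<open>z\<close> is outside \<open>G1\<close>, then \<open>G1\<close> already
  separates it. If \<open>z\<close> lies in \<open>G1\<close> and in a column side, it sits in the
  cell of \<open>a\<close> or of \<open>b\<close> and can replace that point. Otherwise
  \<open>A\<close> resolves \<open>a, b, z, m\<close>: grouping \<open>a\<close> with
  \<open>b\<close> gives a smaller side without \<open>z\<close>, the other groupings are the case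
  of \<open>obs_exchange_pair\<close>.\<close>

lemma obs_exchange_side:
  assumes A: "split_system N A" and B: "split_system N B" and N: "{m, a, b, c, d, z} \<subseteq> N"
    and z: "z \<notin> {m, a, b, c, d}" and ob: "obs A B {m} a b c d"
  shows "obs_via A B {m, z} {m, z, a, b, c, d} \<or> sep A {a, b} ({c, d} \<union> {m, z})"
proof -
  have N': "m \<in> N" "a \<in> N" "b \<in> N" "c \<in> N" "d \<in> N" "z \<in> N" using N by auto
  have dist: "distinct [m, a, b, c, d]" using obs_distinct[OF ob] .
  obtain G1 G2 H1 H2 where
    G1: "G1 \<in> A" "a \<in> G1" "b \<in> G1" "c \<notin> G1" "d \<notin> G1" "m \<notin> G1" and
    G2: "G2 \<in> A" "c \<in> G2" "d \<in> G2" "a \<notin> G2" "b \<notin> G2" "m \<notin> G2" and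
    H1: "H1 \<in> B" "a \<in> H1" "c \<in> H1" "b \<notin> H1" "d \<notin> H1" "m \<notin> H1" and
    H2: "H2 \<in> B" "b \<in> H2" "d \<in> H2" "a \<notin> H2" "c \<notin> H2" "m \<notin> H2"
    using ob by (rule obsE)
  have GG: "N \<inter> G1 \<inter> G2 = {}"
    using G1 G2 N' by (intro compat_disjoint[OF A G1(1) G2(1), of a c m]) auto
  have HH: "N \<inter> H1 \<inter> H2 = {}"
    using H1 H2 N' by (intro compat_disjoint[OF B H1(1) H2(1), of a b m]) auto
  consider "z \<notin> G1" | "z \<in> G1" "z \<in> H1" | "z \<in> G1" "z \<in> H2" | "z \<in> G1" "z \<notin> H1" "z \<notin> H2" by blast
  then show ?thesis
  proof cases
    case 1
    then have "sep A {a, b} ({c, d} \<union> {m, z})"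
      unfolding sep_def using G1 by (intro bexI[of _ G1]) auto
    then show ?thesis ..
  next
    case 2
    then have "z \<notin> G2" "z \<notin> H2" using GG HH N' by auto
    then have "obs A B {m} z b c d"
      using G1 G2 H1 H2 2
      by (intro obsI[where ?G1.0 = G1 and ?G2.0 = G2 and ?H1.0 = H1 and ?H2.0 = H2]) auto
    then have "obs_via A B {m, z} {m, z, a, b, c, d}" by (rule obs_viaI) auto
    then show ?thesis ..
  next
    case 3
    then have "z \<notin> G2" "z \<notin> H1" using GG HH N' by auto
    then have "obs A B {m} a z c d"
      using G1 G2 H1 H2 3
      by (intro obsI[where ?G1.0 = G1 and ?G2.0 = G2 and ?H1.0 = H1 and ?H2.0 = H2]) auto
    then have "obs_via A B {m, z} {m, z, a, b, c, d}" by (rule obs_viaI) auto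
    then show ?thesis ..
  next
    case 4
    then have zG2: "z \<notin> G2" using GG N' by auto
    note clo = split_system_closed[OF A]
    have "{a, b, z, m} \<subseteq> N" "distinct [a, b, z, m]" using z dist N by auto
    with A show ?thesis
    proof (rule split_system_resolve)
      assume "sep A {a, b} {z, m}"
      then obtain K where K: "K \<in> A" "a \<in> K" "b \<in> K" "z \<notin> K" "m \<notin> K"
        by (rule sepE2)
      have "N \<inter> K \<subseteq> G1" using compat_nested[OF A K(1) G1(1), of a m] K G1 N' 4 by blast
      then have "sep A {a, b} ({c, d} \<union> {m, z})"
        unfolding sep_def using K G1 N' by (intro bexI[of _ K]) auto
      then show ?thesis ..
    next
      assume "sep A {a, z} {b, m}"
      then obtain K where K: "K \<in> A" "a \<in> K" "z \<in> K" "b \<notin> K" "m \<notin> K"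
        by (rule sepE2)
      have "obs_via A B {m, z} {m, z, a, b, c, d}"
        by (rule obs_exchange_pair[OF A B N z dist G1 G2 H1 H2 4(1) zG2 4(2,3) K])
      then show ?thesis ..
    next
      assume "sep A {a, m} {b, z}"
      with clo obtain K where K: "K \<in> A" "b \<in> K" "z \<in> K" "a \<notin> K" "m \<notin> K"
        by (rule sepE2_compl)
      have "obs_via A B {m, z} {m, z, b, a, d, c}"
        by (rule obs_exchange_pair[OF A B _ _ _ G1(1,3,2,5,4,6) G2(1,3,2,5,4,6)
              H2(1-3,4,5,6) H1(1-3,4,5,6) 4(1) zG2 4(3,2) K]) (use N z dist in auto)
      then show ?thesis by (simp add: insert_commute)
    qed
  qed
qed

text \<open>A further point either can replace a point of the obstruction other than \<open>m\<close>, or plays the same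
  role as \<open>m\<close>.\<close>

lemma obs_exchange:
  assumes A: "split_system N A" and B: "split_system N B" and N: "{m, a, b, c, d, z} \<subseteq> N"
    and z: "z \<notin> {m, a, b, c, d}" and ob: "obs A B {m} a b c d"
  shows "obs_via A B {m, z} {m, z, a, b, c, d} \<or> obs A B {m, z} a b c d"
proof -
  have sw: "obs_via B A P Q \<longleftrightarrow> obs_via A B P Q" for P Q
  proof
    assume "obs_via B A P Q"
    then obtain m a b c d where "obs B A {m} a b c d" "P \<subseteq> {m, a, b, c, d}" "{m, a, b, c, d} \<subseteq> Q"
      by (rule obs_viaE)
    then show "obs_via A B P Q"
      using obs_swap[of B A "{m}" a b c d] by (intro obs_viaI[of A B m a c b d]) auto
  next
    assume "obs_via A B P Q"
    then obtain m a b c d where "obs A B {m} a b c d" "P \<subseteq> {m, a, b, c, d}" "{m, a, b, c, d} \<subseteq> Q"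
      by (rule obs_viaE)
    then show "obs_via B A P Q"
      using obs_swap[of A B "{m}" a b c d] by (intro obs_viaI[of B A m a c b d]) auto
  qed
  have ob': "obs A B {m} c d a b" "obs B A {m} a c b d" "obs B A {m} b d a c"
    using ob obs_rows[of A B "{m}" a b c d] obs_swap[of A B "{m}" a b c d] obs_rows[of B A "{m}" a c b d]
    by simp_all
  \<comment> \<open>The four sides of the table are treated alike after moving the respective side
    to the first row by transposing and exchanging rows.\<close>
  have 1: "obs_via A B {m, z} {m, z, a, b, c, d} \<or> sep A {a, b} ({c, d} \<union> {m, z})"
    by (rule obs_exchange_side[OF A B N z ob])
  have 2: "obs_via A B {m, z} {m, z, a, b, c, d} \<or> sep A {c, d} ({a, b} \<union> {m, z})"
    using obs_exchange_side[OF A B _ _ ob'(1), of z] N z by (simp add: insert_commute)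
  have 3: "obs_via A B {m, z} {m, z, a, b, c, d} \<or> sep B {a, c} ({b, d} \<union> {m, z})"
    using obs_exchange_side[OF B A _ _ ob'(2), of z] N z unfolding sw by (simp add: insert_commute)
  have 4: "obs_via A B {m, z} {m, z, a, b, c, d} \<or> sep B {b, d} ({a, c} \<union> {m, z})"
    using obs_exchange_side[OF B A _ _ ob'(3), of z] N z unfolding sw by (simp add: insert_commute)
  show ?thesis using 1 2 3 4 unfolding obs_def by blast
qed

lemma obs_mono:
  assumes "obs A B M a b c d" "M' \<subseteq> M"
  shows "obs A B M' a b c d"
proof -
  have *: "sep C P (Q \<union> M')" if "sep C P (Q \<union> M)" for C P Q
    using sep_mono[OF that] assms(2) by blast
  show ?thesis using assms(1) unfolding obs_def by (elim conjE) (intro conjI *)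
qed

lemma obs_reroot:
  assumes "split_system N A" "split_system N B" "z \<in> N" "{m, a, b, c, d} \<subseteq> N" "obs A B {m} a b c d"
  shows "obs_via A B {z} N"
proof (cases "z \<in> {m, a, b, c, d}")
  case True
  then have "{z} \<subseteq> {m, a, b, c, d}" by simp
  then show ?thesis using assms(4) by (rule obs_viaI[OF assms(5)])
next
  case False
  have "{m, a, b, c, d, z} \<subseteq> N" using assms(3,4) by auto
  then have "obs_via A B {m, z} {m, z, a, b, c, d} \<or> obs A B {m, z} a b c d"
    using False assms(5) by (rule obs_exchange[OF assms(1,2)])
  then show ?thesis
  proof
    assume "obs_via A B {m, z} {m, z, a, b, c, d}"
    then obtain m' a' b' c' d' where "obs A B {m'} a' b' c' d'" "{m, z} \<subseteq> {m', a', b', c', d'}"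
      "{m', a', b', c', d'} \<subseteq> {m, z, a, b, c, d}"
      by (rule obs_viaE)
    moreover have "{m, z, a, b, c, d} \<subseteq> N" using assms(3,4) by auto
    ultimately show ?thesis by (intro obs_viaI[of A B m' a' b' c' d']) (assumption, simp, rule order_trans)
  next
    assume "obs A B {m, z} a b c d"
    then have "obs A B {z} a b c d" by (rule obs_mono) auto
    then show ?thesis by (rule obs_viaI) (use assms(3,4) in auto)
  qed
qed

section \<open>The circular orders around a single obstruction\<close>

text \<open>Splits that contain \<open>a, b\<close> and avoid \<open>m\<close> are nested on
  \<open>N\<close>; the smallest of them therefore avoids everything that any of them
  avoids.\<close>

lemma exact_side:
  assumes A: "split_system N A" and fin: "finite N" and N: "a \<in> N" "b \<in> N" "m \<in> N"
    and ex: "\<And>z. z \<in> N - {a, b} \<Longrightarrow> \<exists>G\<in>A. a \<in> G \<and> b \<in> G \<and> m \<notin> G \<and> z \<notin> G"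
    and m: "m \<noteq> a" "m \<noteq> b"
  obtains G where "G \<in> A" "N \<inter> G = {a, b}"
proof -
  define P where "P G \<longleftrightarrow> G \<in> A \<and> a \<in> G \<and> b \<in> G \<and> m \<notin> G" for G
  have "\<exists>G. P G" using ex[of m] N m unfolding P_def by blast
  then obtain G where G: "P G" "\<And>H. P H \<Longrightarrow> card (N \<inter> G) \<le> card (N \<inter> H)"
    using ex_has_least_nat[of P _ "\<lambda>G. card (N \<inter> G)"] by blast
  have "N \<inter> G \<subseteq> {a, b}"
  proof
    fix z assume z: "z \<in> N \<inter> G"
    show "z \<in> {a, b}"
    proof (rule ccontr)
      assume "z \<notin> {a, b}"
      with z ex[of z] obtain H where H: "P H" "z \<notin> H" unfolding P_def by blast
      have "N \<inter> H \<subseteq> G"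
        using compat_nested[OF A, of G H a m] G(1) H N z unfolding P_def by blast
      then have "card (N \<inter> H) < card (N \<inter> G)"
        using z H(2) fin by (intro psubset_card_mono) auto
      then show False using G(2)[OF H(1)] by simp
    qed
  qed
  then have "N \<inter> G = {a, b}" using G(1) N unfolding P_def by blast
  then show thesis using that G(1) unfolding P_def by blast
qed

lemma almost_circular_order:
  assumes A: "split_system N A" and B: "split_system N B" and fin: "finite N"
    and N: "{m, a, b, c, d} \<subseteq> N" and ob: "obs A B {m} a b c d"
    and uniq: "\<And>p q r s t. obs A B {p} q r s t \<Longrightarrow> {p, q, r, s, t} \<subseteq> N \<Longrightarrow> m \<in> {p, q, r, s, t} \<Longrightarrow>
      {p, q, r, s, t} = {m, a, b, c, d}"
  obtains us vs where "distinct (m # us @ [a, b, c, d] @ vs)" "set (m # us @ [a, b, c, d] @ vs) = N"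
    "circ A (m # us @ [a, b, c, d] @ vs)" "circ B (m # us @ [a, c, b, d] @ vs)"
proof -
  have N': "m \<in> N" "a \<in> N" "b \<in> N" "c \<in> N" "d \<in> N" using N by auto
  have dist: "distinct [m, a, b, c, d]" using obs_distinct[OF ob] .
  note clA = split_system_closed[OF A] and clB = split_system_closed[OF B]
  have no: False if "obs A B {m} q r s t" "{q, r, s, t} \<subseteq> N" "z \<in> {q, r, s, t}" "z \<notin> {m, a, b, c, d}"
    for q r s t z
    using uniq[OF that(1)] that N' by blast
  \<comment> \<open>An exchange would give an obstruction through \<open>m\<close> and
    \<open>z\<close>, contrary to \<open>uniq\<close>; so every further point plays the role of
    \<open>m\<close>. This is what makes the four sides exact.\<close>
  have avoid: "obs A B {m, z} a b c d" if z: "z \<in> N" "z \<notin> {m, a, b, c, d}" for z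
  proof -
    have "\<not> obs_via A B {m, z} {m, z, a, b, c, d}"
    proof
      assume "obs_via A B {m, z} {m, z, a, b, c, d}"
      then obtain p q r s t where p: "obs A B {p} q r s t" "{m, z} \<subseteq> {p, q, r, s, t}"
        "{p, q, r, s, t} \<subseteq> {m, z, a, b, c, d}"
        by (rule obs_viaE)
      have "{m, z, a, b, c, d} \<subseteq> N" using z N by auto
      then have "{p, q, r, s, t} \<subseteq> N" using p(3) by (rule order_trans[rotated])
      then have "{p, q, r, s, t} = {m, a, b, c, d}" using uniq[OF p(1)] p(2) by blast
      then show False using p(2) z by blast
    qed
    then show ?thesis
      using obs_exchange[OF A B _ z(2) ob] z(1) N by auto
  qed
  have side: "\<exists>G\<in>C. x \<in> G \<and> y \<in> G \<and> m \<notin> G \<and> z \<notin> G"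
    if "sep C {x, y} ({u, w} \<union> {m})"
      "\<And>z. z \<in> N \<Longrightarrow> z \<notin> {m, a, b, c, d} \<Longrightarrow> sep C {x, y} ({u, w} \<union> {m, z})"
      "{m, a, b, c, d} \<subseteq> {m, x, y, u, w}" "z \<in> N - {x, y}" for C x y u w z
  proof (cases "z \<in> {m, a, b, c, d}")
    case True
    then have "z \<in> {u, w, m}" using that(3,4) by blast
    then show ?thesis using that(1) unfolding sep_def by auto
  next
    case False
    then show ?thesis using that(2)[of z] that(4) unfolding sep_def by auto
  qed
  obtain G1 where G1: "G1 \<in> A" "N \<inter> G1 = {a, b}"
  proof (rule exact_side[OF A fin N'(2,3,1)])
    show "\<exists>G\<in>A. a \<in> G \<and> b \<in> G \<and> m \<notin> G \<and> z \<notin> G" if "z \<in> N - {a, b}" for z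
      by (rule side[of A a b c d]) (use that ob avoid in \<open>auto simp: obs_def\<close>)
  qed (use dist in auto)
  obtain G2 where G2: "G2 \<in> A" "N \<inter> G2 = {c, d}"
  proof (rule exact_side[OF A fin N'(4,5,1)])
    show "\<exists>G\<in>A. c \<in> G \<and> d \<in> G \<and> m \<notin> G \<and> z \<notin> G" if "z \<in> N - {c, d}" for z
      by (rule side[of A c d a b]) (use that ob avoid in \<open>auto simp: obs_def\<close>)
  qed (use dist in auto)
  obtain H1 where H1: "H1 \<in> B" "N \<inter> H1 = {a, c}"
  proof (rule exact_side[OF B fin N'(2,4,1)])
    show "\<exists>G\<in>B. a \<in> G \<and> c \<in> G \<and> m \<notin> G \<and> z \<notin> G" if "z \<in> N - {a, c}" for z
      by (rule side[of B a c b d]) (use that ob avoid in \<open>auto simp: obs_def\<close>)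
  qed (use dist in auto)
  obtain H2 where H2: "H2 \<in> B" "N \<inter> H2 = {b, d}"
  proof (rule exact_side[OF B fin N'(3,5,1)])
    show "\<exists>G\<in>B. b \<in> G \<and> d \<in> G \<and> m \<notin> G \<and> z \<notin> G" if "z \<in> N - {b, d}" for z
      by (rule side[of B b d a c]) (use that ob avoid in \<open>auto simp: obs_def\<close>)
  qed (use dist in auto)
  have sep_exact: "sep C {x, y} Q" if "G \<in> C" "N \<inter> G = {x, y}" "Q \<subseteq> N - {x, y}" for C G x y Q
    unfolding sep_def using that by (intro bexI[of _ G]) auto

  \<comment> \<open>Without \<open>b\<close> and \<open>c\<close> no obstruction is left at all: any
    remaining one could be moved to \<open>m\<close> inside \<open>N1\<close>, and the only one
    through \<open>m\<close> contains \<open>b\<close>.\<close>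
  define N1 where "N1 = N - {b, c}"
  have N1: "N1 \<subseteq> N" "m \<in> N1" "a \<in> N1" "d \<in> N1" using N' dist unfolding N1_def by auto
  have free: "\<not> obs A B {p} q r s t" if "{p, q, r, s, t} \<subseteq> N1" for p q r s t
  proof
    assume "obs A B {p} q r s t"
    then have "obs_via A B {m} N1"
      using obs_reroot[OF split_system_mono[OF A N1(1)] split_system_mono[OF B N1(1)] N1(2) that] by blast
    then obtain p' q' r' s' t' where p: "obs A B {p'} q' r' s' t'" "{m} \<subseteq> {p', q', r', s', t'}"
      "{p', q', r', s', t'} \<subseteq> N1"
      by (rule obs_viaE)
    then have "{p', q', r', s', t'} = {m, a, b, c, d}"
      using uniq[OF p(1)] order_trans[OF p(3) N1(1)] by simp
    then have "b \<in> N1" using p(3) by auto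
    then show False unfolding N1_def by simp
  qed
  obtain xs where xs: "distinct xs" "set xs = N1" "circ A xs" "circ B xs"
    using circular_kuratowski[OF split_system_mono[OF A N1(1)] split_system_mono[OF B N1(1)] _ free]
      finite_subset[OF N1(1) fin] by blast
  obtain us0 vs0 where "xs = us0 @ m # vs0" using xs(2) N1(2) by (metis split_list)
  then obtain ys where ys: "distinct (m # ys)" "set (m # ys) = N1" "circ A (m # ys)" "circ B (m # ys)"
    using xs circ_rotate[OF _ clA, of us0 "m # vs0"] circ_rotate[OF _ clB, of us0 "m # vs0"]
    by (intro that[of "vs0 @ us0"]) auto
  have rev: "circ C (m # rev ys)" if "circ C (m # ys)" "\<forall>G\<in>C. - G \<in> C" for C
    using circ_rotate[of C "rev ys" "[m]"] circ_rev[OF that] that(2) by simp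
  have "a \<in> set ys" "d \<in> set ys" using ys N1 dist by auto
  \<comment> \<open>Up to reversal, \<open>a\<close> comes before \<open>d\<close> when the circle
    is read from \<open>m\<close>.\<close>
  then obtain zs where zs: "distinct (m # zs)" "set (m # zs) = N1" "circ A (m # zs)" "circ B (m # zs)"
    "\<exists>us ws vs. zs = us @ a # ws @ d # vs"
  proof -
    obtain us vs where uv: "ys = us @ a # vs" using \<open>a \<in> set ys\<close> by (metis split_list)
    show thesis
    proof (cases "d \<in> set vs")
      case True
      then obtain ws vs' where "vs = ws @ d # vs'" by (metis split_list)
      then show thesis using that[of ys] ys uv by auto
    next
      case False
      then have "d \<in> set us" using \<open>d \<in> set ys\<close> uv dist by auto
      then obtain us' ws where "us = us' @ d # ws" by (metis split_list)
      then have "rev ys = rev vs @ a # rev ws @ d # rev us'" using uv by simp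
      then have "\<exists>us ws vs. rev ys = us @ a # ws @ d # vs" by blast
      then show thesis
        using that[of "rev ys"] ys rev[OF ys(3) clA] rev[OF ys(4) clB] by auto
    qed
  qed
  then obtain us ws vs where uv: "zs = us @ a # ws @ d # vs" by blast
  have "ws = []"
  proof (rule ccontr)
    assume "ws \<noteq> []"
    then obtain z ws' where ws: "ws = z # ws'" by (cases ws) auto
    have z: "z \<in> N" "z \<notin> {m, a, b, c, d}" using zs(1,2) uv ws unfolding N1_def by auto
    have "subseq ([m] @ [a] @ [z] @ [d]) ([m] @ us @ [a] @ ws @ d # vs)"
      unfolding ws by (auto intro!: list_emb_append_mono list_emb_append2)
    then have sub: "subseq [m, a, z, d] (m # zs)" using uv by simp
    \<comment> \<open>The points occur as \<open>m, a, z, d\<close>, so pairing \<open>m\<close>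
      with \<open>z\<close> against \<open>a\<close> with \<open>d\<close> would alternate. Hence
      each system groups \<open>z\<close> with \<open>a\<close> or with \<open>d\<close>.\<close>
    have cases: "sep C {a, z} {m, d} \<or> sep C {z, d} {m, a}"
      if C: "split_system N C" "circ C (m # zs)" for C
    proof -
      note cl = split_system_closed[OF C(1)]
      have "{m, a, z, d} \<subseteq> N" "distinct [m, a, z, d]" using z N' dist by auto
      with C(1) show ?thesis
      proof (rule split_system_resolve)
        assume "sep C {m, a} {z, d}"
        then show ?thesis using sep_sym[OF cl] by blast
      next
        assume "sep C {m, z} {a, d}"
        then obtain G where "G \<in> C" "m \<in> G" "z \<in> G" "a \<notin> G" "d \<notin> G" by (rule sepE2)
        then show ?thesis using circ_noalt(1)[OF C(2) cl _ sub] by blast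
      next
        assume "sep C {m, d} {a, z}"
        then show ?thesis using sep_sym[OF cl] by blast
      qed
    qed
    \<comment> \<open>The split \<open>K\<close> that groups \<open>z\<close> with \<open>y\<close>
      cannot cut the exact pairs \<open>{y, y'}\<close> and \<open>{x, x'}\<close>, because it
      contains \<open>z\<close> and avoids \<open>m\<close>. So \<open>y'\<close> joins
      \<open>y\<close>, and \<open>x'\<close> stays outside with \<open>x\<close>.\<close>
    have ext: "sep C {z, y, y'} ({m, x, x'})"
      if C: "split_system N C" and zy: "sep C {z, y} {m, x}" and G: "G \<in> C" "N \<inter> G = {y, y'}"
        and H: "H \<in> C" "N \<inter> H = {x, x'}" and new: "m \<notin> {x, x', y, y'}" "z \<notin> {x, x', y, y'}" "distinct [x, x', y, y']"
      for C y y' x x' G H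
    proof -
      obtain K where K: "K \<in> C" "z \<in> K" "y \<in> K" "m \<notin> K" "x \<notin> K"
        using zy by (rule sepE2)
      have in_G: "t \<in> G \<longleftrightarrow> t = y \<or> t = y'" and in_H: "t \<in> H \<longleftrightarrow> t = x \<or> t = x'" if "t \<in> N" for t
        using G(2) H(2) that by blast+
      have xy: "x \<in> N" "y \<in> N" "x' \<in> N" "y' \<in> N" using G(2) H(2) by auto
      have mG: "m \<notin> G" "m \<notin> H" "z \<notin> G" "z \<notin> H" using in_G in_H z(1) N'(1) new by auto
      have GH: "y \<in> G" "y' \<in> G" "x \<in> H" "x' \<in> H" using in_G in_H xy by auto
      have "N \<inter> K \<subseteq> G \<or> N \<inter> G \<subseteq> K"
        using K GH mG xy N'(1) by (intro compat_nested[OF C K(1) G(1), of y m]) auto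
      then have "y' \<in> K" using mG GH K(2) z(1) xy by blast
      moreover have "x' \<notin> K"
      proof
        assume "x' \<in> K"
        then have "N \<inter> K \<subseteq> H \<or> N \<inter> H \<subseteq> K"
          using K GH mG xy N'(1) by (intro compat_nested[OF C K(1) H(1), of x' m]) auto
        then show False using mG GH K z(1) xy by blast
      qed
      ultimately show ?thesis unfolding sep_def using K by (intro bexI[of _ K]) auto
    qed
    have mN: "m \<notin> {a, b, c, d}" and zN: "z \<notin> {a, b, c, d}" using dist z by auto
    have A1: "sep A {z, a, b} {m, d, c}" if "sep A {a, z} {m, d}"
      using ext[OF A _ G1 G2(1), of d c] that G2(2) mN zN dist by (auto simp: insert_commute)
    have A2: "sep A {z, d, c} {m, a, b}" if "sep A {z, d} {m, a}"
      using ext[OF A _ G2(1) _ G1, of d c] that G2(2) mN zN dist by (auto simp: insert_commute)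
    have B1: "sep B {z, a, c} {m, d, b}" if "sep B {a, z} {m, d}"
      using ext[OF B _ H1 H2(1), of d b] that H2(2) mN zN dist by (auto simp: insert_commute)
    have B2: "sep B {z, d, b} {m, a, c}" if "sep B {z, d} {m, a}"
      using ext[OF B _ H2(1) _ H1, of d b] that H2(2) mN zN dist by (auto simp: insert_commute)
    have s: "sep A {a, b} {c, d, m, z}" "sep A {c, d} {a, b, m, z}" "sep B {a, c} {b, d, m, z}" "sep B {b, d} {a, c, m, z}"
      using N' z dist
      by (auto intro!: sep_exact[OF G1] sep_exact[OF G2] sep_exact[OF H1] sep_exact[OF H2])
    \<comment> \<open>\<open>A\<close> tells the row of \<open>z\<close> and \<open>B\<close> its
      column, so \<open>z\<close> can replace the point in that cell of the table: \<open>a\<close>,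
      \<open>b\<close>, \<open>c\<close> or \<open>d\<close> in this order of the cases. Each gives
      a forbidden obstruction through \<open>m\<close>.\<close>
    from cases[OF A zs(3)] cases[OF B zs(4)] show False
    proof (elim disjE)
      assume "sep A {a, z} {m, d}" "sep B {a, z} {m, d}"
      then have h: "sep A {z, a, b} {m, d, c}" "sep B {z, a, c} {m, d, b}"
        by (simp_all only: A1 B1)
      have "sep A {z, b} ({c, d} \<union> {m})" by (rule sep_mono[OF h(1)]) auto
      moreover have "sep A {c, d} ({z, b} \<union> {m})" by (rule sep_mono[OF s(2)]) auto
      moreover have "sep B {z, c} ({b, d} \<union> {m})" by (rule sep_mono[OF h(2)]) auto
      moreover have "sep B {b, d} ({z, c} \<union> {m})" by (rule sep_mono[OF s(4)]) auto
      ultimately have "obs A B {m} z b c d" unfolding obs_def by blast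
      then show False by (rule no[of _ _ _ _ z]) (use z N' in auto)
    next
      assume "sep A {a, z} {m, d}" "sep B {z, d} {m, a}"
      then have h: "sep A {z, a, b} {m, d, c}" "sep B {z, d, b} {m, a, c}"
        by (simp_all only: A1 B2)
      have "sep A {a, z} ({c, d} \<union> {m})" by (rule sep_mono[OF h(1)]) auto
      moreover have "sep A {c, d} ({a, z} \<union> {m})" by (rule sep_mono[OF s(2)]) auto
      moreover have "sep B {a, c} ({z, d} \<union> {m})" by (rule sep_mono[OF s(3)]) auto
      moreover have "sep B {z, d} ({a, c} \<union> {m})" by (rule sep_mono[OF h(2)]) auto
      ultimately have "obs A B {m} a z c d" unfolding obs_def by blast
      then show False by (rule no[of _ _ _ _ z]) (use z N' in auto)
    next
      assume "sep A {z, d} {m, a}" "sep B {a, z} {m, d}"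
      then have h: "sep A {z, d, c} {m, a, b}" "sep B {z, a, c} {m, d, b}"
        by (simp_all only: A2 B1)
      have "sep A {a, b} ({z, d} \<union> {m})" by (rule sep_mono[OF s(1)]) auto
      moreover have "sep A {z, d} ({a, b} \<union> {m})" by (rule sep_mono[OF h(1)]) auto
      moreover have "sep B {a, z} ({b, d} \<union> {m})" by (rule sep_mono[OF h(2)]) auto
      moreover have "sep B {b, d} ({a, z} \<union> {m})" by (rule sep_mono[OF s(4)]) auto
      ultimately have "obs A B {m} a b z d" unfolding obs_def by blast
      then show False by (rule no[of _ _ _ _ z]) (use z N' in auto)
    next
      assume "sep A {z, d} {m, a}" "sep B {z, d} {m, a}"
      then have h: "sep A {z, d, c} {m, a, b}" "sep B {z, d, b} {m, a, c}"
        by (simp_all only: A2 B2)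
      have "sep A {a, b} ({c, z} \<union> {m})" by (rule sep_mono[OF s(1)]) auto
      moreover have "sep A {c, z} ({a, b} \<union> {m})" by (rule sep_mono[OF h(1)]) auto
      moreover have "sep B {a, c} ({b, z} \<union> {m})" by (rule sep_mono[OF s(3)]) auto
      moreover have "sep B {b, z} ({a, c} \<union> {m})" by (rule sep_mono[OF h(2)]) auto
      ultimately have "obs A B {m} a b c z" unfolding obs_def by blast
      then show False by (rule no[of _ _ _ _ z]) (use z N' in auto)
    qed
  qed
  have zs': "m # zs = (m # us) @ a # d # vs" using uv \<open>ws = []\<close> by simp
  have set: "set (m # us @ a # d # vs) = N - {b, c}" and d': "distinct (m # us @ a # d # vs)"
    using zs(1,2) zs' unfolding N1_def by auto
  \<comment> \<open>The missing points return as twins of \<open>a\<close> and \<open>d\<close>. For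
    \<open>A\<close> the twin of \<open>a\<close> is \<open>b\<close> and that of \<open>d\<close>
    is \<open>c\<close>; for \<open>B\<close> it is the other way round, which is the source of the
    single crossing.\<close>
  have ins: "circ C (m # us @ [a, x, y, d] @ vs)"
    if C: "split_system N C" "circ C (m # zs)" and xy: "{x, y} = {b, c}"
      and G: "G \<in> C" "N \<inter> G = {a, x}" and H: "H \<in> C" "N \<inter> H = {y, d}" for C G H x y
  proof -
    have x: "x \<notin> set (m # us @ a # d # vs)" "y \<notin> set (m # us @ a # d # vs)" "x \<noteq> y" "x \<in> N" "y \<in> N"
      using set xy N' dist by (auto simp: doubleton_eq_iff)
    have sN: "set (m # us @ a # d # vs) \<subseteq> N" using set by blast
    have "circ C ((m # us) @ a # x # d # vs)"
      by (rule circ_twin[OF C(1) _ G, of "m # us" "d # vs"])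
        (use C(2) zs' x d' sN in auto)
    then have "circ C (((m # us) @ [a, x]) @ d # vs)" by simp
    moreover have "N \<inter> H = {d, y}" using H(2) by (simp add: insert_commute)
    ultimately have "circ C (((m # us) @ [a, x]) @ y # d # vs)"
      by (rule circ_twin[OF C(1) _ H(1)]) (use x d' sN N' in auto)
    then show ?thesis by simp
  qed
  have "circ A (m # us @ [a, b, c, d] @ vs)"
    by (rule ins[OF A zs(3) refl G1 G2])
  moreover have "circ B (m # us @ [a, c, b, d] @ vs)"
    by (rule ins[OF B zs(4) _ H1 H2]) auto
  moreover have "distinct (m # us @ [a, b, c, d] @ vs)" "set (m # us @ [a, b, c, d] @ vs) = N"
    using d' set N' dist by auto
  ultimately show thesis using that by blast
qed

section \<open>The ancestor order of a rooted tree\<close>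

lemma path_edges_Cons_Cons: "path_edges (x # y # zs) = insert {x, y} (path_edges (y # zs))"
proof -
  have "{i. Suc i < length (x # y # zs)} = insert 0 (Suc ` {i. Suc i < length (y # zs)})"
    by (auto simp: image_iff less_Suc_eq_0_disj)
  then have "(\<lambda>i. {(x # y # zs) ! i, (x # y # zs) ! Suc i}) ` {i. Suc i < length (x # y # zs)} =
      insert {x, y} ((\<lambda>i. {(y # zs) ! i, (y # zs) ! Suc i}) ` {i. Suc i < length (y # zs)})"
    by (simp add: image_image)
  then show ?thesis
    unfolding path_edges_def by (simp add: setcompr_eq_image)
qed

lemma path_edges_simps [simp]: "path_edges [] = {}" "path_edges [x] = {}"
  unfolding path_edges_def by auto

lemma path_edges_append: "path_edges (xs @ y # ys) = path_edges (xs @ [y]) \<union> path_edges (y # ys)"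
proof (induction xs)
  case (Cons x xs)
  then show ?case by (cases xs) (auto simp: path_edges_Cons_Cons)
qed simp

lemma path_edges_rev: "path_edges (rev xs) = path_edges xs"
proof (induction xs rule: induct_list012)
  case (3 x y zs)
  have "path_edges (rev (x # y # zs)) = path_edges (rev zs @ y # [x])" by simp
  also have "\<dots> = path_edges (rev (y # zs)) \<union> path_edges [y, x]"
    by (subst path_edges_append) simp
  also have "\<dots> = path_edges (x # y # zs)"
    using 3 by (auto simp: path_edges_Cons_Cons insert_commute)
  finally show ?case .
qed auto

lemma path_betw_append:
  assumes "path_betw G u (xs @ w # ys) v"
  shows "path_betw G u (xs @ [w]) w" "path_betw G w (w # ys) v"
  using assms unfolding path_betw_def path_edges_append[of xs w ys]
  by (auto simp: hd_append split: if_splits)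

lemma path_betw_rev: "path_betw G u xs v \<Longrightarrow> path_betw G v (rev xs) u"
  unfolding path_betw_def by (auto simp: path_edges_rev hd_rev last_rev)

lemma path_betw_snoc:
  assumes "path_betw G u xs v" "{v, w} \<in> edges G" "w \<in> verts G" "w \<notin> set xs"
  shows "path_betw G u (xs @ [w]) w"
proof -
  obtain zs where "xs = zs @ [v]" using assms(1) unfolding path_betw_def by (metis append_butlast_last_id)
  then have "path_edges (xs @ [w]) = path_edges xs \<union> {{v, w}}"
    using path_edges_append[of zs v "[w]"] by (simp add: path_edges_Cons_Cons)
  then show ?thesis using assms unfolding path_betw_def by auto
qed

text \<open>If the paths leave \<open>u\<close> by different edges, follow the first one up to its
  first vertex \<open>w\<close> on the second one and then go back along the second one to
  \<open>y1\<close>. The edge from \<open>y1\<close> to \<open>u\<close> closes a cycle.\<close>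

lemma acyclic_path_unique:
  assumes G: "acyclic_graph G"
  shows "path_betw G u xs v \<Longrightarrow> path_betw G u ys v \<Longrightarrow> xs = ys"
proof (induction xs arbitrary: u ys)
  case Nil
  then show ?case unfolding path_betw_def by simp
next
  case (Cons x xs)
  have x: "x = u" using Cons.prems(1) unfolding path_betw_def by simp
  obtain ys' where ys: "ys = u # ys'"
    using Cons.prems(2) unfolding path_betw_def by (cases ys) auto
  show ?case
  proof (cases xs)
    case Nil
    then have "v = u" using Cons.prems(1) x unfolding path_betw_def by simp
    then have "ys' = []" using Cons.prems(2) ys unfolding path_betw_def by (auto split: if_splits)
    then show ?thesis using ys x Nil by simp
  next
    case (Cons x1 xs')
    have "u \<noteq> v" using Cons.prems(1) Cons x unfolding path_betw_def by (auto split: if_splits)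
    then have "ys' \<noteq> []" using Cons.prems(2) ys unfolding path_betw_def by auto
    then obtain y1 ys'' where ys': "ys' = y1 # ys''" by (cases ys') auto
    have px: "path_betw G x1 (x1 # xs') v" and py: "path_betw G y1 (y1 # ys'') v"
      using path_betw_append(2)[of G u "[u]" x1 xs' v] path_betw_append(2)[of G u "[u]" y1 ys'' v]
        Cons.prems x Cons ys ys' by auto
    show ?thesis
    proof (cases "x1 = y1")
      case True
      then show ?thesis using Cons.IH[of x1 "y1 # ys''"] px py Cons x ys ys' by simp
    next
      case False
      have "v \<in> set (x1 # xs')" "v \<in> set (y1 # ys'')"
        using px py unfolding path_betw_def by (metis last_in_set)+
      then have "\<exists>w\<in>set (x1 # xs'). w \<in> set (y1 # ys'')" by blast
      then obtain p w q where p: "x1 # xs' = p @ w # q" "w \<in> set (y1 # ys'')" "\<forall>z\<in>set p. z \<notin> set (y1 # ys'')"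
        by (rule split_list_first_propE)
      obtain r s where r: "y1 # ys'' = r @ w # s" using p(2) by (metis split_list)
      have ux: "u # x1 # xs' = (u # p) @ w # q" using p(1) by simp
      have PX: "path_betw G u ((u # p) @ w # q) v" using Cons.prems(1) Cons x ux by simp
      then have A: "path_betw G u ((u # p) @ [w]) w" by (rule path_betw_append)
      have PY: "path_betw G u ((u # r) @ w # s) v" using Cons.prems(2) ys ys' r by simp
      have "path_betw G y1 (r @ w # s) v" using py r by simp
      then have "path_betw G y1 (r @ [w]) w" by (rule path_betw_append)
      then have B: "path_betw G w (w # rev r) y1" using path_betw_rev by fastforce
      have "u \<notin> set r" using PY unfolding path_betw_def by auto
      moreover have "set p \<inter> set r = {}" using p(3) r by auto
      ultimately have "path_betw G u ((u # p) @ w # rev r) y1"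
        using A B path_edges_append[of "u # p" w "rev r"] unfolding path_betw_def
        by (auto split: if_splits)
      moreover have "3 \<le> length ((u # p) @ w # rev r)"
      proof (rule ccontr)
        assume "\<not> 3 \<le> length ((u # p) @ w # rev r)"
        then have "p = []" "r = []" by (cases p; cases r; simp)+
        then show False using p(1) r False by simp
      qed
      moreover have "{u, y1} \<in> edges G"
        using Cons.prems(2) ys ys' unfolding path_betw_def by (auto simp: path_edges_Cons_Cons)
      ultimately show ?thesis using G unfolding acyclic_graph_def by blast
    qed
  qed
qed

lemma obtain_max:
  fixes f :: "'b \<Rightarrow> nat"
  assumes "finite D" "D \<noteq> {}"
  obtains w where "w \<in> D" "\<And>x. x \<in> D \<Longrightarrow> f x \<le> f w"
proof -
  have "Max (f ` D) \<in> f ` D" using assms by (intro Max_in) auto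
  then obtain w where "w \<in> D" "f w = Max (f ` D)" by auto
  moreover have "f x \<le> Max (f ` D)" if "x \<in> D" for x using assms that by (intro Max_ge) auto
  ultimately show thesis using that[of w] by simp
qed

section \<open>Descendants, children and clusters\<close>

definition root_path :: "'a rtree \<Rightarrow> 'a \<Rightarrow> 'a list" where
  "root_path T v = (THE xs. path_betw T (rt T) xs v)"

text \<open>The ancestor order, with \<open>u\<close> above \<open>v\<close>. As a prefix relation
  of root paths it inherits reflexivity, transitivity and the comparability of two ancestors of one
  vertex from lists.\<close>

definition below :: "'a rtree \<Rightarrow> 'a \<Rightarrow> 'a \<Rightarrow> bool" where
  "below T u v \<longleftrightarrow> u \<in> verts T \<and> v \<in> verts T \<and> prefix (root_path T u) (root_path T v)"

definition child :: "'a rtree \<Rightarrow> 'a \<Rightarrow> 'a \<Rightarrow> bool" where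
  "child T u v \<longleftrightarrow> u \<in> verts T \<and> v \<in> verts T \<and> root_path T v = root_path T u @ [v]"

definition cluster :: "'a rtree \<Rightarrow> 'a \<Rightarrow> 'a set" where
  "cluster T v = {l \<in> leaves T. below T v l}"

locale binary_tree =
  fixes T :: "'a rtree"
  assumes binary: "rooted_binary_tree T"
begin

lemma tree: "simple_graph T" "connected_graph T" "acyclic_graph T" and rt_in: "rt T \<in> verts T"
  using binary unfolding rooted_binary_tree_def rooted_tree_def tree_graph_def by auto

lemma fin: "finite (verts T)"
  using tree(1) unfolding simple_graph_def by blast

lemma edge_verts: "{u, v} \<in> edges T \<Longrightarrow> u \<in> verts T \<and> v \<in> verts T \<and> u \<noteq> v"
  using tree(1) unfolding simple_graph_def by (fastforce simp: doubleton_eq_iff)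

lemma root_path_eq: "path_betw T (rt T) xs v \<Longrightarrow> root_path T v = xs"
  unfolding root_path_def using acyclic_path_unique[OF tree(3)] by blast

lemma root_path:
  assumes "v \<in> verts T"
  shows "path_betw T (rt T) (root_path T v) v"
proof -
  obtain xs where "path_betw T (rt T) xs v"
    using tree(2) rt_in assms unfolding connected_graph_def by blast
  then show ?thesis using root_path_eq by simp
qed

lemma root_path_facts:
  assumes "v \<in> verts T"
  shows "root_path T v \<noteq> []" "last (root_path T v) = v" "distinct (root_path T v)"
    "set (root_path T v) \<subseteq> verts T" "v \<in> set (root_path T v)" "hd (root_path T v) = rt T"
  using root_path[OF assms] last_in_set[of "root_path T v"] unfolding path_betw_def by auto

lemma root_path_split:
  assumes "v \<in> verts T" "root_path T v = xs @ w # ys"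
  shows "root_path T w = xs @ [w]"
  using path_betw_append(1)[of T "rt T" xs w ys v] root_path[OF assms(1)] assms(2) root_path_eq by simp

lemma root_path_inj: "u \<in> verts T \<Longrightarrow> v \<in> verts T \<Longrightarrow> root_path T u = root_path T v \<Longrightarrow> u = v"
  using root_path_facts(2) by metis

lemma below_iff_set: "v \<in> verts T \<Longrightarrow> below T u v \<longleftrightarrow> u \<in> set (root_path T v)"
proof
  assume v: "v \<in> verts T" and "below T u v"
  then obtain zs where "root_path T v = root_path T u @ zs" and u: "u \<in> verts T"
    unfolding below_def prefix_def by auto
  then show "u \<in> set (root_path T v)" using root_path_facts(5)[OF u] by simp
next
  assume v: "v \<in> verts T" and u: "u \<in> set (root_path T v)"
  then obtain xs ys where s: "root_path T v = xs @ u # ys" by (metis split_list)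
  then have "root_path T u = xs @ [u]" using root_path_split[OF v] by blast
  moreover have "u \<in> verts T" using u root_path_facts(4)[OF v] by blast
  ultimately show "below T u v" unfolding below_def prefix_def using v s by simp
qed

lemma below_verts: "below T u v \<Longrightarrow> u \<in> verts T \<and> v \<in> verts T"
  unfolding below_def by blast

lemma below_refl: "v \<in> verts T \<Longrightarrow> below T v v"
  unfolding below_def by simp

lemma below_trans: "below T u v \<Longrightarrow> below T v w \<Longrightarrow> below T u w"
  unfolding below_def by (meson prefix_order.order_trans)

lemma below_antisym: "below T u v \<Longrightarrow> below T v u \<Longrightarrow> u = v"
  unfolding below_def using root_path_inj prefix_order.antisym by blast

lemma below_linear: "below T u w \<Longrightarrow> below T v w \<Longrightarrow> below T u v \<or> below T v u"
  unfolding below_def using prefix_same_cases by blast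

lemma below_rt: "v \<in> verts T \<Longrightarrow> below T (rt T) v"
  using below_iff_set root_path_facts(1,6) by (metis hd_in_set)

lemma child_verts: "child T u v \<Longrightarrow> u \<in> verts T \<and> v \<in> verts T"
  unfolding child_def by blast

lemma child_below: "child T u v \<Longrightarrow> below T u v \<and> u \<noteq> v"
  unfolding child_def below_def by auto

lemma child_edge: "child T u v \<Longrightarrow> {u, v} \<in> edges T"
proof -
  assume c: "child T u v"
  then have u: "u \<in> verts T" and v: "v \<in> verts T" and p: "root_path T v = root_path T u @ [v]"
    unfolding child_def by auto
  have "root_path T u = butlast (root_path T u) @ [u]"
    using root_path_facts(1,2)[OF u] by (metis append_butlast_last_id)
  then have "root_path T v = butlast (root_path T u) @ u # [v]" using p by simp
  then have "{u, v} \<in> path_edges (root_path T v)"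
    using path_edges_append[of "butlast (root_path T u)" u "[v]"] by (simp add: path_edges_Cons_Cons)
  then show ?thesis using root_path[OF v] unfolding path_betw_def by blast
qed

text \<open>If \<open>v\<close> is not on the root path of \<open>u\<close>, that path can be
  prolonged by \<open>v\<close>. If it is, acyclicity leaves no room between \<open>v\<close> and
  \<open>u\<close>.\<close>

lemma edge_child: "{u, v} \<in> edges T \<Longrightarrow> child T u v \<or> child T v u"
proof -
  assume e: "{u, v} \<in> edges T"
  then have uv: "u \<in> verts T" "v \<in> verts T" "u \<noteq> v" using edge_verts by auto
  show ?thesis
  proof (cases "v \<in> set (root_path T u)")
    case False
    then have "path_betw T (rt T) (root_path T u @ [v]) v"
      using path_betw_snoc[OF root_path[OF uv(1)] e uv(2)] by blast
    then show ?thesis using root_path_eq uv unfolding child_def by blast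
  next
    case True
    then obtain xs ys where s: "root_path T u = xs @ v # ys" by (metis split_list)
    have pv: "root_path T v = xs @ [v]" using root_path_split[OF uv(1) s] .
    have p: "path_betw T v (v # ys) u"
      using path_betw_append(2)[of T "rt T" xs v ys u] root_path[OF uv(1)] s by simp
    then have "\<not> 3 \<le> length (v # ys)"
      using tree(3) e unfolding acyclic_graph_def by (metis insert_commute)
    moreover have "ys \<noteq> []" using p uv(3) unfolding path_betw_def by auto
    ultimately have "length ys = 1" by (cases ys; cases "tl ys") auto
    then obtain y where "ys = [y]" by (auto simp: length_Suc_conv)
    moreover from this p have "y = u" unfolding path_betw_def by simp
    ultimately have "child T v u" unfolding child_def using uv s pv by simp
    then show ?thesis by blast
  qed
qed

lemma parent_unique: "child T u v \<Longrightarrow> child T u' v \<Longrightarrow> u = u'"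
  unfolding child_def using root_path_inj by auto

lemma parent_exists:
  assumes "v \<in> verts T" "v \<noteq> rt T"
  obtains u where "child T u v"
proof -
  have "root_path T v = butlast (root_path T v) @ [v]"
    using root_path_facts(1,2)[OF assms(1)] by (metis append_butlast_last_id)
  moreover have "butlast (root_path T v) \<noteq> []"
  proof
    assume "butlast (root_path T v) = []"
    then have "root_path T v = [v]" using calculation by simp
    then show False using root_path_facts(6)[OF assms(1)] assms(2) by simp
  qed
  ultimately obtain xs u where s: "root_path T v = xs @ u # [v]"
    by (metis append.assoc append_Cons append_Nil append_butlast_last_id)
  have "u \<in> verts T" using root_path_facts(4)[OF assms(1)] s by auto
  then have "child T u v" unfolding child_def using root_path_split[OF assms(1) s] s assms(1) by simp
  then show thesis by (rule that)
qed

lemma below_child: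
  assumes "below T u v" "u \<noteq> v"
  obtains c where "child T u c" "below T c v"
proof -
  have uv: "u \<in> verts T" "v \<in> verts T" using below_verts[OF assms(1)] by auto
  obtain zs where zs: "root_path T v = root_path T u @ zs"
    using assms(1) unfolding below_def prefix_def by blast
  have "zs \<noteq> []" using zs assms(2) root_path_inj uv by auto
  then obtain c ys where z: "zs = c # ys" by (cases zs) auto
  have pc: "root_path T c = root_path T u @ [c]" using root_path_split[OF uv(2)] zs z by blast
  have cV: "c \<in> verts T" using root_path_facts(4)[OF uv(2)] zs z by auto
  have "child T u c" unfolding child_def using pc cV uv by simp
  moreover have "below T c v" unfolding below_def prefix_def using pc zs z cV uv by simp
  ultimately show thesis by (rule that)
qed

lemma below_parent:
  assumes "child T p v" "below T u v" "u \<noteq> v"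
  shows "below T u p"
proof -
  have v: "v \<in> verts T" "p \<in> verts T" using child_verts[OF assms(1)] by auto
  have "root_path T v = root_path T p @ [v]" using assms(1) unfolding child_def by simp
  then have "u \<in> set (root_path T p)" using assms(2,3) below_iff_set[OF v(1)] by auto
  then show ?thesis using below_iff_set[OF v(2)] by blast
qed

text \<open>Stated for a set \<open>E\<close> of edges, as it is used both for the whole tree and
  for the union of the root paths to \<open>S\<close>.\<close>

lemma deg_eq:
  assumes "v \<in> verts T" "E \<subseteq> edges T"
    and "\<And>p. child T p v \<Longrightarrow> {p, v} \<in> E"
  shows "card {e \<in> E. v \<in> e} = card {c. child T v c \<and> {v, c} \<in> E} + (if v = rt T then 0 else 1)"
proof -
  let ?C = "{c. child T v c \<and> {v, c} \<in> E}"
  have edgeD: "\<exists>w. e = {v, w} \<and> (child T v w \<or> child T w v)" if e: "e \<in> E" "v \<in> e" for e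
  proof -
    have "e \<in> edges T" using e assms(2) by blast
    then obtain x y where "e = {x, y}" using tree(1) unfolding simple_graph_def by blast
    then obtain w where "e = {v, w}" using e(2) by blast
    then show ?thesis using edge_child[of v w] \<open>e \<in> edges T\<close> by auto
  qed
  have inj: "inj_on (\<lambda>c. {v, c}) ?C"
    by (auto simp: inj_on_def doubleton_eq_iff)
  have finC: "finite ?C" using fin by (rule rev_finite_subset) (auto dest: child_verts)
  show ?thesis
  proof (cases "v = rt T")
    case True
    have "\<not> child T p v" for p
      using True child_below[of p v] below_rt[of p] below_antisym child_verts by metis
    then have "{e \<in> E. v \<in> e} = (\<lambda>c. {v, c}) ` ?C" using edgeD by fastforce
    then show ?thesis using card_image[OF inj] True by simp
  next
    case False
    obtain p where p: "child T p v" using parent_exists[OF assms(1) False] .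
    have "{e \<in> E. v \<in> e} = insert {p, v} ((\<lambda>c. {v, c}) ` ?C)"
    proof
      show "{e \<in> E. v \<in> e} \<subseteq> insert {p, v} ((\<lambda>c. {v, c}) ` ?C)"
      proof
        fix e assume e: "e \<in> {e \<in> E. v \<in> e}"
        then obtain w where w: "e = {v, w}" "child T v w \<or> child T w v" using edgeD by blast
        from w(2) show "e \<in> insert {p, v} ((\<lambda>c. {v, c}) ` ?C)"
        proof
          assume "child T v w"
          then show ?thesis using e w(1) by auto
        next
          assume "child T w v"
          then have "w = p" using parent_unique p by blast
          then show ?thesis using w(1) by auto
        qed
      qed
    qed (use assms(3)[OF p] in auto)
    moreover have "{p, v} \<notin> (\<lambda>c. {v, c}) ` ?C"
    proof
      assume "{p, v} \<in> (\<lambda>c. {v, c}) ` ?C"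
      then have "child T v p" using child_below[OF p] by (auto simp: doubleton_eq_iff)
      then show False using child_below p below_antisym by metis
    qed
    ultimately show ?thesis using card_image[OF inj] finC False by simp
  qed
qed

lemma deg_children: "v \<in> verts T \<Longrightarrow> deg T v = card {c. child T v c} + (if v = rt T then 0 else 1)"
  using deg_eq[of v "edges T"] child_edge unfolding deg_def by (simp cong: conj_cong)

lemma fin_children: "finite {c. child T v c}"
  using fin by (rule rev_finite_subset) (auto dest: child_verts)

lemma leaves_verts: "l \<in> leaves T \<Longrightarrow> l \<in> verts T" and rt_not_leaf: "rt T \<notin> leaves T"
  unfolding leaves_def by auto

lemma leaf_no_child: "l \<in> leaves T \<Longrightarrow> \<not> child T l c"
  using deg_children[of l] fin_children[of l] unfolding leaves_def by auto

lemma rt_child: obtains c where "child T (rt T) c" "\<And>c'. child T (rt T) c' \<Longrightarrow> c' = c"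
proof -
  have "deg T (rt T) = 1"
    using binary unfolding rooted_binary_tree_def rooted_tree_def by blast
  then have "card {c. child T (rt T) c} = 1" using deg_children[OF rt_in] by simp
  then obtain c where "{c. child T (rt T) c} = {c}" by (metis card_1_singletonE)
  then show thesis using that[of c] by blast
qed

lemma inner_children:
  assumes "v \<in> verts T" "v \<noteq> rt T" "v \<notin> leaves T"
  obtains c d where "child T v c" "child T v d" "c \<noteq> d" "\<And>x. child T v x \<Longrightarrow> x = c \<or> x = d"
proof -
  have "deg T v = 3" using binary assms unfolding rooted_binary_tree_def by blast
  then have "card {c. child T v c} = 2" using deg_children[OF assms(1)] assms(2) by simp
  then obtain c d where "{c. child T v c} = {c, d}" "c \<noteq> d" by (auto simp: card_2_iff)
  then show thesis using that[of c d] by blast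
qed

lemma below_leaf: "below T l v \<Longrightarrow> l \<in> leaves T \<Longrightarrow> l = v"
  using below_child leaf_no_child by metis

text \<open>A deepest vertex below \<open>v\<close> has no child, and the root and the inner
  vertices all have one.\<close>

lemma cluster_nonempty:
  assumes "v \<in> verts T"
  shows "cluster T v \<noteq> {}"
proof -
  let ?D = "{w. below T v w}"
  have "finite ?D" using fin by (rule rev_finite_subset) (auto dest: below_verts)
  moreover have "?D \<noteq> {}" using below_refl[OF assms] by blast
  ultimately obtain w where w: "w \<in> ?D" "\<And>x. x \<in> ?D \<Longrightarrow> length (root_path T x) \<le> length (root_path T w)"
    by (rule obtain_max[where f = "\<lambda>x. length (root_path T x)"]) blast
  have wV: "w \<in> verts T" using w(1) below_verts by blast
  have noc: "\<not> child T w c" for c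
  proof
    assume c: "child T w c"
    then have "below T v c" using child_below below_trans w(1) by blast
    then have "length (root_path T c) \<le> length (root_path T w)" using w(2) by blast
    then show False using c unfolding child_def by simp
  qed
  have "w \<in> leaves T" using inner_children[OF wV] rt_child noc by metis
  then show ?thesis unfolding cluster_def using w(1) by blast
qed

lemma cluster_leaf: "l \<in> leaves T \<Longrightarrow> cluster T l = {l}"
  unfolding cluster_def using below_leaf below_refl leaves_verts by blast

lemma cluster_mono: "below T u v \<Longrightarrow> cluster T v \<subseteq> cluster T u"
  unfolding cluster_def using below_trans by blast

lemma cluster_children:
  assumes "v \<in> verts T" "v \<notin> leaves T"
  shows "cluster T v = (\<Union>c\<in>{c. child T v c}. cluster T c)"
proof
  show "cluster T v \<subseteq> (\<Union>c\<in>{c. child T v c}. cluster T c)"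
  proof
    fix l assume l: "l \<in> cluster T v"
    then have "below T v l" "l \<in> leaves T" unfolding cluster_def by auto
    moreover have "v \<noteq> l" using assms(2) \<open>l \<in> leaves T\<close> by blast
    ultimately obtain c where "child T v c" "below T c l" using below_child by metis
    then show "l \<in> (\<Union>c\<in>{c. child T v c}. cluster T c)" using \<open>l \<in> leaves T\<close> unfolding cluster_def by blast
  qed
  show "(\<Union>c\<in>{c. child T v c}. cluster T c) \<subseteq> cluster T v"
    using cluster_mono child_below by blast
qed

lemma cluster_meet: "cluster T u \<inter> cluster T v \<noteq> {} \<Longrightarrow> below T u v \<or> below T v u"
  unfolding cluster_def using below_linear by blast

lemma children_incomparable: "child T v c \<Longrightarrow> child T v d \<Longrightarrow> below T c d \<Longrightarrow> c = d"
  unfolding child_def below_def by auto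

lemma cluster_children_disjoint:
  assumes "child T v c" "child T v d" "c \<noteq> d"
  shows "cluster T c \<inter> cluster T d = {}"
  using cluster_meet[of c d] children_incomparable[OF assms(1,2)] children_incomparable[OF assms(2,1)] assms(3)
  by blast

lemma cluster_rt: "cluster T (rt T) = leaves T"
  unfolding cluster_def using below_rt leaves_verts by blast

lemma fin_leaves: "finite (leaves T)"
  using fin by (rule rev_finite_subset) (auto dest: leaves_verts)

end

section \<open>Induced subtrees\<close>

lemma path_edges_iff: "e \<in> path_edges xs \<longleftrightarrow> (\<exists>us x y vs. xs = us @ x # y # vs \<and> e = {x, y})"
proof
  assume "e \<in> path_edges xs"
  then obtain i where i: "Suc i < length xs" "e = {xs ! i, xs ! Suc i}"
    unfolding path_edges_def by blast
  then have "xs = take i xs @ xs ! i # xs ! Suc i # drop (Suc (Suc i)) xs"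
    by (metis Cons_nth_drop_Suc Suc_lessD append_take_drop_id)
  then show "\<exists>us x y vs. xs = us @ x # y # vs \<and> e = {x, y}" using i(2) by blast
next
  assume "\<exists>us x y vs. xs = us @ x # y # vs \<and> e = {x, y}"
  then obtain us x y vs where "xs = us @ x # y # vs" "e = {x, y}" by blast
  then show "e \<in> path_edges xs"
    using path_edges_append[of us x "y # vs"] by (simp add: path_edges_Cons_Cons)
qed

text \<open>The covering relation of inclusion on a set family, that is, adjacency in its Hasse
  diagram.\<close>

definition covers :: "'a set set \<Rightarrow> 'a set \<Rightarrow> 'a set \<Rightarrow> bool" where
  "covers F X Y \<longleftrightarrow> X \<in> F \<and> Y \<in> F \<and> Y \<subset> X \<and> \<not> (\<exists>Z\<in>F. Y \<subset> Z \<and> Z \<subset> X)"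

locale binary_subtree = binary_tree +
  fixes S :: "'a set"
  assumes S: "S \<subseteq> leaves T" "S \<noteq> {}"
begin

abbreviation "U \<equiv> root_paths_union T S"

definition B :: "'a set" where
  "B = {v \<in> verts U. deg U v \<noteq> 2}"

lemma S_verts: "s \<in> S \<Longrightarrow> s \<in> verts T"
  using S leaves_verts by blast

lemma meet_iff: "S \<inter> cluster T w \<noteq> {} \<longleftrightarrow> (\<exists>s\<in>S. below T w s)"
  using S(1) unfolding cluster_def by blast

lemma meet_mono: "below T u v \<Longrightarrow> S \<inter> cluster T v \<noteq> {} \<Longrightarrow> S \<inter> cluster T u \<noteq> {}"
  using cluster_mono by blast

lemma U_verts: "verts U = {w \<in> verts T. S \<inter> cluster T w \<noteq> {}}"
proof -
  have "verts U = \<Union> {set xs | xs s. s \<in> S \<and> path_betw T (rt T) xs s}"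
    unfolding root_paths_union_def by simp
  also have "\<dots> = (\<Union>s\<in>S. set (root_path T s))"
  proof -
    have "{set xs | xs s. s \<in> S \<and> path_betw T (rt T) xs s} = (\<lambda>s. set (root_path T s)) ` S"
    proof
      show "{set xs | xs s. s \<in> S \<and> path_betw T (rt T) xs s} \<subseteq> (\<lambda>s. set (root_path T s)) ` S"
        using root_path_eq by auto
      show "(\<lambda>s. set (root_path T s)) ` S \<subseteq> {set xs | xs s. s \<in> S \<and> path_betw T (rt T) xs s}"
        using root_path[OF S_verts] by blast
    qed
    then show ?thesis by simp
  qed
  also have "\<dots> = {w. \<exists>s\<in>S. below T w s}"
    using below_iff_set[OF S_verts] by blast
  finally show ?thesis using meet_iff below_verts by blast
qed

lemma path_edges_root_path:
  assumes v: "v \<in> verts T"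
  shows "path_edges (root_path T v) = {{p, w} | p w. child T p w \<and> below T w v}"
proof (intro subset_antisym subsetI)
  fix e assume "e \<in> path_edges (root_path T v)"
  then obtain us x y vs where s: "root_path T v = us @ x # y # vs" and e: "e = {x, y}"
    unfolding path_edges_iff by blast
  have "root_path T x = us @ [x]" "root_path T y = (us @ [x]) @ [y]"
    using root_path_split[OF v, of us x "y # vs"] root_path_split[OF v, of "us @ [x]" y vs] s by auto
  moreover have "x \<in> verts T" "y \<in> verts T" "y \<in> set (root_path T v)"
    using root_path_facts(4)[OF v] s by auto
  ultimately have "child T x y" "below T y v"
    unfolding child_def using below_iff_set[OF v] by auto
  then show "e \<in> {{p, w} | p w. child T p w \<and> below T w v}" using e by blast
next
  fix e assume "e \<in> {{p, w} | p w. child T p w \<and> below T w v}"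
  then obtain p w where e: "e = {p, w}" and c: "child T p w" and b: "below T w v" by blast
  obtain zs where zs: "root_path T v = root_path T w @ zs"
    using b unfolding below_def prefix_def by blast
  have p: "p \<in> verts T" "root_path T w = root_path T p @ [w]" using c unfolding child_def by auto
  obtain us where "root_path T p = us @ [p]"
    using root_path_facts(1,2)[OF p(1)] by (metis append_butlast_last_id)
  then have "root_path T v = us @ p # w # zs" using zs p(2) by simp
  then show "e \<in> path_edges (root_path T v)" unfolding path_edges_iff using e by blast
qed

lemma U_edges: "edges U = {{p, w} | p w. child T p w \<and> S \<inter> cluster T w \<noteq> {}}"
proof -
  have "edges U = \<Union> {path_edges xs | xs s. s \<in> S \<and> path_betw T (rt T) xs s}"
    unfolding root_paths_union_def by simp
  also have "{path_edges xs | xs s. s \<in> S \<and> path_betw T (rt T) xs s} = (\<lambda>s. path_edges (root_path T s)) ` S"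
  proof
    show "{path_edges xs | xs s. s \<in> S \<and> path_betw T (rt T) xs s} \<subseteq> (\<lambda>s. path_edges (root_path T s)) ` S"
      using root_path_eq by auto
    show "(\<lambda>s. path_edges (root_path T s)) ` S \<subseteq> {path_edges xs | xs s. s \<in> S \<and> path_betw T (rt T) xs s}"
      using root_path[OF S_verts] by blast
  qed
  also have "\<Union> \<dots> = (\<Union>s\<in>S. {{p, w} | p w. child T p w \<and> below T w s})"
    using path_edges_root_path[OF S_verts] by simp
  also have "\<dots> = {{p, w} | p w. child T p w \<and> S \<inter> cluster T w \<noteq> {}}"
    unfolding meet_iff by blast
  finally show ?thesis .
qed

lemma U_edges_T: "edges U \<subseteq> edges T"
  unfolding U_edges using child_edge by auto

lemma U_edge_child:
  assumes "child T v c"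
  shows "{v, c} \<in> edges U \<longleftrightarrow> S \<inter> cluster T c \<noteq> {}"
proof
  assume "{v, c} \<in> edges U"
  then obtain p w where pw: "{v, c} = {p, w}" "child T p w" "S \<inter> cluster T w \<noteq> {}"
    unfolding U_edges by blast
  have "\<not> child T c v" using assms child_below below_antisym by metis
  then have "p = v" "w = c" using pw(1,2) by (auto simp: doubleton_eq_iff)
  then show "S \<inter> cluster T c \<noteq> {}" using pw(3) by simp
qed (use assms in \<open>auto simp: U_edges\<close>)

lemma deg_U:
  assumes "v \<in> verts U"
  shows "deg U v = card {c. child T v c \<and> S \<inter> cluster T c \<noteq> {}} + (if v = rt T then 0 else 1)"
proof -
  have v: "v \<in> verts T" "S \<inter> cluster T v \<noteq> {}" using assms unfolding U_verts by auto
  have "deg U v = card {c. child T v c \<and> {v, c} \<in> edges U} + (if v = rt T then 0 else 1)"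
    unfolding deg_def
  proof (rule deg_eq[OF v(1) U_edges_T])
    fix p assume "child T p v"
    then show "{p, v} \<in> edges U" using v(2) U_edge_child by blast
  qed
  then show ?thesis using U_edge_child by (simp cong: conj_cong)
qed

text \<open>An inner vertex on a path to \<open>S\<close> has degree 2 in the union exactly when
  only one of its two children leads to \<open>S\<close>. The root and the leaves have degree at
  most 1 there.\<close>

lemma B_iff:
  "v \<in> B \<longleftrightarrow> v \<in> verts T \<and> S \<inter> cluster T v \<noteq> {} \<and>
    (v = rt T \<or> v \<in> leaves T \<or> (\<forall>c. child T v c \<longrightarrow> S \<inter> cluster T c \<noteq> {}))"
proof (cases "v \<in> verts U")
  case False
  then show ?thesis unfolding B_def U_verts by blast
next
  case True
  then have v: "v \<in> verts T" "S \<inter> cluster T v \<noteq> {}" unfolding U_verts by auto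
  let ?C = "{c. child T v c \<and> S \<inter> cluster T c \<noteq> {}}"
  have "deg U v \<noteq> 2 \<longleftrightarrow> v = rt T \<or> v \<in> leaves T \<or> (\<forall>c. child T v c \<longrightarrow> S \<inter> cluster T c \<noteq> {})"
  proof (cases "v = rt T \<or> v \<in> leaves T")
    case rl: True
    then show ?thesis
    proof
      assume r: "v = rt T"
      obtain c where "\<And>c'. child T v c' \<Longrightarrow> c' = c" using rt_child r by metis
      then have "?C \<subseteq> {c}" by blast
      then have "card ?C \<le> 1" using card_mono[of "{c}" ?C] by simp
      then show ?thesis using deg_U[OF True] r by simp
    next
      assume "v \<in> leaves T"
      then have C: "?C = {}" using leaf_no_child by blast
      have "deg U v = (if v = rt T then 0 else 1)" using deg_U[OF True] unfolding C by simp
      then show ?thesis using \<open>v \<in> leaves T\<close> by simp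
    qed
  next
    case False
    then have nr: "v \<noteq> rt T" and nl: "v \<notin> leaves T" by auto
    obtain c d where cd: "child T v c" "child T v d" "c \<noteq> d" "\<And>x. child T v x \<Longrightarrow> x = c \<or> x = d"
      by (rule inner_children[OF v(1) nr nl]) blast
    have "{x. child T v x} = {c, d}" using cd by blast
    then have "cluster T v = cluster T c \<union> cluster T d"
      using cluster_children[OF v(1) nl] by simp
    then have some: "S \<inter> cluster T c \<noteq> {} \<or> S \<inter> cluster T d \<noteq> {}" using v(2) by blast
    consider "S \<inter> cluster T c \<noteq> {}" "S \<inter> cluster T d \<noteq> {}" | "S \<inter> cluster T c \<noteq> {}" "S \<inter> cluster T d = {}"
      | "S \<inter> cluster T c = {}" "S \<inter> cluster T d \<noteq> {}" using some by blast
    then show ?thesis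
    proof cases
      case 1
      then have "?C = {c, d}" using cd by blast
      then have "deg U v = 3" using deg_U[OF True] nr cd(3) by simp
      moreover have "\<forall>x. child T v x \<longrightarrow> S \<inter> cluster T x \<noteq> {}" using cd(4) 1 by blast
      ultimately show ?thesis by simp
    next
      case 2
      then have "?C = {c}" using cd by blast
      then have "deg U v = 2" using deg_U[OF True] nr by simp
      then show ?thesis using 2 cd(2) nr nl by auto
    next
      case 3
      then have "?C = {d}" using cd by blast
      then have "deg U v = 2" using deg_U[OF True] nr by simp
      then show ?thesis using 3 cd(1) nr nl by auto
    qed
  qed
  then show ?thesis unfolding B_def using True v by blast
qed

lemma rt_B: "rt T \<in> B"
  unfolding B_iff using rt_in cluster_rt S by auto

lemma S_B: "s \<in> S \<Longrightarrow> s \<in> B"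
  unfolding B_iff using S(1) S_verts cluster_leaf by blast

text \<open>A path that has gone down once cannot turn, since the only way up leads back to the
  vertex just left.\<close>

lemma down_path:
  assumes "path_betw T u (u # w # zs) v" "child T u w"
  shows "root_path T v = root_path T u @ w # zs"
  using assms
proof (induction zs arbitrary: u w)
  case Nil
  then have "v = w" unfolding path_betw_def by simp
  then show ?case using Nil.prems(2) unfolding child_def by simp
next
  case (Cons z zs)
  have p: "path_betw T w (w # z # zs) v"
    using path_betw_append(2)[of T u "[u]" w "z # zs" v] Cons.prems(1) by simp
  then have "{w, z} \<in> edges T" unfolding path_betw_def by (simp add: path_edges_Cons_Cons)
  moreover have "z \<noteq> u" using Cons.prems(1) unfolding path_betw_def by auto
  ultimately have "child T w z" using edge_child parent_unique Cons.prems(2) by blast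
  then have "root_path T v = root_path T w @ z # zs" by (rule Cons.IH[OF p])
  then show ?case using Cons.prems(2) unfolding child_def by simp
qed

lemma U_path_T: "path_betw U u xs v \<Longrightarrow> path_betw T u xs v"
  unfolding path_betw_def using U_edges_T U_verts by blast

text \<open>A path in the union that starts upwards could turn down only at a vertex both of whose
  children lead to \<open>S\<close>. Such a vertex belongs to \<open>B\<close>, and the interior
  vertices do not.\<close>

lemma up_path:
  assumes "path_betw U u (u # w # zs) v" "child T w u"
    and "\<And>x. x \<in> set (u # w # zs) - {u, v} \<Longrightarrow> x \<notin> B"
  shows "root_path T u = root_path T v @ tl (rev (u # w # zs))"
  using assms
proof (induction zs arbitrary: u w)
  case Nil
  then have "v = w" unfolding path_betw_def by simp
  then show ?case using Nil.prems(2) unfolding child_def by simp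
next
  case (Cons z zs)
  have p: "path_betw U w (w # z # zs) v"
    using path_betw_append(2)[of U u "[u]" w "z # zs" v] Cons.prems(1) by simp
  then have e: "{w, z} \<in> edges U" unfolding path_betw_def by (simp add: path_edges_Cons_Cons)
  have d: "distinct (u # w # z # zs)" "v \<in> set (z # zs)" "u \<in> verts U" "w \<in> verts U" "z \<in> verts U"
    using Cons.prems(1) last_in_set[of "z # zs"] unfolding path_betw_def by (auto simp del: last.simps simp: last_ConsR)
  have "w \<notin> B" using Cons.prems(3)[of w] d by auto
  have "child T z w"
  proof (rule ccontr)
    assume "\<not> child T z w"
    then have z: "child T w z" using e U_edges_T edge_child by blast
    have w: "w \<in> verts T" "S \<inter> cluster T w \<noteq> {}" using d(4) unfolding U_verts by auto
    have "w \<noteq> rt T" "w \<notin> leaves T" using \<open>w \<notin> B\<close> w unfolding B_iff by auto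
    then obtain c c' where c: "\<And>x. child T w x \<Longrightarrow> x = c \<or> x = c'"
      by (rule inner_children[OF w(1)]) blast
    have "u \<noteq> z" using d(1) by auto
    then have "x = u \<or> x = z" if "child T w x" for x
      using c[OF that] c[OF z] c[OF Cons.prems(2)] by blast
    then have "\<forall>x. child T w x \<longrightarrow> S \<inter> cluster T x \<noteq> {}" using d(3,5) unfolding U_verts by blast
    then show False using \<open>w \<notin> B\<close> w unfolding B_iff by blast
  qed
  then have "root_path T w = root_path T v @ tl (rev (w # z # zs))"
  proof (rule Cons.IH[OF p])
    fix x assume "x \<in> set (w # z # zs) - {w, v}"
    then have "x \<in> set (u # w # z # zs) - {u, v}" using d(1) by auto
    then show "x \<notin> B" by (rule Cons.prems(3))
  qed
  moreover have "tl (rev (u # w # z # zs)) = tl (rev (w # z # zs)) @ [u]" by (cases "rev zs") auto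
  ultimately show ?case using Cons.prems(2) unfolding child_def by simp
qed

text \<open>The covering relation of the ancestor order restricted to the vertices that survive the
  suppression; \<open>induced_edges\<close> identifies it with adjacency in the induced
  tree.\<close>

definition cov :: "'a \<Rightarrow> 'a \<Rightarrow> bool" where
  "cov u v \<longleftrightarrow> u \<in> B \<and> v \<in> B \<and> below T u v \<and> u \<noteq> v \<and>
     (\<forall>w\<in>B. below T u w \<longrightarrow> below T w v \<longrightarrow> w = u \<or> w = v)"

lemma B_verts: "v \<in> B \<Longrightarrow> v \<in> verts T"
  unfolding B_iff by blast

lemma cov_of_run:
  assumes "u \<in> B" "v \<in> B" "u \<noteq> v" "root_path T v = root_path T u @ zs"
    and "\<And>x. x \<in> set zs \<Longrightarrow> x \<noteq> v \<Longrightarrow> x \<notin> B"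
  shows "cov u v"
  unfolding cov_def
proof (intro conjI ballI impI)
  show "below T u v" using assms(1,2,4) B_verts unfolding below_def prefix_def by blast
  fix w assume w: "w \<in> B" "below T u w" "below T w v"
  then have "w \<in> set (root_path T u) \<or> w \<in> set zs"
    using below_iff_set[OF B_verts[OF assms(2)]] assms(4) by auto
  then show "w = u \<or> w = v"
  proof
    assume "w \<in> set (root_path T u)"
    then have "below T w u" using below_iff_set[OF B_verts[OF assms(1)]] by blast
    then show ?thesis using w(2) below_antisym by blast
  next
    assume "w \<in> set zs"
    then show ?thesis using assms(5)[of w] w(1) by blast
  qed
qed (use assms in auto)

lemma run_of_cov:
  assumes "cov u v"
  obtains xs where "path_betw U u xs v" "\<And>w. w \<in> set xs - {u, v} \<Longrightarrow> deg U w = 2"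
proof -
  have uv: "u \<in> B" "v \<in> B" "below T u v" "u \<noteq> v" and mid: "\<And>w. w \<in> B \<Longrightarrow> below T u w \<Longrightarrow> below T w v \<Longrightarrow> w = u \<or> w = v"
    using assms unfolding cov_def by auto
  have V: "u \<in> verts T" "v \<in> verts T" using uv B_verts by auto
  have meet_v: "S \<inter> cluster T v \<noteq> {}" using uv(2) unfolding B_iff by blast
  obtain zs where zs: "root_path T v = root_path T u @ zs" using uv(3) unfolding below_def prefix_def by blast
  obtain us where us: "root_path T u = us @ [u]"
    using root_path_facts(1,2)[OF V(1)] by (metis append_butlast_last_id)
  have split: "root_path T v = us @ u # zs" using zs us by simp
  then have pT: "path_betw T u (u # zs) v"
    using path_betw_append(2)[of T "rt T" us u zs v] root_path[OF V(2)] by simp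
  have between: "below T u x" "below T x v" if x: "x \<in> set (u # zs)" for x
  proof -
    show "below T x v" using below_iff_set[OF V(2)] x split by auto
    obtain as bs where ab: "u # zs = as @ x # bs" using x by (metis split_list)
    then have "root_path T x = us @ as @ [x]" using root_path_split[OF V(2), of "us @ as" x bs] split by simp
    moreover have "us @ as @ [x] = (us @ [u]) @ tl (as @ [x])" using ab by (cases as) auto
    ultimately show "below T u x"
      using us V(1) \<open>below T x v\<close> unfolding below_def prefix_def by auto
  qed
  have meet: "S \<inter> cluster T x \<noteq> {}" if "below T x v" for x using meet_mono[OF that meet_v] .
  have sub: "set (u # zs) \<subseteq> verts U"
    unfolding U_verts using between(2) meet below_verts by blast
  have "path_edges (u # zs) \<subseteq> path_edges (root_path T v)"
    unfolding split path_edges_append[of us u zs] by blast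
  also have "\<dots> \<subseteq> edges U"
    unfolding path_edges_root_path[OF V(2)] U_edges using meet by blast
  finally have "path_betw U u (u # zs) v" using pT sub unfolding path_betw_def by blast
  moreover have "deg U w = 2" if "w \<in> set (u # zs) - {u, v}" for w
  proof -
    have "w \<notin> B" using mid[of w] between[of w] that by blast
    then show ?thesis using sub that unfolding B_def by blast
  qed
  ultimately show thesis by (rule that)
qed

lemma induced_verts: "verts (induced_rtree T S) = B"
  unfolding induced_rtree_def suppress_deg2_def B_def by simp

lemma induced_rt: "rt (induced_rtree T S) = rt T"
  unfolding induced_rtree_def suppress_deg2_def root_paths_union_def by simp

text \<open>A path whose interior vertices are suppressed is monotone, by \<open>down_path\<close>
  or \<open>up_path\<close>, and so it runs between a covering pair.\<close>

lemma induced_edges: "{u, v} \<in> edges (induced_rtree T S) \<longleftrightarrow> cov u v \<or> cov v u"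
proof
  assume "{u, v} \<in> edges (induced_rtree T S)"
  then obtain a b xs where ab: "{u, v} = {a, b}" "a \<noteq> b" "deg U a \<noteq> 2" "deg U b \<noteq> 2"
    and p: "path_betw U a xs b" and mid: "\<forall>w\<in>set xs - {a, b}. deg U w = 2"
    unfolding induced_rtree_def suppress_deg2_def by auto
  have "a \<in> set xs" "b \<in> set xs" "set xs \<subseteq> verts U"
    using p hd_in_set[of xs] last_in_set[of xs] unfolding path_betw_def by auto
  then have B: "a \<in> B" "b \<in> B" using ab(3,4) unfolding B_def by auto
  have midB: "x \<notin> B" if "x \<in> set xs - {a, b}" for x using mid that unfolding B_def by blast
  obtain w zs where xs: "xs = a # w # zs"
    using p ab(2) unfolding path_betw_def by (cases xs; cases "tl xs") auto
  have pT: "path_betw T a (a # w # zs) b" using U_path_T p xs by simp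
  then have "{a, w} \<in> edges T" unfolding path_betw_def by (simp add: path_edges_Cons_Cons)
  then have "child T a w \<or> child T w a" by (rule edge_child)
  then have "cov a b \<or> cov b a"
  proof
    assume c: "child T a w"
    have "root_path T b = root_path T a @ w # zs" by (rule down_path[OF pT c])
    then have "cov a b"
    proof (rule cov_of_run[OF B ab(2)])
      fix x assume x: "x \<in> set (w # zs)" "x \<noteq> b"
      have "x \<noteq> a" using x(1) pT unfolding path_betw_def by auto
      then show "x \<notin> B" using midB x xs by auto
    qed
    then show ?thesis ..
  next
    assume c: "child T w a"
    have "root_path T a = root_path T b @ tl (rev (a # w # zs))"
      by (rule up_path[OF p[unfolded xs] c]) (use midB xs in auto)
    then have "cov b a"
    proof (rule cov_of_run[OF B(2,1) ab(2)[symmetric]])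
      fix x assume x: "x \<in> set (tl (rev (a # w # zs)))" "x \<noteq> a"
      have "distinct (rev xs)" "rev xs \<noteq> []" "hd (rev xs) = b"
        using p xs unfolding path_betw_def by (auto simp: hd_rev)
      then have "b \<notin> set (tl (rev xs))" by (cases "rev xs") auto
      then have "x \<noteq> b" using x(1) xs by auto
      moreover have "x \<in> set xs" using x(1) xs list.set_sel(2)[of "rev xs" x] by auto
      ultimately show "x \<notin> B" using midB x(2) by blast
    qed
    then show ?thesis ..
  qed
  then show "cov u v \<or> cov v u" using ab(1) by (auto simp: doubleton_eq_iff)
next
  have *: "{u, v} \<in> edges (induced_rtree T S)" if c: "cov u v" for u v
  proof -
    obtain xs where "path_betw U u xs v" "\<And>w. w \<in> set xs - {u, v} \<Longrightarrow> deg U w = 2"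
      by (rule run_of_cov[OF c]) blast
    moreover have "u \<noteq> v" "deg U u \<noteq> 2" "deg U v \<noteq> 2" using c unfolding cov_def B_def by auto
    ultimately show ?thesis unfolding induced_rtree_def suppress_deg2_def by auto
  qed
  assume "cov u v \<or> cov v u"
  then show "{u, v} \<in> edges (induced_rtree T S)"
    using *[of u v] *[of v u] by (auto simp: insert_commute)
qed

end

section \<open>The induced tree as a family of leaf sets\<close>

lemma covers_image:
  assumes "inj_on h I" "\<And>X. X \<in> F \<Longrightarrow> X \<subseteq> I" "X \<in> F" "Y \<in> F"
  shows "covers ((`) h ` F) (h ` X) (h ` Y) \<longleftrightarrow> covers F X Y"
proof -
  have *: "h ` P \<subset> h ` Q \<longleftrightarrow> P \<subset> Q" if "P \<in> F" "Q \<in> F" for P Q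
    using inj_on_image_subset_iff[OF assms(1) assms(2)[OF that(1)] assms(2)[OF that(2)]]
      inj_on_image_subset_iff[OF assms(1) assms(2)[OF that(2)] assms(2)[OF that(1)]]
    unfolding less_le_not_le by simp
  show ?thesis unfolding covers_def using * assms(3,4) by simp
qed

lemma subset_two: "X \<subseteq> {a, b} \<Longrightarrow> X = {} \<or> X = {a} \<or> X = {b} \<or> X = {a, b}"
  by blast

context binary_subtree
begin

definition trace :: "'a \<Rightarrow> 'a set" where
  "trace v = S \<inter> cluster T v"

text \<open>The root is left out, because its trace repeats that of its only child; without it,
  surviving vertices and members correspond one to one.\<close>

definition family :: "'a set set" where
  "family = {trace v | v. v \<in> verts T \<and> v \<noteq> rt T \<and> trace v \<noteq> {}}"

lemma trace_mono: "below T u v \<Longrightarrow> trace v \<subseteq> trace u"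
  unfolding trace_def using cluster_mono by blast

lemma trace_leaf: "s \<in> S \<Longrightarrow> trace s = {s}"
  unfolding trace_def using S(1) cluster_leaf by blast

text \<open>If \<open>w\<close> were properly above \<open>v\<close>, the child of \<open>w\<close>
  off the path to \<open>v\<close> would still lead to \<open>S\<close>, as \<open>w\<close> is in
  \<open>B\<close>. Then the trace of \<open>w\<close> would not fit into that of
  \<open>v\<close>.\<close>

lemma below_iff_trace:
  assumes v: "v \<in> B" and w: "w \<in> B" "w \<noteq> rt T"
  shows "below T v w \<longleftrightarrow> trace w \<subseteq> trace v"
proof
  assume sub: "trace w \<subseteq> trace v"
  have "trace w \<noteq> {}" using w(1) unfolding B_iff trace_def by blast
  then have "cluster T v \<inter> cluster T w \<noteq> {}" using sub unfolding trace_def by blast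
  then have "below T v w \<or> below T w v" by (rule cluster_meet)
  moreover have "w = v" if "below T w v"
  proof (rule ccontr)
    assume "w \<noteq> v"
    with that obtain c where c: "child T w c" "below T c v" by (rule below_child)
    have "w \<notin> leaves T" using leaf_no_child c(1) by blast
    then obtain c' d where d: "child T w c'" "child T w d" "c' \<noteq> d"
      using inner_children[OF B_verts[OF w(1)] w(2)] by metis
    then obtain d' where d': "child T w d'" "d' \<noteq> c" by metis
    have "S \<inter> cluster T d' \<noteq> {}" using w d'(1) \<open>w \<notin> leaves T\<close> unfolding B_iff by blast
    moreover have "cluster T d' \<subseteq> cluster T w" using d'(1) child_below cluster_mono by blast
    moreover have "cluster T d' \<inter> cluster T c = {}" using cluster_children_disjoint[OF d'(1) c(1) d'(2)] .
    moreover have "cluster T v \<subseteq> cluster T c" using cluster_mono[OF c(2)] .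
    ultimately show False using sub unfolding trace_def by blast
  qed
  ultimately show "below T v w" using below_refl[OF B_verts[OF v]] by blast
qed (rule trace_mono)

lemma trace_inj:
  assumes "v \<in> B" "v \<noteq> rt T" "w \<in> B" "w \<noteq> rt T" "trace v = trace w"
  shows "v = w"
  using below_iff_trace[of v w] below_iff_trace[of w v] assms below_antisym by simp

lemma family_B: "family = trace ` (B - {rt T})"
proof
  show "trace ` (B - {rt T}) \<subseteq> family"
  proof (rule image_subsetI)
    fix v assume v: "v \<in> B - {rt T}"
    then have "v \<in> B" by blast
    then have "v \<in> verts T" "trace v \<noteq> {}" using B_iff[of v] unfolding trace_def by auto
    then show "trace v \<in> family" unfolding family_def using v by blast
  qed
  show "family \<subseteq> trace ` (B - {rt T})"
  proof
    fix X assume "X \<in> family"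
    then obtain v where v: "X = trace v" "v \<in> verts T" "v \<noteq> rt T" "trace v \<noteq> {}"
      unfolding family_def by blast
    \<comment> \<open>The deepest vertex with the given trace survives: if one of its children
      missed \<open>S\<close>, the other child would have the same trace.\<close>
    let ?D = "{w. below T v w \<and> trace w = trace v}"
    have "finite ?D" using fin by (rule rev_finite_subset) (auto dest: below_verts)
    moreover have "?D \<noteq> {}" using below_refl[OF v(2)] by blast
    ultimately obtain w where w: "w \<in> ?D" "\<And>x. x \<in> ?D \<Longrightarrow> length (root_path T x) \<le> length (root_path T w)"
      by (rule obtain_max[where f = "\<lambda>x. length (root_path T x)"]) blast
    have wV: "w \<in> verts T" and bw: "below T v w" and tw: "trace w = trace v"
      using w(1) below_verts by auto
    have "w \<noteq> rt T"
    proof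
      assume "w = rt T"
      then show False using bw below_rt[OF v(2)] below_antisym v(3) by blast
    qed
    have "S \<inter> cluster T c \<noteq> {}" if "w \<notin> leaves T" and c: "child T w c" for c
    proof
      assume e: "S \<inter> cluster T c = {}"
      obtain x y where xy: "child T w x" "child T w y" "x \<noteq> y" "\<And>z. child T w z \<Longrightarrow> z = x \<or> z = y"
        by (rule inner_children[OF wV \<open>w \<noteq> rt T\<close> \<open>w \<notin> leaves T\<close>]) blast
      then obtain d where d: "child T w d" "d \<noteq> c" "\<And>z. child T w z \<Longrightarrow> z = c \<or> z = d"
        using c by metis
      have "{z. child T w z} = {c, d}" using c d by blast
      then have "cluster T w = cluster T c \<union> cluster T d"
        using cluster_children[OF wV \<open>w \<notin> leaves T\<close>] by simp
      then have "trace d = trace v" using e tw unfolding trace_def by blast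
      moreover have "below T v d" using bw child_below[OF d(1)] below_trans by blast
      ultimately have "length (root_path T d) \<le> length (root_path T w)" using w(2) by blast
      then show False using d(1) unfolding child_def by simp
    qed
    then have "w \<in> B" using wV v(4) tw unfolding B_iff trace_def by blast
    then show "X \<in> trace ` (B - {rt T})" using v(1) tw \<open>w \<noteq> rt T\<close> by blast
  qed
qed

lemma S_family: "S \<in> family"
proof -
  obtain c where c: "child T (rt T) c" "\<And>c'. child T (rt T) c' \<Longrightarrow> c' = c" by (rule rt_child) blast
  have "{x. child T (rt T) x} = {c}" using c by blast
  then have "cluster T c = leaves T"
    using cluster_children[OF rt_in rt_not_leaf] cluster_rt by simp
  then have "trace c = S" using S(1) unfolding trace_def by blast
  moreover have "c \<noteq> rt T" "c \<in> verts T" using child_below[OF c(1)] child_verts[OF c(1)] by auto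
  ultimately show ?thesis unfolding family_def using S(2) by blast
qed

lemma cov_rt:
  assumes "v \<in> B" "v \<noteq> rt T"
  shows "cov (rt T) v \<longleftrightarrow> trace v = S" "\<not> cov v (rt T)"
proof
  have sub: "trace w \<subseteq> S" for w unfolding trace_def by blast
  obtain c where c: "c \<in> B" "c \<noteq> rt T" "trace c = S" using S_family unfolding family_B by blast
  assume cv: "cov (rt T) v"
  have "below T c v" using below_iff_trace[OF c(1) assms] c(3) sub by blast
  moreover have "below T (rt T) c" using below_rt[OF B_verts[OF c(1)]] .
  ultimately have "c = v" using cv c unfolding cov_def by blast
  then show "trace v = S" using c by simp
next
  assume tv: "trace v = S"
  show "cov (rt T) v"
    unfolding cov_def
  proof (intro conjI ballI impI)
    fix w assume w: "w \<in> B" "below T w v"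
    have "w = v" if "w \<noteq> rt T"
    proof (rule trace_inj[OF w(1) that assms])
      show "trace w = trace v" using trace_mono[OF w(2)] tv unfolding trace_def by blast
    qed
    then show "w = rt T \<or> w = v" by blast
  qed (use assms rt_B below_rt[OF B_verts[OF assms(1)]] in auto)
next
  show "\<not> cov v (rt T)"
    unfolding cov_def using below_rt[OF B_verts[OF assms(1)]] below_antisym assms(2) by blast
qed

text \<open>Reduces adjacency of non-root vertices to inclusion of traces. The root, which is not
  represented in \<open>family\<close>, is treated in \<open>cov_rt\<close>.\<close>

lemma cov_iff_covers:
  assumes v: "v \<in> B" "v \<noteq> rt T" and w: "w \<in> B" "w \<noteq> rt T"
  shows "cov v w \<longleftrightarrow> covers family (trace v) (trace w)"
proof -
  have strict: "trace x \<subset> trace y \<longleftrightarrow> below T y x \<and> y \<noteq> x"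
    if "x \<in> B" "x \<noteq> rt T" "y \<in> B" "y \<noteq> rt T" for x y
    using below_iff_trace[of y x] below_iff_trace[of x y] that below_antisym[of x y] trace_inj[of x y]
    unfolding psubset_eq by auto
  have "cov v w \<longleftrightarrow> trace w \<subset> trace v \<and> \<not> (\<exists>x\<in>B - {rt T}. trace w \<subset> trace x \<and> trace x \<subset> trace v)"
  proof
    assume c: "cov v w"
    then have "trace w \<subset> trace v" using strict[OF w v] unfolding cov_def by blast
    moreover have False if "x \<in> B - {rt T}" "trace w \<subset> trace x" "trace x \<subset> trace v" for x
    proof -
      have "below T x w" "x \<noteq> w" "below T v x" "v \<noteq> x"
        using that strict[OF w, of x] strict[of x v] v by auto
      then show False using c that(1) unfolding cov_def by blast
    qed
    ultimately show "trace w \<subset> trace v \<and> \<not> (\<exists>x\<in>B - {rt T}. trace w \<subset> trace x \<and> trace x \<subset> trace v)" by blast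
  next
    assume c: "trace w \<subset> trace v \<and> \<not> (\<exists>x\<in>B - {rt T}. trace w \<subset> trace x \<and> trace x \<subset> trace v)"
    then have b: "below T v w" "v \<noteq> w" using strict[OF w v] by auto
    have "x = v \<or> x = w" if x: "x \<in> B" "below T v x" "below T x w" for x
    proof (rule ccontr)
      assume ne: "\<not> (x = v \<or> x = w)"
      have "x \<noteq> rt T" using x(2) below_rt[OF B_verts[OF v(1)]] below_antisym v(2) by blast
      then have "trace w \<subset> trace x" "trace x \<subset> trace v"
        using strict[OF w x(1)] strict[OF x(1) _ v] x ne by auto
      then show False using c x(1) \<open>x \<noteq> rt T\<close> by blast
    qed
    then show "cov v w" unfolding cov_def using v(1) w(1) b by blast
  qed
  then show ?thesis unfolding covers_def family_B using v w by auto
qed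

text \<open>The means to recognise an induced tree: a model tree \<open>K\<close> whose non-root
  vertices \<open>k\<close> are labelled by sets \<open>ks k\<close> of leaf indices, and a
  bijection \<open>h\<close> from indices to \<open>S\<close>. Equality of the families gives the
  isomorphism, because both edge relations are the covering relation.\<close>

lemma induced_iso:
  assumes K: "verts K = insert r V" "r \<notin> V" "{r} \<notin> edges K" and inj: "inj_on ks V"
    and edges: "\<And>k k'. k \<in> V \<Longrightarrow> k' \<in> V \<Longrightarrow>
      {k, k'} \<in> edges K \<longleftrightarrow> covers (ks ` V) (ks k) (ks k') \<or> covers (ks ` V) (ks k') (ks k)"
    and redges: "\<And>k. k \<in> V \<Longrightarrow> {r, k} \<in> edges K \<longleftrightarrow> ks k = I"
    and sub: "\<And>k. k \<in> V \<Longrightarrow> ks k \<subseteq> I"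
    and h: "inj_on h I" "h ` I = S" and fam: "family = (\<lambda>k. h ` ks k) ` V"
  obtains g where "bij_betw g (verts K) (verts (induced_rtree T S))" "g r = rt (induced_rtree T S)"
    "\<And>k. k \<in> V \<Longrightarrow> trace (g k) = h ` ks k \<and> g k \<in> B \<and> g k \<noteq> rt T"
    "\<And>k k'. k \<in> verts K \<Longrightarrow> k' \<in> verts K \<Longrightarrow>
      {k, k'} \<in> edges K \<longleftrightarrow> {g k, g k'} \<in> edges (induced_rtree T S)"
proof -
  have "\<forall>k\<in>V. \<exists>v. v \<in> B - {rt T} \<and> trace v = h ` ks k"
    using fam unfolding family_B by (metis imageE imageI)
  then obtain g0 where g0: "\<And>k. k \<in> V \<Longrightarrow> g0 k \<in> B - {rt T} \<and> trace (g0 k) = h ` ks k"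
    by metis
  define g where "g k = (if k = r then rt T else g0 k)" for k
  have gr: "g r = rt T" unfolding g_def by simp
  have gV: "trace (g k) = h ` ks k" "g k \<in> B" "g k \<noteq> rt T" if "k \<in> V" for k
    using g0[OF that] that K(2) unfolding g_def by auto
  have img_eq: "ks k = ks k'" if "k \<in> V" "k' \<in> V" "h ` ks k = h ` ks k'" for k k'
    using inj_on_image_eq_iff[OF h(1) sub[OF that(1)] sub[OF that(2)]] that(3) by simp
  have injg: "inj_on g V"
  proof (rule inj_onI)
    fix k k' assume k: "k \<in> V" "k' \<in> V" "g k = g k'"
    then have "h ` ks k = h ` ks k'" using gV(1) by metis
    then show "k = k'" using img_eq[OF k(1,2)] inj_onD[OF inj _ k(1,2)] by blast
  qed
  have "g ` V = B - {rt T}"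
  proof
    show "g ` V \<subseteq> B - {rt T}" using gV by auto
    show "B - {rt T} \<subseteq> g ` V"
    proof
      fix v assume v: "v \<in> B - {rt T}"
      then have "trace v \<in> family" unfolding family_B by blast
      then obtain k where k: "k \<in> V" "trace v = h ` ks k" unfolding fam by blast
      then have "v = g k" using trace_inj[of v "g k"] gV[OF k(1)] v by simp
      then show "v \<in> g ` V" using k by blast
    qed
  qed
  then have img: "g ` verts K = B"
    unfolding K(1) image_insert gr using rt_B by blast
  have "g r \<notin> g ` (V - {r})" using gV(3) gr by force
  then have "inj_on g (verts K)" unfolding K(1) inj_on_insert using injg by blast
  then have bij: "bij_betw g (verts K) (verts (induced_rtree T S))"
    unfolding bij_betw_def induced_verts using img by blast
  have F: "family = (`) h ` (ks ` V)" unfolding fam by (simp add: image_image)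
  have cc: "cov (g k) (g k') \<longleftrightarrow> covers (ks ` V) (ks k) (ks k')" if "k \<in> V" "k' \<in> V" for k k'
  proof -
    have "cov (g k) (g k') \<longleftrightarrow> covers family (h ` ks k) (h ` ks k')"
      using cov_iff_covers[OF gV(2,3)[OF that(1)] gV(2,3)[OF that(2)]] gV(1) that by simp
    moreover have "covers ((`) h ` (ks ` V)) (h ` ks k) (h ` ks k') \<longleftrightarrow> covers (ks ` V) (ks k) (ks k')"
      by (rule covers_image[OF h(1)]) (use sub that in auto)
    ultimately show ?thesis unfolding F by simp
  qed
  have rr: "{r, k} \<in> edges K \<longleftrightarrow> {g r, g k} \<in> edges (induced_rtree T S)" if "k \<in> V" for k
  proof -
    have "h ` ks k = S \<longleftrightarrow> ks k = I"
      using inj_on_image_eq_iff[OF h(1) sub[OF that] order_refl] h(2) by simp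
    then show ?thesis
      using redges[OF that] cov_rt[OF gV(2,3)[OF that]] gV(1)[OF that] gr unfolding induced_edges by simp
  qed
  have self: "\<not> cov (rt T) (rt T)" unfolding cov_def by simp
  show thesis
  proof (rule that[OF bij])
    show "g r = rt (induced_rtree T S)" using gr induced_rt by simp
    show "trace (g k) = h ` ks k \<and> g k \<in> B \<and> g k \<noteq> rt T" if "k \<in> V" for k using gV[OF that] by simp
    fix k k' assume "k \<in> verts K" "k' \<in> verts K"
    then consider "k \<in> V" "k' \<in> V" | "k = r" "k' \<in> V" | "k \<in> V" "k' = r" | "k = r" "k' = r"
      using K(1) by blast
    then show "{k, k'} \<in> edges K \<longleftrightarrow> {g k, g k'} \<in> edges (induced_rtree T S)"
    proof cases
      case 1
      then show ?thesis using edges[OF 1] cc[OF 1] cc[OF 1(2,1)] unfolding induced_edges by simp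
    next
      case 2
      then show ?thesis using rr by simp
    next
      case 3
      then show ?thesis using rr[of k] by (simp add: insert_commute)
    next
      case 4
      then show ?thesis using K(3) self gr unfolding induced_edges by simp
    qed
  qed
qed

lemma family_laminar:
  assumes "X \<in> family" "Y \<in> family"
  shows "X \<inter> Y = {} \<or> X \<subseteq> Y \<or> Y \<subseteq> X"
proof -
  obtain v w where "X = trace v" "Y = trace w" using assms unfolding family_def by blast
  moreover have "X \<inter> Y = {} \<or> below T v w \<or> below T w v"
    using cluster_meet[of v w] calculation unfolding trace_def by blast
  ultimately show ?thesis using trace_mono by blast
qed

lemma family_sub: "X \<in> family \<Longrightarrow> X \<subseteq> S \<and> X \<noteq> {}"
  unfolding family_def trace_def by blast

lemma singleton_family: "s \<in> S \<Longrightarrow> {s} \<in> family"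
proof -
  assume s: "s \<in> S"
  then have "s \<in> B - {rt T}" using S_B S(1) rt_not_leaf by auto
  then have "trace s \<in> family" unfolding family_B by (rule imageI)
  then show ?thesis using trace_leaf[OF s] by simp
qed

text \<open>A family of this kind is laminar and contains \<open>S\<close> and all singletons;
  together with the two given pairs this leaves no room for another member.\<close>

lemma balanced_family:
  assumes S4: "S = {a, b, c, d}" and fam: "{a, b} \<in> family" "{c, d} \<in> family"
    and dist: "distinct [a, b, c, d]"
  shows "family = {{a, b, c, d}, {a, b}, {c, d}, {a}, {b}, {c}, {d}}"
proof
  show "{{a, b, c, d}, {a, b}, {c, d}, {a}, {b}, {c}, {d}} \<subseteq> family"
    using S_family singleton_family S4 fam by auto
  show "family \<subseteq> {{a, b, c, d}, {a, b}, {c, d}, {a}, {b}, {c}, {d}}"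
  proof
    fix X assume X: "X \<in> family"
    have sub: "X \<subseteq> {a, b, c, d}" "X \<noteq> {}" using family_sub[OF X] S4 by auto
    have lam: "X \<inter> {a, b} = {} \<or> X \<subseteq> {a, b} \<or> {a, b} \<subseteq> X" "X \<inter> {c, d} = {} \<or> X \<subseteq> {c, d} \<or> {c, d} \<subseteq> X"
      using family_laminar[OF X] fam by auto
    from lam(1) consider "X \<subseteq> {c, d}" | "X \<subseteq> {a, b}" | "{a, b} \<subseteq> X" using sub(1) by blast
    then show "X \<in> {{a, b, c, d}, {a, b}, {c, d}, {a}, {b}, {c}, {d}}"
    proof cases
      case 1
      then show ?thesis using subset_two[OF 1] sub(2) by auto
    next
      case 2
      then show ?thesis using subset_two[OF 2] sub(2) by auto
    next
      case 3
      from lam(2) show ?thesis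
      proof (elim disjE)
        assume "X \<inter> {c, d} = {}"
        then have "X = {a, b}" using sub(1) 3 by blast
        then show ?thesis by simp
      next
        assume "X \<subseteq> {c, d}"
        then show ?thesis using 3 dist by auto
      next
        assume "{c, d} \<subseteq> X"
        then have "X = {a, b, c, d}" using sub(1) 3 by blast
        then show ?thesis by simp
      qed
    qed
  qed
qed

lemma caterpillar_family:
  assumes S4: "S = {a, b, c, d}" and fam: "{b, c, d} \<in> family" "{c, d} \<in> family"
    and dist: "distinct [a, b, c, d]"
  shows "family = {{a, b, c, d}, {b, c, d}, {c, d}, {a}, {b}, {c}, {d}}"
proof
  show "{{a, b, c, d}, {b, c, d}, {c, d}, {a}, {b}, {c}, {d}} \<subseteq> family"
    using S_family singleton_family S4 fam by auto
  show "family \<subseteq> {{a, b, c, d}, {b, c, d}, {c, d}, {a}, {b}, {c}, {d}}"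
  proof
    fix X assume X: "X \<in> family"
    have sub: "X \<subseteq> {a, b, c, d}" "X \<noteq> {}" using family_sub[OF X] S4 by auto
    have lam: "X \<inter> {b, c, d} = {} \<or> X \<subseteq> {b, c, d} \<or> {b, c, d} \<subseteq> X" "X \<inter> {c, d} = {} \<or> X \<subseteq> {c, d} \<or> {c, d} \<subseteq> X"
      using family_laminar[OF X] fam by auto
    from lam(1) consider "X \<subseteq> {a}" | "X \<subseteq> {b, c, d}" | "{b, c, d} \<subseteq> X" using sub(1) by blast
    then show "X \<in> {{a, b, c, d}, {b, c, d}, {c, d}, {a}, {b}, {c}, {d}}"
    proof cases
      case 1
      then have "X = {a}" using sub(2) by blast
      then show ?thesis by simp
    next
      case 2
      from lam(2) show ?thesis
      proof (elim disjE)
        assume "X \<inter> {c, d} = {}"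
        then have "X = {b}" using sub(2) 2 by blast
        then show ?thesis by simp
      next
        assume "X \<subseteq> {c, d}"
        then show ?thesis using subset_two[of X c d] sub(2) by auto
      next
        assume "{c, d} \<subseteq> X"
        then have "X = {c, d} \<or> X = {b, c, d}" using 2 by blast
        then show ?thesis by blast
      qed
    next
      case 3
      then have "X = {b, c, d} \<or> X = {a, b, c, d}" using sub(1) by blast
      then show ?thesis by blast
    qed
  qed
qed

end

section \<open>The tanglegrams \<open>\<K>\<^sub>1\<close> and \<open>\<K>\<^sub>2\<close>\<close>

definition kvs :: "kvertex set" where
  "kvs = {Inner 1, Inner 2, Inner 3, Leaf 1, Leaf 2, Leaf 3, Leaf 4}"

text \<open>The value at \<open>Root\<close> is a dummy, and every \<open>Inner n\<close> with
  \<open>n\<close> other than 1 and 2 is read as \<open>Inner 3\<close>; only vertices in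
  \<open>kvs\<close> matter.\<close>

definition balanced_leaves :: "kvertex \<Rightarrow> nat set" where
  "balanced_leaves k = (case k of Root \<Rightarrow> {} | Leaf i \<Rightarrow> {i}
     | Inner n \<Rightarrow> if n = 1 then {1, 2, 3, 4} else if n = 2 then {1, 2} else {3, 4})"

definition caterpillar_leaves :: "kvertex \<Rightarrow> nat set" where
  "caterpillar_leaves k = (case k of Root \<Rightarrow> {} | Leaf i \<Rightarrow> {i}
     | Inner n \<Rightarrow> if n = 1 then {1, 2, 3, 4} else if n = 2 then {2, 3, 4} else {3, 4})"

lemma balanced_family_eq:
  "balanced_leaves ` kvs = {{1, 2, 3, 4}, {1, 2}, {3, 4}, {1}, {2}, {3}, {4}}"
  unfolding kvs_def balanced_leaves_def by simp

lemma caterpillar_family_eq: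
  "caterpillar_leaves ` kvs = {{1, 2, 3, 4}, {2, 3, 4}, {3, 4}, {1}, {2}, {3}, {4}}"
  unfolding kvs_def caterpillar_leaves_def by simp

lemma balanced_edges:
  assumes "k \<in> kvs" "k' \<in> kvs"
  shows "{k, k'} \<in> edges balanced_rtree4 \<longleftrightarrow>
    covers (balanced_leaves ` kvs) (balanced_leaves k) (balanced_leaves k') \<or>
    covers (balanced_leaves ` kvs) (balanced_leaves k') (balanced_leaves k)"
  unfolding balanced_family_eq using assms unfolding kvs_def
  by (elim insertE emptyE; hypsubst;
      simp add: balanced_leaves_def covers_def balanced_rtree4_def doubleton_eq_iff psubset_eq set_eq_subset)

lemma caterpillar_edges:
  assumes "k \<in> kvs" "k' \<in> kvs"
  shows "{k, k'} \<in> edges caterpillar_rtree4 \<longleftrightarrow>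
    covers (caterpillar_leaves ` kvs) (caterpillar_leaves k) (caterpillar_leaves k') \<or>
    covers (caterpillar_leaves ` kvs) (caterpillar_leaves k') (caterpillar_leaves k)"
  unfolding caterpillar_family_eq using assms unfolding kvs_def
  by (elim insertE emptyE; hypsubst;
      simp add: caterpillar_leaves_def covers_def caterpillar_rtree4_def doubleton_eq_iff psubset_eq set_eq_subset)

lemma balanced_facts:
  "verts balanced_rtree4 = insert Root kvs" "Root \<notin> kvs" "{Root} \<notin> edges balanced_rtree4"
  "inj_on balanced_leaves kvs"
  "\<And>k. k \<in> kvs \<Longrightarrow> {Root, k} \<in> edges balanced_rtree4 \<longleftrightarrow> balanced_leaves k = {1, 2, 3, 4}"
  "\<And>k. k \<in> kvs \<Longrightarrow> balanced_leaves k \<subseteq> {1, 2, 3, 4}"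
proof -
  show "verts balanced_rtree4 = insert Root kvs" unfolding balanced_rtree4_def kvs_def by simp
  show "Root \<notin> kvs" unfolding kvs_def by simp
  show "{Root} \<notin> edges balanced_rtree4" unfolding balanced_rtree4_def by simp
  show "inj_on balanced_leaves kvs"
  proof (rule inj_onI)
    fix k k' assume "k \<in> kvs" "k' \<in> kvs" "balanced_leaves k = balanced_leaves k'"
    then show "k = k'"
      unfolding kvs_def by (elim insertE emptyE; hypsubst; simp add: balanced_leaves_def set_eq_subset)
  qed
  show "{Root, k} \<in> edges balanced_rtree4 \<longleftrightarrow> balanced_leaves k = {1, 2, 3, 4}" if "k \<in> kvs" for k
    using that unfolding kvs_def
    by (elim insertE emptyE; hypsubst; simp add: balanced_leaves_def balanced_rtree4_def doubleton_eq_iff set_eq_subset)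
  show "balanced_leaves k \<subseteq> {1, 2, 3, 4}" if "k \<in> kvs" for k
    using that unfolding kvs_def by (elim insertE emptyE; hypsubst; simp add: balanced_leaves_def)
qed

lemma caterpillar_facts:
  "verts caterpillar_rtree4 = insert Root kvs" "Root \<notin> kvs" "{Root} \<notin> edges caterpillar_rtree4"
  "inj_on caterpillar_leaves kvs"
  "\<And>k. k \<in> kvs \<Longrightarrow> {Root, k} \<in> edges caterpillar_rtree4 \<longleftrightarrow> caterpillar_leaves k = {1, 2, 3, 4}"
  "\<And>k. k \<in> kvs \<Longrightarrow> caterpillar_leaves k \<subseteq> {1, 2, 3, 4}"
proof -
  show "verts caterpillar_rtree4 = insert Root kvs" unfolding caterpillar_rtree4_def kvs_def by simp
  show "Root \<notin> kvs" unfolding kvs_def by simp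
  show "{Root} \<notin> edges caterpillar_rtree4" unfolding caterpillar_rtree4_def by simp
  show "inj_on caterpillar_leaves kvs"
  proof (rule inj_onI)
    fix k k' assume "k \<in> kvs" "k' \<in> kvs" "caterpillar_leaves k = caterpillar_leaves k'"
    then show "k = k'"
      unfolding kvs_def by (elim insertE emptyE; hypsubst; simp add: caterpillar_leaves_def set_eq_subset)
  qed
  show "{Root, k} \<in> edges caterpillar_rtree4 \<longleftrightarrow> caterpillar_leaves k = {1, 2, 3, 4}" if "k \<in> kvs" for k
    using that unfolding kvs_def
    by (elim insertE emptyE; hypsubst; simp add: caterpillar_leaves_def caterpillar_rtree4_def doubleton_eq_iff set_eq_subset)
  show "caterpillar_leaves k \<subseteq> {1, 2, 3, 4}" if "k \<in> kvs" for k
    using that unfolding kvs_def by (elim insertE emptyE; hypsubst; simp add: caterpillar_leaves_def)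
qed

section \<open>Isomorphisms onto the two model tanglegrams\<close>

definition tree_iso :: "('b \<Rightarrow> 'c) \<Rightarrow> 'b rtree \<Rightarrow> 'c rtree \<Rightarrow> bool" where
  "tree_iso g K H \<longleftrightarrow> graph_iso g K H \<and> g (rt K) = rt H"

context binary_subtree
begin

lemma leaf_of_trace:
  assumes "v \<in> B" "v \<noteq> rt T" "trace v = {s}" "s \<in> S"
  shows "v = s"
proof (rule trace_inj[OF assms(1,2) S_B[OF assms(4)]])
  show "s \<noteq> rt T" using assms(4) S(1) rt_not_leaf by blast
  show "trace v = trace s" using assms(3) trace_leaf[OF assms(4)] by simp
qed

lemma induced_balanced:
  assumes S4: "S = {a, b, c, d}" and fam: "{a, b} \<in> family" "{c, d} \<in> family"
    and dist: "distinct [a, b, c, d]"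
  obtains g where "tree_iso g balanced_rtree4 (induced_rtree T S)"
    "g (Leaf 1) = a" "g (Leaf 2) = b" "g (Leaf 3) = c" "g (Leaf 4) = d"
proof -
  define h where "h i = (if i = 1 then a else if i = 2 then b else if i = 3 then c else d)" for i :: nat
  have hv: "h 1 = a" "h 2 = b" "h 3 = c" "h 4 = d" unfolding h_def by auto
  have inj: "inj_on h {1, 2, 3, 4}" using dist unfolding inj_on_def h_def by auto
  have img: "h ` {1, 2, 3, 4} = S" unfolding S4 by (simp only: image_insert image_empty hv)
  have F: "family = (\<lambda>k. h ` balanced_leaves k) ` kvs"
  proof -
    have "(\<lambda>k. h ` balanced_leaves k) ` kvs = (`) h ` (balanced_leaves ` kvs)"
      by (simp add: image_image)
    also have "\<dots> = {{a, b, c, d}, {a, b}, {c, d}, {a}, {b}, {c}, {d}}"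
      unfolding balanced_family_eq by (simp only: image_insert image_empty hv)
    finally show ?thesis using balanced_family[OF S4 fam dist] by simp
  qed
  obtain g where g: "bij_betw g (verts balanced_rtree4) (verts (induced_rtree T S))"
      "g Root = rt (induced_rtree T S)"
      "\<And>k. k \<in> kvs \<Longrightarrow> trace (g k) = h ` balanced_leaves k \<and> g k \<in> B \<and> g k \<noteq> rt T"
      "\<And>k k'. k \<in> verts balanced_rtree4 \<Longrightarrow> k' \<in> verts balanced_rtree4 \<Longrightarrow>
        {k, k'} \<in> edges balanced_rtree4 \<longleftrightarrow> {g k, g k'} \<in> edges (induced_rtree T S)"
    by (rule induced_iso[OF balanced_facts(1-4) balanced_edges balanced_facts(5,6) inj img F]) blast+
  have "rt balanced_rtree4 = Root" unfolding balanced_rtree4_def by simp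
  then have "tree_iso g balanced_rtree4 (induced_rtree T S)"
    unfolding tree_iso_def graph_iso_def using g by auto
  moreover have leaf: "g (Leaf i) = h i" if "Leaf i \<in> kvs" for i
  proof (rule leaf_of_trace)
    have "i \<in> {1, 2, 3, 4}" using that unfolding kvs_def by auto
    then show "h i \<in> S" using img by blast
    show "trace (g (Leaf i)) = {h i}" using g(3)[OF that] unfolding balanced_leaves_def by simp
  qed (use g(3)[OF that] in auto)
  moreover have "Leaf 1 \<in> kvs" "Leaf 2 \<in> kvs" "Leaf 3 \<in> kvs" "Leaf 4 \<in> kvs" unfolding kvs_def by auto
  ultimately show thesis using that[of g] hv by simp
qed

lemma induced_caterpillar:
  assumes S4: "S = {a, b, c, d}" and fam: "{b, c, d} \<in> family" "{c, d} \<in> family"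
    and dist: "distinct [a, b, c, d]"
  obtains g where "tree_iso g caterpillar_rtree4 (induced_rtree T S)"
    "g (Leaf 1) = a" "g (Leaf 2) = b" "g (Leaf 3) = c" "g (Leaf 4) = d"
proof -
  define h where "h i = (if i = 1 then a else if i = 2 then b else if i = 3 then c else d)" for i :: nat
  have hv: "h 1 = a" "h 2 = b" "h 3 = c" "h 4 = d" unfolding h_def by auto
  have inj: "inj_on h {1, 2, 3, 4}" using dist unfolding inj_on_def h_def by auto
  have img: "h ` {1, 2, 3, 4} = S" unfolding S4 by (simp only: image_insert image_empty hv)
  have F: "family = (\<lambda>k. h ` caterpillar_leaves k) ` kvs"
  proof -
    have "(\<lambda>k. h ` caterpillar_leaves k) ` kvs = (`) h ` (caterpillar_leaves ` kvs)"
      by (simp add: image_image)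
    also have "\<dots> = {{a, b, c, d}, {b, c, d}, {c, d}, {a}, {b}, {c}, {d}}"
      unfolding caterpillar_family_eq by (simp only: image_insert image_empty hv)
    finally show ?thesis using caterpillar_family[OF S4 fam dist] by simp
  qed
  obtain g where g: "bij_betw g (verts caterpillar_rtree4) (verts (induced_rtree T S))"
      "g Root = rt (induced_rtree T S)"
      "\<And>k. k \<in> kvs \<Longrightarrow> trace (g k) = h ` caterpillar_leaves k \<and> g k \<in> B \<and> g k \<noteq> rt T"
      "\<And>k k'. k \<in> verts caterpillar_rtree4 \<Longrightarrow> k' \<in> verts caterpillar_rtree4 \<Longrightarrow>
        {k, k'} \<in> edges caterpillar_rtree4 \<longleftrightarrow> {g k, g k'} \<in> edges (induced_rtree T S)"
    by (rule induced_iso[OF caterpillar_facts(1-4) caterpillar_edges caterpillar_facts(5,6) inj img F]) blast+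
  have "rt caterpillar_rtree4 = Root" unfolding caterpillar_rtree4_def by simp
  then have "tree_iso g caterpillar_rtree4 (induced_rtree T S)"
    unfolding tree_iso_def graph_iso_def using g by auto
  moreover have leaf: "g (Leaf i) = h i" if "Leaf i \<in> kvs" for i
  proof (rule leaf_of_trace)
    have "i \<in> {1, 2, 3, 4}" using that unfolding kvs_def by auto
    then show "h i \<in> S" using img by blast
    show "trace (g (Leaf i)) = {h i}" using g(3)[OF that] unfolding caterpillar_leaves_def by simp
  qed (use g(3)[OF that] in auto)
  moreover have "Leaf 1 \<in> kvs" "Leaf 2 \<in> kvs" "Leaf 3 \<in> kvs" "Leaf 4 \<in> kvs" unfolding kvs_def by auto
  ultimately show thesis using that[of g] hv by simp
qed

end

lemma underlying_edges:
  "{Inl u, Inl v} \<in> edges (underlying_graph T) \<longleftrightarrow> {u, v} \<in> edges (ltree T)"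
  "{Inr x, Inr y} \<in> edges (underlying_graph T) \<longleftrightarrow> {x, y} \<in> edges (rtree T)"
  "{Inl u, Inr y} \<in> edges (underlying_graph T) \<longleftrightarrow> (u, y) \<in> matching T"
proof -
  let ?L = "(\<lambda>e. Inl ` e) ` edges (ltree T)" and ?R = "(\<lambda>e. Inr ` e) ` edges (rtree T)"
    and ?M = "{{Inl l, Inr r} | l r. (l, r) \<in> matching T}"
  have E: "edges (underlying_graph T) = ?L \<union> ?R \<union> ?M" unfolding underlying_graph_def by simp
  have inj_image: "inj ((`) f)" if "inj f" for f :: "'c \<Rightarrow> 'd"
    by (rule injI) (simp add: inj_image_eq_iff[OF that])
  have notL: "e \<notin> ?L" if "Inr x \<in> e" for e x using that by auto
  have notR: "e \<notin> ?R" if "Inl x \<in> e" for e x using that by auto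
  have inM: "e \<in> ?M \<Longrightarrow> (\<exists>l. Inl l \<in> e) \<and> (\<exists>r. Inr r \<in> e)" for e by auto
  have LL: "{Inl u, Inl v} \<in> ?L \<longleftrightarrow> {u, v} \<in> edges (ltree T)"
    using inj_image_mem_iff[OF inj_image[OF inj_Inl], of "{u, v}"] by simp
  have RR: "{Inr x, Inr y} \<in> ?R \<longleftrightarrow> {x, y} \<in> edges (rtree T)"
    using inj_image_mem_iff[OF inj_image[OF inj_Inr], of "{x, y}"] by simp
  have MM: "{Inl u, Inr y} \<in> ?M \<longleftrightarrow> (u, y) \<in> matching T" by (auto simp: doubleton_eq_iff)
  have "{Inl u, Inl v} \<notin> ?R" "{Inl u, Inl v} \<notin> ?M"
    using notR[of u "{Inl u, Inl v}"] inM[of "{Inl u, Inl v}"] by auto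
  then show "{Inl u, Inl v} \<in> edges (underlying_graph T) \<longleftrightarrow> {u, v} \<in> edges (ltree T)"
    unfolding E using LL by blast
  have "{Inr x, Inr y} \<notin> ?L" "{Inr x, Inr y} \<notin> ?M"
    using notL[of x "{Inr x, Inr y}"] inM[of "{Inr x, Inr y}"] by auto
  then show "{Inr x, Inr y} \<in> edges (underlying_graph T) \<longleftrightarrow> {x, y} \<in> edges (rtree T)"
    unfolding E using RR by blast
  have "{Inl u, Inr y} \<notin> ?L" "{Inl u, Inr y} \<notin> ?R"
    using notL[of y "{Inl u, Inr y}"] notR[of u "{Inl u, Inr y}"] by auto
  then show "{Inl u, Inr y} \<in> edges (underlying_graph T) \<longleftrightarrow> (u, y) \<in> matching T"
    unfolding E using MM by blast
qed

text \<open>The tree isomorphisms start from the model \<open>K\<close>, the direction in which the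
  induced trees are recognised. The isomorphism asked for is the inverse of their sum map.\<close>

lemma tanglegram_iso_of_trees:
  assumes L: "tree_iso gL (ltree K) (ltree U)" and R: "tree_iso gR (rtree K) (rtree U)"
    and M: "\<And>k k'. k \<in> verts (ltree K) \<Longrightarrow> k' \<in> verts (rtree K) \<Longrightarrow>
      (k, k') \<in> matching K \<longleftrightarrow> (gL k, gR k') \<in> matching U"
    and rt: "rt (ltree K) \<in> verts (ltree K)" "rt (rtree K) \<in> verts (rtree K)"
  shows "tanglegram_isomorphic U K"
proof -
  define g where "g = map_sum gL gR"
  have gs: "g (Inl x) = Inl (gL x)" "g (Inr y) = Inr (gR y)" for x y unfolding g_def by auto
  let ?V = "verts (underlying_graph K)" and ?W = "verts (underlying_graph U)"
  have V: "?V = Inl ` verts (ltree K) \<union> Inr ` verts (rtree K)"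
    and W: "?W = Inl ` verts (ltree U) \<union> Inr ` verts (rtree U)"
    unfolding underlying_graph_def by auto
  have bL: "bij_betw gL (verts (ltree K)) (verts (ltree U))" and bR: "bij_betw gR (verts (rtree K)) (verts (rtree U))"
    using L R unfolding tree_iso_def graph_iso_def by auto
  have inj: "inj_on g ?V"
  proof (rule inj_onI)
    fix x y assume "x \<in> ?V" "y \<in> ?V" "g x = g y"
    then show "x = y"
      unfolding V using bij_betw_imp_inj_on[OF bL] bij_betw_imp_inj_on[OF bR]
      by (cases x; cases y) (auto simp: gs dest: inj_onD)
  qed
  have img: "g ` ?V = ?W"
    unfolding V W image_Un image_image gs
    using bij_betw_imp_surj_on[OF bL] bij_betw_imp_surj_on[OF bR] by (metis image_image)
  have edges: "{x, y} \<in> edges (underlying_graph K) \<longleftrightarrow> {g x, g y} \<in> edges (underlying_graph U)"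
    if "x \<in> ?V" "y \<in> ?V" for x y
  proof -
    have LL: "{a, b} \<in> edges (ltree K) \<longleftrightarrow> {gL a, gL b} \<in> edges (ltree U)"
      if "a \<in> verts (ltree K)" "b \<in> verts (ltree K)" for a b
      using L that unfolding tree_iso_def graph_iso_def by blast
    have RR: "{a, b} \<in> edges (rtree K) \<longleftrightarrow> {gR a, gR b} \<in> edges (rtree U)"
      if "a \<in> verts (rtree K)" "b \<in> verts (rtree K)" for a b
      using R that unfolding tree_iso_def graph_iso_def by blast
    from that consider a b where "x = Inl a" "y = Inl b" "a \<in> verts (ltree K)" "b \<in> verts (ltree K)"
      | a b where "x = Inr a" "y = Inr b" "a \<in> verts (rtree K)" "b \<in> verts (rtree K)"
      | a b where "x = Inl a" "y = Inr b" "a \<in> verts (ltree K)" "b \<in> verts (rtree K)"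
      | a b where "x = Inr b" "y = Inl a" "a \<in> verts (ltree K)" "b \<in> verts (rtree K)"
      unfolding V by blast
    then show ?thesis
    proof cases
      case 1
      then show ?thesis using LL by (simp add: gs underlying_edges)
    next
      case 2
      then show ?thesis using RR by (simp add: gs underlying_edges)
    next
      case 3
      then show ?thesis using M by (simp add: gs underlying_edges)
    next
      case 4
      then show ?thesis
        using M by (simp add: gs underlying_edges insert_commute[of "Inr _" "Inl _"])
    qed
  qed
  define f where "f = inv_into ?V g"
  have bg: "bij_betw g ?V ?W" using inj img unfolding bij_betw_def by blast
  have bf: "bij_betw f ?W ?V" unfolding f_def by (rule bij_betw_inv_into[OF bg])
  have fg: "f (g x) = x" if "x \<in> ?V" for x unfolding f_def using inv_into_f_f[OF inj that] .
  have gf: "g (f y) = y" "f y \<in> ?V" if "y \<in> ?W" for y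
    unfolding f_def using that img by (auto intro: f_inv_into_f inv_into_into)
  have "graph_iso f (underlying_graph U) (underlying_graph K)"
    unfolding graph_iso_def
  proof (intro conjI ballI bf)
    fix u v assume "u \<in> ?W" "v \<in> ?W"
    then show "{u, v} \<in> edges (underlying_graph U) \<longleftrightarrow> {f u, f v} \<in> edges (underlying_graph K)"
      using edges[of "f u" "f v"] gf by simp
  qed
  moreover have "g (Inl (rt (ltree K))) = Inl (rt (ltree U))" "g (Inr (rt (rtree K))) = Inr (rt (rtree U))"
    using L R unfolding tree_iso_def gs by auto
  moreover have "Inl (rt (ltree K)) \<in> ?V" "Inr (rt (rtree K)) \<in> ?V" using rt unfolding V by auto
  ultimately show ?thesis
    unfolding tanglegram_isomorphic_def using fg by metis
qed

lemma matching_transfer: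
  assumes "inj_on gL V" "inj_on gR W" "M \<subseteq> V \<times> W" "M' = (\<lambda>(k, k'). (gL k, gR k')) ` M" "k \<in> V" "k' \<in> W"
  shows "(k, k') \<in> M \<longleftrightarrow> (gL k, gR k') \<in> M'"
proof
  assume "(gL k, gR k') \<in> M'"
  then obtain x y where xy: "(x, y) \<in> M" "gL x = gL k" "gR y = gR k'" using assms(4) by auto
  then have "x = k" "y = k'" using assms(3,5,6) inj_onD[OF assms(1)] inj_onD[OF assms(2)] by blast+
  then show "(k, k') \<in> M" using xy by simp
qed (use assms(4) in auto)

lemma K1_verts: "verts (ltree K1) = insert Root kvs" "verts (rtree K1) = insert Root kvs"
  "ltree K1 = balanced_rtree4" "rtree K1 = balanced_rtree4" "rt balanced_rtree4 = Root"
  using balanced_facts(1) unfolding K1_def balanced_rtree4_def by auto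

lemma K2_verts: "verts (ltree K2) = insert Root kvs" "verts (rtree K2) = insert Root kvs"
  "ltree K2 = caterpillar_rtree4" "rtree K2 = caterpillar_rtree4" "rt caterpillar_rtree4 = Root"
  using caterpillar_facts(1) unfolding K2_def caterpillar_rtree4_def by auto

lemma tree_iso_inj: "tree_iso g K H \<Longrightarrow> inj_on g (verts K)"
  unfolding tree_iso_def graph_iso_def bij_betw_def by blast

locale tangle =
  fixes T :: "('a, 'b) tanglegram"
  assumes tangle: "is_tanglegram T"
begin

sublocale L: binary_tree "ltree T"
  by unfold_locales (use tangle in \<open>simp add: is_tanglegram_def\<close>)

sublocale R: binary_tree "rtree T"
  by unfold_locales (use tangle in \<open>simp add: is_tanglegram_def\<close>)

lemma matching_leaves: "e \<in> matching T \<Longrightarrow> fst e \<in> leaves (ltree T) \<and> snd e \<in> leaves (rtree T)"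
  using tangle unfolding is_tanglegram_def by auto

lemma fst_inj: "e \<in> matching T \<Longrightarrow> f \<in> matching T \<Longrightarrow> fst e = fst f \<Longrightarrow> e = f"
proof -
  assume ef: "e \<in> matching T" "f \<in> matching T" "fst e = fst f"
  then have "\<exists>!r. (fst e, r) \<in> matching T"
    using tangle matching_leaves[OF ef(1)] unfolding is_tanglegram_def by blast
  then show "e = f" using ef by (metis prod.collapse)
qed

lemma snd_inj: "e \<in> matching T \<Longrightarrow> f \<in> matching T \<Longrightarrow> snd e = snd f \<Longrightarrow> e = f"
proof -
  assume ef: "e \<in> matching T" "f \<in> matching T" "snd e = snd f"
  then have "\<exists>!l. (l, snd e) \<in> matching T"
    using tangle matching_leaves[OF ef(1)] unfolding is_tanglegram_def by blast
  then show "e = f" using ef by (metis prod.collapse)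
qed

lemma fst_eq_iff: "e \<in> matching T \<Longrightarrow> f \<in> matching T \<Longrightarrow> fst e = fst f \<longleftrightarrow> e = f"
  using fst_inj by blast

lemma snd_eq_iff: "e \<in> matching T \<Longrightarrow> f \<in> matching T \<Longrightarrow> snd e = snd f \<longleftrightarrow> e = f"
  using snd_inj by blast

lemma fst_onto: "l \<in> leaves (ltree T) \<Longrightarrow> \<exists>e\<in>matching T. fst e = l"
  using tangle unfolding is_tanglegram_def by (metis fst_conv)

lemma snd_onto: "r \<in> leaves (rtree T) \<Longrightarrow> \<exists>e\<in>matching T. snd e = r"
  using tangle unfolding is_tanglegram_def by (metis snd_conv)

lemma fin_matching: "finite (matching T)"
proof (rule finite_subset)
  show "matching T \<subseteq> leaves (ltree T) \<times> leaves (rtree T)" using tangle unfolding is_tanglegram_def by blast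
qed (simp add: L.fin_leaves R.fin_leaves)

text \<open>On the right the edges are listed as \<open>e1, e3, e2, e4\<close>, because the second
  left leaf of \<open>K1\<close> is matched to its third right leaf and vice versa.\<close>

lemma cross_responsible_K1:
  assumes e: "{e1, e2, e3, e4} \<subseteq> matching T" and dist: "distinct [e1, e2, e3, e4]"
    and l1: "v1 \<in> verts (ltree T)" "v1 \<noteq> rt (ltree T)" "{fst e1, fst e2, fst e3, fst e4} \<inter> cluster (ltree T) v1 = {fst e1, fst e2}"
    and l2: "v2 \<in> verts (ltree T)" "v2 \<noteq> rt (ltree T)" "{fst e1, fst e2, fst e3, fst e4} \<inter> cluster (ltree T) v2 = {fst e3, fst e4}"
    and r1: "w1 \<in> verts (rtree T)" "w1 \<noteq> rt (rtree T)" "{snd e1, snd e3, snd e2, snd e4} \<inter> cluster (rtree T) w1 = {snd e1, snd e3}"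
    and r2: "w2 \<in> verts (rtree T)" "w2 \<noteq> rt (rtree T)" "{snd e1, snd e3, snd e2, snd e4} \<inter> cluster (rtree T) w2 = {snd e2, snd e4}"
  shows "cross_responsible T {e1, e2, e3, e4}"
proof -
  have m: "e1 \<in> matching T" "e2 \<in> matching T" "e3 \<in> matching T" "e4 \<in> matching T" using e by auto
  have dl: "distinct [fst e1, fst e2, fst e3, fst e4]" using dist m by (auto simp: fst_eq_iff)
  have dr: "distinct [snd e1, snd e3, snd e2, snd e4]" using dist m by (auto simp: snd_eq_iff)
  interpret SL: binary_subtree "ltree T" "{fst e1, fst e2, fst e3, fst e4}"
    by unfold_locales (use m matching_leaves in auto)
  interpret SR: binary_subtree "rtree T" "{snd e1, snd e3, snd e2, snd e4}"
    by unfold_locales (use m matching_leaves in auto)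
  have fl: "{fst e1, fst e2} \<in> SL.family" "{fst e3, fst e4} \<in> SL.family"
    unfolding SL.family_def SL.trace_def using l1 l2 by blast+
  have fr: "{snd e1, snd e3} \<in> SR.family" "{snd e2, snd e4} \<in> SR.family"
    unfolding SR.family_def SR.trace_def using r1 r2 by blast+
  obtain gL where gL: "tree_iso gL balanced_rtree4 (induced_rtree (ltree T) {fst e1, fst e2, fst e3, fst e4})"
    "gL (Leaf 1) = fst e1" "gL (Leaf 2) = fst e2" "gL (Leaf 3) = fst e3" "gL (Leaf 4) = fst e4"
    by (rule SL.induced_balanced[OF refl fl dl])
  obtain gR where gR: "tree_iso gR balanced_rtree4 (induced_rtree (rtree T) {snd e1, snd e3, snd e2, snd e4})"
    "gR (Leaf 1) = snd e1" "gR (Leaf 2) = snd e3" "gR (Leaf 3) = snd e2" "gR (Leaf 4) = snd e4"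
    by (rule SR.induced_balanced[OF refl fr dr])
  let ?U = "subtanglegram T {e1, e2, e3, e4}"
  have U: "ltree ?U = induced_rtree (ltree T) {fst e1, fst e2, fst e3, fst e4}"
    "rtree ?U = induced_rtree (rtree T) {snd e1, snd e3, snd e2, snd e4}" "matching ?U = {e1, e2, e3, e4}"
    unfolding subtanglegram_def by (simp_all add: insert_commute)
  have "tanglegram_isomorphic ?U K1"
  proof (rule tanglegram_iso_of_trees)
    show L: "tree_iso gL (ltree K1) (ltree ?U)" unfolding U K1_verts by (rule gL(1))
    show R: "tree_iso gR (rtree K1) (rtree ?U)" unfolding U K1_verts by (rule gR(1))
    fix k k' assume k: "k \<in> verts (ltree K1)" "k' \<in> verts (rtree K1)"
    show "(k, k') \<in> matching K1 \<longleftrightarrow> (gL k, gR k') \<in> matching ?U"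
    proof (rule matching_transfer[OF tree_iso_inj[OF L] tree_iso_inj[OF R] _ _ k])
      show "matching K1 \<subseteq> verts (ltree K1) \<times> verts (rtree K1)"
        unfolding K1_verts(1,2) by (simp add: K1_def kvs_def)
      show "matching ?U = (\<lambda>(k, k'). (gL k, gR k')) ` matching K1"
        unfolding U K1_def tanglegram.simps image_insert image_empty case_prod_conv gL(2-) gR(2-) by simp
    qed
  qed (simp_all add: K1_verts(5) K1_verts(1,2) K1_verts(3,4)[symmetric], simp_all add: K1_verts)
  then show ?thesis unfolding cross_responsible_def using e by blast
qed

text \<open>On the right the edges are listed as \<open>e4, e2, e3, e1\<close>, because the matching
  of \<open>K2\<close> exchanges the first and the last leaf.\<close>

lemma cross_responsible_K2:
  assumes e: "{e1, e2, e3, e4} \<subseteq> matching T" and dist: "distinct [e1, e2, e3, e4]"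
    and l1: "v1 \<in> verts (ltree T)" "v1 \<noteq> rt (ltree T)" "{fst e1, fst e2, fst e3, fst e4} \<inter> cluster (ltree T) v1 = {fst e2, fst e3, fst e4}"
    and l2: "v2 \<in> verts (ltree T)" "v2 \<noteq> rt (ltree T)" "{fst e1, fst e2, fst e3, fst e4} \<inter> cluster (ltree T) v2 = {fst e3, fst e4}"
    and r1: "w1 \<in> verts (rtree T)" "w1 \<noteq> rt (rtree T)" "{snd e4, snd e2, snd e3, snd e1} \<inter> cluster (rtree T) w1 = {snd e2, snd e3, snd e1}"
    and r2: "w2 \<in> verts (rtree T)" "w2 \<noteq> rt (rtree T)" "{snd e4, snd e2, snd e3, snd e1} \<inter> cluster (rtree T) w2 = {snd e3, snd e1}"
  shows "cross_responsible T {e1, e2, e3, e4}"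
proof -
  have m: "e1 \<in> matching T" "e2 \<in> matching T" "e3 \<in> matching T" "e4 \<in> matching T" using e by auto
  have dl: "distinct [fst e1, fst e2, fst e3, fst e4]" using dist m by (auto simp: fst_eq_iff)
  have dr: "distinct [snd e4, snd e2, snd e3, snd e1]" using dist m by (auto simp: snd_eq_iff)
  interpret SL: binary_subtree "ltree T" "{fst e1, fst e2, fst e3, fst e4}"
    by unfold_locales (use m matching_leaves in auto)
  interpret SR: binary_subtree "rtree T" "{snd e4, snd e2, snd e3, snd e1}"
    by unfold_locales (use m matching_leaves in auto)
  have fl: "{fst e2, fst e3, fst e4} \<in> SL.family" "{fst e3, fst e4} \<in> SL.family"
    unfolding SL.family_def SL.trace_def using l1 l2 by blast+
  have fr: "{snd e2, snd e3, snd e1} \<in> SR.family" "{snd e3, snd e1} \<in> SR.family"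
    unfolding SR.family_def SR.trace_def using r1 r2 by blast+
  obtain gL where gL: "tree_iso gL caterpillar_rtree4 (induced_rtree (ltree T) {fst e1, fst e2, fst e3, fst e4})"
    "gL (Leaf 1) = fst e1" "gL (Leaf 2) = fst e2" "gL (Leaf 3) = fst e3" "gL (Leaf 4) = fst e4"
    by (rule SL.induced_caterpillar[OF refl fl dl])
  obtain gR where gR: "tree_iso gR caterpillar_rtree4 (induced_rtree (rtree T) {snd e4, snd e2, snd e3, snd e1})"
    "gR (Leaf 1) = snd e4" "gR (Leaf 2) = snd e2" "gR (Leaf 3) = snd e3" "gR (Leaf 4) = snd e1"
    by (rule SR.induced_caterpillar[OF refl fr dr])
  let ?U = "subtanglegram T {e1, e2, e3, e4}"
  have U: "ltree ?U = induced_rtree (ltree T) {fst e1, fst e2, fst e3, fst e4}"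
    "rtree ?U = induced_rtree (rtree T) {snd e4, snd e2, snd e3, snd e1}" "matching ?U = {e1, e2, e3, e4}"
    unfolding subtanglegram_def by (simp_all add: insert_commute)
  have "tanglegram_isomorphic ?U K2"
  proof (rule tanglegram_iso_of_trees)
    show L: "tree_iso gL (ltree K2) (ltree ?U)" unfolding U K2_verts by (rule gL(1))
    show R: "tree_iso gR (rtree K2) (rtree ?U)" unfolding U K2_verts by (rule gR(1))
    fix k k' assume k: "k \<in> verts (ltree K2)" "k' \<in> verts (rtree K2)"
    show "(k, k') \<in> matching K2 \<longleftrightarrow> (gL k, gR k') \<in> matching ?U"
    proof (rule matching_transfer[OF tree_iso_inj[OF L] tree_iso_inj[OF R] _ _ k])
      show "matching K2 \<subseteq> verts (ltree K2) \<times> verts (rtree K2)"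
        unfolding K2_verts(1,2) by (simp add: K2_def kvs_def)
      show "matching ?U = (\<lambda>(k, k'). (gL k, gR k')) ` matching K2"
        unfolding U K2_def tanglegram.simps image_insert image_empty case_prod_conv gL(2-) gR(2-) by simp
    qed
  qed (simp_all add: K2_verts(5) K2_verts(1,2) K2_verts(3,4)[symmetric], simp_all add: K2_verts)
  then show ?thesis unfolding cross_responsible_def using e by blast
qed

end

section \<open>The split systems of a tanglegram\<close>

text \<open>Matching edges instead of leaves are the points, so that both trees split the same set;
  \<open>f\<close> is \<open>fst\<close> for the left tree and \<open>snd\<close> for the right
  one.\<close>

definition edge_side :: "'c rtree \<Rightarrow> 'e set \<Rightarrow> ('e \<Rightarrow> 'c) \<Rightarrow> 'c \<Rightarrow> 'e option set" where
  "edge_side T M f v = Some ` {e \<in> M. f e \<in> cluster T v}"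

text \<open>The point \<open>None\<close> stands for the root, so that a rooted tree becomes an unrooted one.\<close>

definition tree_splits :: "'c rtree \<Rightarrow> 'e set \<Rightarrow> ('e \<Rightarrow> 'c) \<Rightarrow> 'e option set set" where
  "tree_splits T M f = edge_side T M f ` (verts T - {rt T}) \<union> uminus ` edge_side T M f ` (verts T - {rt T})"

lemma mem_edge_side: "Some e \<in> edge_side T M f v \<longleftrightarrow> e \<in> M \<and> f e \<in> cluster T v"
  "None \<notin> edge_side T M f v"
  unfolding edge_side_def by auto

lemma tree_splitsE:
  assumes "G \<in> tree_splits T M f"
  obtains v where "v \<in> verts T" "v \<noteq> rt T" "G = edge_side T M f v \<or> G = - edge_side T M f v"
  using assms unfolding tree_splits_def by auto

lemma tree_splitsI:
  assumes "v \<in> verts T" "v \<noteq> rt T"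
  shows "edge_side T M f v \<in> tree_splits T M f" "- edge_side T M f v \<in> tree_splits T M f"
  using assms unfolding tree_splits_def by auto

context binary_tree
begin

text \<open>Take a deepest non-root vertex with at least two points of \<open>Q\<close> below it.
  Each of its two children has at most one.\<close>

lemma cluster_of_two:
  assumes Q: "Q \<subseteq> leaves T" "2 \<le> card Q"
  obtains v where "v \<in> verts T" "v \<noteq> rt T" "card (cluster T v \<inter> Q) = 2"
proof -
  let ?D = "{v \<in> verts T. v \<noteq> rt T \<and> 2 \<le> card (cluster T v \<inter> Q)}"
  obtain c where c: "child T (rt T) c" "\<And>c'. child T (rt T) c' \<Longrightarrow> c' = c" by (rule rt_child) blast
  have "{x. child T (rt T) x} = {c}" using c by blast
  then have "cluster T c = leaves T"
    using cluster_children[OF rt_in rt_not_leaf] cluster_rt by simp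
  then have "cluster T c \<inter> Q = Q" using Q(1) by blast
  then have "c \<in> ?D" using Q(2) child_below[OF c(1)] child_verts[OF c(1)] by auto
  then have ne: "?D \<noteq> {}" by blast
  have "finite ?D" using fin by simp
  from this ne obtain v where v: "v \<in> ?D" "\<And>x. x \<in> ?D \<Longrightarrow> length (root_path T x) \<le> length (root_path T v)"
    by (rule obtain_max[where f = "\<lambda>x. length (root_path T x)"]) blast
  have vV: "v \<in> verts T" "v \<noteq> rt T" "2 \<le> card (cluster T v \<inter> Q)" using v(1) by auto
  have nl: "v \<notin> leaves T"
  proof
    assume "v \<in> leaves T"
    then have "cluster T v \<inter> Q \<subseteq> {v}" using cluster_leaf by blast
    then have "card (cluster T v \<inter> Q) \<le> 1" using card_mono[of "{v}"] by fastforce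
    then show False using vV(3) by simp
  qed
  obtain x y where xy: "child T v x" "child T v y" "x \<noteq> y" "\<And>z. child T v z \<Longrightarrow> z = x \<or> z = y"
    by (rule inner_children[OF vV(1,2) nl]) blast
  have "{z. child T v z} = {x, y}" using xy by blast
  then have cl: "cluster T v = cluster T x \<union> cluster T y"
    using cluster_children[OF vV(1) nl] by simp
  have small: "card (cluster T z \<inter> Q) \<le> 1" if "child T v z" for z
  proof (rule ccontr)
    assume "\<not> card (cluster T z \<inter> Q) \<le> 1"
    moreover have "z \<noteq> rt T"
    proof
      assume "z = rt T"
      then show False using child_below[OF that] below_rt[OF vV(1)] below_antisym by blast
    qed
    ultimately have "z \<in> ?D" using child_verts[OF that] by auto
    then have "length (root_path T z) \<le> length (root_path T v)" by (rule v(2))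
    then show False using that unfolding child_def by simp
  qed
  have "cluster T v \<inter> Q = (cluster T x \<inter> Q) \<union> (cluster T y \<inter> Q)" unfolding cl by blast
  then have "card (cluster T v \<inter> Q) \<le> card (cluster T x \<inter> Q) + card (cluster T y \<inter> Q)"
    using card_Un_le by metis
  then have "card (cluster T v \<inter> Q) = 2" using small[OF xy(1)] small[OF xy(2)] vV(3) by simp
  then show thesis using that vV(1,2) by blast
qed

lemma cluster_laminar: "cluster T v \<inter> cluster T w = {} \<or> cluster T v \<subseteq> cluster T w \<or> cluster T w \<subseteq> cluster T v"
  using cluster_meet cluster_mono by blast

text \<open>Compatibility is laminarity of the clusters. For the last clause, at least three of the
  four points are leaves, and a cluster with exactly two of them splits the quadruple two against
  two, \<open>None\<close> being in no cluster.\<close>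

lemma split_system_tree:
  assumes inj: "inj_on f M" and M: "f ` M \<subseteq> leaves T"
  shows "split_system (insert None (Some ` M)) (tree_splits T M f)"
  unfolding split_system_def
proof (intro conjI ballI impI)
  fix G assume "G \<in> tree_splits T M f"
  then obtain v where "v \<in> verts T" "v \<noteq> rt T" "G = edge_side T M f v \<or> G = - edge_side T M f v"
    by (rule tree_splitsE)
  then show "- G \<in> tree_splits T M f" using tree_splitsI by (metis double_complement)
next
  let ?N = "insert None (Some ` M)"
  fix G H assume "G \<in> tree_splits T M f" "H \<in> tree_splits T M f"
  then obtain v w where v: "G = edge_side T M f v \<or> G = - edge_side T M f v"
    and w: "H = edge_side T M f w \<or> H = - edge_side T M f w"
    by (elim tree_splitsE)
  define X Y where "X = edge_side T M f v" and "Y = edge_side T M f w"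
  have lam: "X \<inter> Y = {} \<or> X \<subseteq> Y \<or> Y \<subseteq> X"
    using cluster_laminar[of v w] unfolding X_def Y_def edge_side_def by blast
  from v w have "G = X \<or> G = - X" "H = Y \<or> H = - Y" unfolding X_def Y_def by auto
  then show "?N \<inter> G \<inter> H = {} \<or> ?N \<inter> G \<subseteq> H \<or> ?N \<inter> H \<subseteq> G \<or> ?N \<subseteq> G \<union> H"
    using lam by (elim disjE; hypsubst; blast)
next
  let ?N = "insert None (Some ` M)"
  fix a b c d assume N: "a \<in> ?N" "b \<in> ?N" "c \<in> ?N" "d \<in> ?N" and dist: "distinct [a, b, c, d]"
  define E where "E = {e \<in> M. Some e \<in> {a, b, c, d}}"
  have E_eq: "Some ` E = {a, b, c, d} - {None}" using N unfolding E_def by auto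
  have "card ({a, b, c, d} - {None}) \<ge> 3"
    using dist card_Diff_singleton_if[of "{a, b, c, d}" None] by auto
  then have cE: "card E \<ge> 3" using E_eq by (metis card_image inj_Some inj_on_subset subset_UNIV)
  have injE: "inj_on f E" using inj unfolding E_def by (rule inj_on_subset) blast
  have fE: "f ` E \<subseteq> leaves T" using M unfolding E_def by blast
  moreover have "2 \<le> card (f ` E)" using cE card_image[OF injE] by simp
  ultimately obtain v where v: "v \<in> verts T" "v \<noteq> rt T" "card (cluster T v \<inter> f ` E) = 2"
    by (rule cluster_of_two)
  define G where "G = edge_side T M f v"
  define P where "P = {e \<in> E. f e \<in> cluster T v}"
  have "cluster T v \<inter> f ` E = f ` P" unfolding P_def by blast
  moreover have "inj_on f P" using injE unfolding P_def by (rule inj_on_subset) blast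
  ultimately have "card P = 2" using v(3) card_image by metis
  then obtain x y where xy: "P = {x, y}" "x \<noteq> y" by (auto simp: card_2_iff)
  have mem: "t \<in> G \<longleftrightarrow> t = Some x \<or> t = Some y" if "t \<in> {a, b, c, d}" for t
  proof (cases t)
    case None
    then show ?thesis unfolding G_def by (simp add: mem_edge_side)
  next
    case (Some e)
    then have "t \<in> G \<longleftrightarrow> e \<in> P"
      using that unfolding G_def P_def E_def by (auto simp: mem_edge_side)
    then show ?thesis using Some xy by auto
  qed
  have "Some x \<in> {a, b, c, d}" "Some y \<in> {a, b, c, d}" using xy unfolding P_def E_def by auto
  moreover have "Some x \<noteq> Some y" using xy by simp
  ultimately have two: "\<exists>p q. p \<in> {a, b, c, d} \<and> q \<in> {a, b, c, d} \<and> p \<noteq> q \<and>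
      (\<forall>t\<in>{a, b, c, d}. t \<in> G \<longleftrightarrow> t = p \<or> t = q)"
    using mem by blast
  \<comment> \<open>The clause asks for a side that contains \<open>a\<close>, hence the choice
    between \<open>G\<close> and \<open>- G\<close>.\<close>
  have "(a \<in> G \<and> (b \<in> G \<and> c \<notin> G \<and> d \<notin> G \<or> b \<notin> G \<and> c \<in> G \<and> d \<notin> G \<or> b \<notin> G \<and> c \<notin> G \<and> d \<in> G)) \<or>
    (a \<notin> G \<and> (b \<notin> G \<and> c \<in> G \<and> d \<in> G \<or> b \<in> G \<and> c \<notin> G \<and> d \<in> G \<or> b \<in> G \<and> c \<in> G \<and> d \<notin> G))"
    using two dist by auto
  then show "\<exists>G\<in>tree_splits T M f. a \<in> G \<and> (b \<in> G \<and> c \<notin> G \<and> d \<notin> G \<or> b \<notin> G \<and> c \<in> G \<and> d \<notin> G \<or> b \<notin> G \<and> c \<notin> G \<and> d \<in> G)"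
  proof
    assume "a \<in> G \<and> (b \<in> G \<and> c \<notin> G \<and> d \<notin> G \<or> b \<notin> G \<and> c \<in> G \<and> d \<notin> G \<or> b \<notin> G \<and> c \<notin> G \<and> d \<in> G)"
    then show ?thesis using tree_splitsI(1)[OF v(1,2), of M f] unfolding G_def by (rule bexI)
  next
    assume "a \<notin> G \<and> (b \<notin> G \<and> c \<in> G \<and> d \<in> G \<or> b \<in> G \<and> c \<notin> G \<and> d \<in> G \<or> b \<in> G \<and> c \<in> G \<and> d \<notin> G)"
    then have "a \<in> - G \<and> (b \<in> - G \<and> c \<notin> - G \<and> d \<notin> - G \<or> b \<notin> - G \<and> c \<in> - G \<and> d \<notin> - G \<or> b \<notin> - G \<and> c \<notin> - G \<and> d \<in> - G)"
      by auto
    then show ?thesis using tree_splitsI(2)[OF v(1,2), of M f] unfolding G_def by (rule bexI)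
  qed
qed

text \<open>A side that avoids \<open>None\<close> is a cluster and not the complement of
  one.\<close>

lemma sep_cluster:
  assumes "sep (tree_splits T M f) P Q" "None \<in> Q"
  obtains v where "v \<in> verts T" "v \<noteq> rt T" "\<And>e. Some e \<in> P \<Longrightarrow> f e \<in> cluster T v"
    "\<And>e. e \<in> M \<Longrightarrow> Some e \<in> Q \<Longrightarrow> f e \<notin> cluster T v"
proof -
  obtain G where G: "G \<in> tree_splits T M f" "P \<subseteq> G" "Q \<inter> G = {}"
    using assms(1) unfolding sep_def by blast
  obtain v where v: "v \<in> verts T" "v \<noteq> rt T" "G = edge_side T M f v \<or> G = - edge_side T M f v"
    using G(1) by (rule tree_splitsE)
  have "None \<notin> G" using assms(2) G(3) by blast
  then have "G = edge_side T M f v" using v(3) by (auto simp: mem_edge_side)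
  have "f e \<in> cluster T v" if "Some e \<in> P" for e
    using that G(2) mem_edge_side(1)[of e T M f v] \<open>G = edge_side T M f v\<close> by blast
  moreover have "f e \<notin> cluster T v" if "e \<in> M" "Some e \<in> Q" for e
    using that G(3) mem_edge_side(1)[of e T M f v] \<open>G = edge_side T M f v\<close> by blast
  ultimately show thesis using that[OF v(1,2)] by blast
qed

end

section \<open>Obstructions through the root are cross-responsible sets\<close>

context tangle
begin

abbreviation "points \<equiv> insert None (Some ` matching T)"
abbreviation "lsplits \<equiv> tree_splits (ltree T) (matching T) fst"
abbreviation "rsplits \<equiv> tree_splits (rtree T) (matching T) snd"

lemma lsplits: "split_system points lsplits"
  by (rule L.split_system_tree) (use fst_inj matching_leaves in \<open>auto simp: inj_on_def\<close>)

lemma rsplits: "split_system points rsplits"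
  by (rule R.split_system_tree) (use snd_inj matching_leaves in \<open>auto simp: inj_on_def\<close>)

lemma cross_responsible_of_obs_root:
  assumes m: "e1 \<in> matching T" "e2 \<in> matching T" "e3 \<in> matching T" "e4 \<in> matching T"
    and ob: "obs lsplits rsplits {None} (Some e1) (Some e2) (Some e3) (Some e4)"
  shows "cross_responsible T {e1, e2, e3, e4}"
proof -
  have dist: "distinct [e1, e2, e3, e4]" using obs_distinct[OF ob] by auto
  have s: "sep lsplits {Some e1, Some e2} ({Some e3, Some e4} \<union> {None})"
    "sep lsplits {Some e3, Some e4} ({Some e1, Some e2} \<union> {None})"
    "sep rsplits {Some e1, Some e3} ({Some e2, Some e4} \<union> {None})"
    "sep rsplits {Some e2, Some e4} ({Some e1, Some e3} \<union> {None})"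
    using ob unfolding obs_def by auto
  obtain v1 where v1: "v1 \<in> verts (ltree T)" "v1 \<noteq> rt (ltree T)"
    "\<And>e. Some e \<in> {Some e1, Some e2} \<Longrightarrow> fst e \<in> cluster (ltree T) v1"
    "\<And>e. e \<in> matching T \<Longrightarrow> Some e \<in> {Some e3, Some e4} \<union> {None} \<Longrightarrow> fst e \<notin> cluster (ltree T) v1"
    by (rule L.sep_cluster[OF s(1)]) (blast, blast)
  obtain v2 where v2: "v2 \<in> verts (ltree T)" "v2 \<noteq> rt (ltree T)"
    "\<And>e. Some e \<in> {Some e3, Some e4} \<Longrightarrow> fst e \<in> cluster (ltree T) v2"
    "\<And>e. e \<in> matching T \<Longrightarrow> Some e \<in> {Some e1, Some e2} \<union> {None} \<Longrightarrow> fst e \<notin> cluster (ltree T) v2"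
    by (rule L.sep_cluster[OF s(2)]) (blast, blast)
  obtain w1 where w1: "w1 \<in> verts (rtree T)" "w1 \<noteq> rt (rtree T)"
    "\<And>e. Some e \<in> {Some e1, Some e3} \<Longrightarrow> snd e \<in> cluster (rtree T) w1"
    "\<And>e. e \<in> matching T \<Longrightarrow> Some e \<in> {Some e2, Some e4} \<union> {None} \<Longrightarrow> snd e \<notin> cluster (rtree T) w1"
    by (rule R.sep_cluster[OF s(3)]) (blast, blast)
  obtain w2 where w2: "w2 \<in> verts (rtree T)" "w2 \<noteq> rt (rtree T)"
    "\<And>e. Some e \<in> {Some e2, Some e4} \<Longrightarrow> snd e \<in> cluster (rtree T) w2"
    "\<And>e. e \<in> matching T \<Longrightarrow> Some e \<in> {Some e1, Some e3} \<union> {None} \<Longrightarrow> snd e \<notin> cluster (rtree T) w2"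
    by (rule R.sep_cluster[OF s(4)]) (blast, blast)
  show ?thesis
  proof (rule cross_responsible_K1[OF _ dist v1(1,2) _ v2(1,2) _ w1(1,2) _ w2(1,2)])
    show "{e1, e2, e3, e4} \<subseteq> matching T" using m by simp
    show "{fst e1, fst e2, fst e3, fst e4} \<inter> cluster (ltree T) v1 = {fst e1, fst e2}"
      using v1(3)[of e1] v1(3)[of e2] v1(4)[OF m(3)] v1(4)[OF m(4)] by simp
    show "{fst e1, fst e2, fst e3, fst e4} \<inter> cluster (ltree T) v2 = {fst e3, fst e4}"
      using v2(3)[of e3] v2(3)[of e4] v2(4)[OF m(1)] v2(4)[OF m(2)] by simp
    show "{snd e1, snd e3, snd e2, snd e4} \<inter> cluster (rtree T) w1 = {snd e1, snd e3}"
      using w1(3)[of e1] w1(3)[of e3] w1(4)[OF m(2)] w1(4)[OF m(4)] by simp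
    show "{snd e1, snd e3, snd e2, snd e4} \<inter> cluster (rtree T) w2 = {snd e2, snd e4}"
      using w2(3)[of e2] w2(3)[of e4] w2(4)[OF m(1)] w2(4)[OF m(3)] by simp
  qed
qed

text \<open>The root now sits in the cell \<open>a\<close> of the table. The two sides that contain
  it are replaced by their complements, which turns them into clusters of three; each contains the
  pair of the opposite side, so both trees are caterpillars.\<close>

lemma cross_responsible_of_obs_leaf:
  assumes m: "e1 \<in> matching T" "e2 \<in> matching T" "e3 \<in> matching T" "e4 \<in> matching T"
    and ob: "obs lsplits rsplits {Some e2} None (Some e1) (Some e4) (Some e3)"
  shows "cross_responsible T {e1, e2, e3, e4}"
proof -
  have dist: "distinct [e1, e2, e3, e4]" using obs_distinct[OF ob] by auto
  note clL = split_system_closed[OF lsplits] and clR = split_system_closed[OF rsplits]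
  have s: "sep lsplits ({Some e4, Some e3} \<union> {Some e2}) {None, Some e1}"
    "sep lsplits {Some e4, Some e3} ({None, Some e1} \<union> {Some e2})"
    "sep rsplits ({Some e1, Some e3} \<union> {Some e2}) {None, Some e4}"
    "sep rsplits {Some e1, Some e3} ({None, Some e4} \<union> {Some e2})"
    using ob sep_sym[OF clL] sep_sym[OF clR] unfolding obs_def by simp_all
  obtain v1 where v1: "v1 \<in> verts (ltree T)" "v1 \<noteq> rt (ltree T)"
    "\<And>e. Some e \<in> {Some e4, Some e3} \<union> {Some e2} \<Longrightarrow> fst e \<in> cluster (ltree T) v1"
    "\<And>e. e \<in> matching T \<Longrightarrow> Some e \<in> {None, Some e1} \<Longrightarrow> fst e \<notin> cluster (ltree T) v1"
    by (rule L.sep_cluster[OF s(1)]) (blast, blast)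
  obtain v2 where v2: "v2 \<in> verts (ltree T)" "v2 \<noteq> rt (ltree T)"
    "\<And>e. Some e \<in> {Some e4, Some e3} \<Longrightarrow> fst e \<in> cluster (ltree T) v2"
    "\<And>e. e \<in> matching T \<Longrightarrow> Some e \<in> {None, Some e1} \<union> {Some e2} \<Longrightarrow> fst e \<notin> cluster (ltree T) v2"
    by (rule L.sep_cluster[OF s(2)]) (blast, blast)
  obtain w1 where w1: "w1 \<in> verts (rtree T)" "w1 \<noteq> rt (rtree T)"
    "\<And>e. Some e \<in> {Some e1, Some e3} \<union> {Some e2} \<Longrightarrow> snd e \<in> cluster (rtree T) w1"
    "\<And>e. e \<in> matching T \<Longrightarrow> Some e \<in> {None, Some e4} \<Longrightarrow> snd e \<notin> cluster (rtree T) w1"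
    by (rule R.sep_cluster[OF s(3)]) (blast, blast)
  obtain w2 where w2: "w2 \<in> verts (rtree T)" "w2 \<noteq> rt (rtree T)"
    "\<And>e. Some e \<in> {Some e1, Some e3} \<Longrightarrow> snd e \<in> cluster (rtree T) w2"
    "\<And>e. e \<in> matching T \<Longrightarrow> Some e \<in> {None, Some e4} \<union> {Some e2} \<Longrightarrow> snd e \<notin> cluster (rtree T) w2"
    by (rule R.sep_cluster[OF s(4)]) (blast, blast)
  show ?thesis
  proof (rule cross_responsible_K2[OF _ dist v1(1,2) _ v2(1,2) _ w1(1,2) _ w2(1,2)])
    show "{e1, e2, e3, e4} \<subseteq> matching T" using m by simp
    show "{fst e1, fst e2, fst e3, fst e4} \<inter> cluster (ltree T) v1 = {fst e2, fst e3, fst e4}"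
      using v1(3)[of e2] v1(3)[of e3] v1(3)[of e4] v1(4)[OF m(1)] by simp
    show "{fst e1, fst e2, fst e3, fst e4} \<inter> cluster (ltree T) v2 = {fst e3, fst e4}"
      using v2(3)[of e3] v2(3)[of e4] v2(4)[OF m(1)] v2(4)[OF m(2)] by simp
    show "{snd e4, snd e2, snd e3, snd e1} \<inter> cluster (rtree T) w1 = {snd e2, snd e3, snd e1}"
      using w1(3)[of e1] w1(3)[of e2] w1(3)[of e3] w1(4)[OF m(4)] by simp
    show "{snd e4, snd e2, snd e3, snd e1} \<inter> cluster (rtree T) w2 = {snd e3, snd e1}"
      using w2(3)[of e1] w2(3)[of e3] w2(4)[OF m(2)] w2(4)[OF m(4)] by simp
  qed
qed

lemma cross_responsible_of_obs:
  assumes ob: "obs lsplits rsplits {p} q r s t" and N: "{p, q, r, s, t} \<subseteq> points"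
    and None: "None \<in> {p, q, r, s, t}"
  obtains Y where "cross_responsible T Y" "{p, q, r, s, t} = insert None (Some ` Y)"
proof -
  have dist: "distinct [p, q, r, s, t]" by (rule obs_distinct[OF ob])
  have some: "\<exists>e\<in>matching T. x = Some e" if "x \<in> {p, q, r, s, t}" "x \<noteq> None" for x
    using that N by auto
  note res = that
  \<comment> \<open>By the symmetries of the table the root can always be brought to the first
    cell.\<close>
  have leaf: thesis if "obs lsplits rsplits {p'} None r' s' t'" "{p', None, r', s', t'} = {p, q, r, s, t}" for p' r' s' t'
  proof -
    have d: "distinct [p', None, r', s', t']" by (rule obs_distinct[OF that(1)])
    have mem: "p' \<in> {p, q, r, s, t}" "r' \<in> {p, q, r, s, t}" "s' \<in> {p, q, r, s, t}" "t' \<in> {p, q, r, s, t}"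
      unfolding that(2)[symmetric] by simp_all
    have "p' \<noteq> None" "r' \<noteq> None" "s' \<noteq> None" "t' \<noteq> None" using d unfolding distinct.simps list.set insert_iff empty_iff by metis+
    then obtain e1 e2 e3 e4 where e: "e1 \<in> matching T" "r' = Some e1" "e2 \<in> matching T" "p' = Some e2"
      "e3 \<in> matching T" "t' = Some e3" "e4 \<in> matching T" "s' = Some e4"
      using some[OF mem(1)] some[OF mem(2)] some[OF mem(3)] some[OF mem(4)] by metis
    have "cross_responsible T {e1, e2, e3, e4}"
      using that(1) by (intro cross_responsible_of_obs_leaf e) (simp add: e)
    moreover have "{p, q, r, s, t} = insert None (Some ` {e1, e2, e3, e4})"
      unfolding that(2)[symmetric] e by auto
    ultimately show ?thesis by (rule res)
  qed
  from None consider "p = None" | "q = None" | "r = None" | "s = None" | "t = None" by auto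
  then show thesis
  proof cases
    case 1
    have "q \<noteq> None" "r \<noteq> None" "s \<noteq> None" "t \<noteq> None" using dist unfolding 1 distinct.simps list.set insert_iff empty_iff by metis+
    then obtain e1 e2 e3 e4 where e: "e1 \<in> matching T" "q = Some e1" "e2 \<in> matching T" "r = Some e2"
      "e3 \<in> matching T" "s = Some e3" "e4 \<in> matching T" "t = Some e4"
      using some[of q] some[of r] some[of s] some[of t] by (metis insertCI)
    have "cross_responsible T {e1, e2, e3, e4}"
      using ob 1 by (intro cross_responsible_of_obs_root e) (simp add: e)
    moreover have "{p, q, r, s, t} = insert None (Some ` {e1, e2, e3, e4})"
      unfolding 1 e by auto
    ultimately show ?thesis by (rule that)
  next
    case 2
    then show ?thesis using leaf[of p r s t] ob by simp
  next
    case 3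
    then show ?thesis using leaf[of p q t s] ob obs_cols[of lsplits rsplits "{p}" q r s t] by (simp add: insert_commute)
  next
    case 4
    then show ?thesis using leaf[of p t q r] ob obs_rows[of lsplits rsplits "{p}" q r s t] by (simp add: insert_commute)
  next
    case 5
    then show ?thesis
      using leaf[of p s r q] ob obs_rows[of lsplits rsplits "{p}" q r s t] obs_cols[of lsplits rsplits "{p}" s t q r]
      by (simp add: insert_commute)
  qed
qed

end

section \<open>The obstruction behind an isomorphism with \<open>K1\<close>\<close>

context binary_subtree
begin

lemma cov_upper_unique:
  assumes "cov u v" "cov u' v"
  shows "u = u'"
proof -
  have "below T u u' \<or> below T u' u" using assms below_linear unfolding cov_def by blast
  then show ?thesis using assms unfolding cov_def by metis
qed

lemma leaf_not_cov: "v \<in> S \<Longrightarrow> \<not> cov v x"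
  unfolding cov_def using S(1) below_leaf by blast

text \<open>The isomorphism might a priori leave the tree along a matching edge. Following
  \<open>balanced_rtree4\<close> down from the root excludes this step by step. The embedding
  \<open>inl\<close> and the partner map \<open>mate\<close> are abstract so that the argument
  serves both sides.\<close>

lemma balanced_pattern:
  fixes inl :: "'a \<Rightarrow> 'v" and E :: "'v set set"
  assumes nb: "\<And>u X. u \<in> B \<Longrightarrow> {inl u, X} \<in> E \<Longrightarrow>
      (\<exists>u'. X = inl u' \<and> (cov u u' \<or> cov u' u)) \<or> (u \<in> S \<and> X = mate u)"
    and inj: "inj_on g (insert Root kvs)" and root: "g Root = inl (rt T)"
    and edge: "\<And>k k'. {k, k'} \<in> edges balanced_rtree4 \<Longrightarrow> {g k, g k'} \<in> E"
  obtains v w a b c d where "g (Leaf 1) = inl a" "g (Leaf 2) = inl b" "g (Leaf 3) = inl c" "g (Leaf 4) = inl d"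
    "below T v a" "below T v b" "\<not> below T v c" "\<not> below T v d"
    "below T w c" "below T w d" "\<not> below T w a" "\<not> below T w b"
proof -
  \<comment> \<open>Besides its upper neighbour a leaf in \<open>S\<close> has only its partner as a
    neighbour. Two further distinct neighbours thus force \<open>v\<close> to be an inner vertex and
    the neighbours to be covered by it.\<close>
  have step: "\<exists>x y. X = inl x \<and> Y = inl y \<and> cov v x \<and> cov v y"
    if uv: "cov u v" and X: "{inl v, X} \<in> E" "X \<noteq> inl u" and Y: "{inl v, Y} \<in> E" "Y \<noteq> inl u" and "X \<noteq> Y"
    for u v X Y
  proof -
    have v: "v \<in> B" using uv unfolding cov_def by blast
    have one: "(\<exists>x. Z = inl x \<and> cov v x) \<or> (v \<in> S \<and> Z = mate v)" if "{inl v, Z} \<in> E" "Z \<noteq> inl u" for Z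
      using nb[OF v that(1)] cov_upper_unique[OF uv] that(2) by blast
    show ?thesis
      using one[OF X] one[OF Y] leaf_not_cov[of v] \<open>X \<noteq> Y\<close> by blast
  qed
  have ne: "g k \<noteq> g k'" if "k \<in> insert Root kvs" "k' \<in> insert Root kvs" "k \<noteq> k'" for k k'
    using inj_onD[OF inj] that by blast
  have edges: "{Root, Inner 1} \<in> edges balanced_rtree4" "{Inner 1, Inner 2} \<in> edges balanced_rtree4"
    "{Inner 1, Inner 3} \<in> edges balanced_rtree4" "{Inner 2, Leaf 1} \<in> edges balanced_rtree4"
    "{Inner 2, Leaf 2} \<in> edges balanced_rtree4" "{Inner 3, Leaf 3} \<in> edges balanced_rtree4"
    "{Inner 3, Leaf 4} \<in> edges balanced_rtree4"
    unfolding balanced_rtree4_def by auto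
  have "rt T \<notin> S" using S(1) rt_not_leaf by blast
  then obtain v1 where v1: "g (Inner 1) = inl v1" "cov (rt T) v1 \<or> cov v1 (rt T)"
    using nb[OF rt_B, of "g (Inner 1)"] edge[OF edges(1)] root by auto
  have "\<not> cov v1 (rt T)"
    unfolding cov_def using below_rt below_antisym B_verts by metis
  then have c1: "cov (rt T) v1" using v1 by blast
  have "g (Inner 2) \<noteq> inl (rt T)" "g (Inner 3) \<noteq> inl (rt T)" "g (Inner 2) \<noteq> g (Inner 3)"
    unfolding root[symmetric] by (rule ne; simp add: kvs_def)+
  then obtain v w where vw: "g (Inner 2) = inl v" "g (Inner 3) = inl w" "cov v1 v" "cov v1 w"
    using step[OF c1, of "g (Inner 2)" "g (Inner 3)"] edge[OF edges(2)] edge[OF edges(3)] v1(1) by auto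
  have "g (Leaf 1) \<noteq> inl v1" "g (Leaf 2) \<noteq> inl v1" "g (Leaf 1) \<noteq> g (Leaf 2)"
    unfolding v1(1)[symmetric] by (rule ne; simp add: kvs_def)+
  then obtain a b where ab: "g (Leaf 1) = inl a" "g (Leaf 2) = inl b" "cov v a" "cov v b"
    using step[OF vw(3), of "g (Leaf 1)" "g (Leaf 2)"] edge[OF edges(4)] edge[OF edges(5)] vw(1) by auto
  have "g (Leaf 3) \<noteq> inl v1" "g (Leaf 4) \<noteq> inl v1" "g (Leaf 3) \<noteq> g (Leaf 4)"
    unfolding v1(1)[symmetric] by (rule ne; simp add: kvs_def)+
  then obtain c d where cd: "g (Leaf 3) = inl c" "g (Leaf 4) = inl d" "cov w c" "cov w d"
    using step[OF vw(4), of "g (Leaf 3)" "g (Leaf 4)"] edge[OF edges(6)] edge[OF edges(7)] vw(2) by auto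
  have "g (Inner 2) \<noteq> g (Inner 3)" by (rule ne) (simp_all add: kvs_def)
  then have "v \<noteq> w" using vw(1,2) by auto
  have incomp: "\<not> below T v w" "\<not> below T w v"
    using vw(3,4) \<open>v \<noteq> w\<close> unfolding cov_def by metis+
  have not_both: "\<not> below T w x" if "below T v x" for x
    using below_linear[OF that] incomp by blast
  have bel: "below T v a" "below T v b" "below T w c" "below T w d"
    using ab(3,4) cd(3,4) unfolding cov_def by auto
  then have "\<not> below T w a" "\<not> below T w b" "\<not> below T v c" "\<not> below T v d"
    using not_both by blast+
  then show thesis using that[OF ab(1,2) cd(1,2)] bel by blast
qed

end

context tangle
begin

lemma sep_lsplits:
  assumes "below (ltree T) v (fst e)" "below (ltree T) v (fst f)" "e \<in> matching T" "f \<in> matching T"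
    and "\<not> below (ltree T) v (fst e')" "\<not> below (ltree T) v (fst f')" "e' \<in> matching T"
  shows "sep lsplits {Some e, Some f} ({Some e', Some f'} \<union> {None})"
proof -
  have "v \<in> verts (ltree T)" using assms(1) L.below_verts by blast
  moreover have "v \<noteq> rt (ltree T)"
    using assms(5) L.below_rt[OF L.leaves_verts] matching_leaves[OF assms(7)] by blast
  ultimately have "edge_side (ltree T) (matching T) fst v \<in> lsplits" by (rule tree_splitsI)
  then show ?thesis
    unfolding sep_def using assms matching_leaves
    by (intro bexI[of _ "edge_side (ltree T) (matching T) fst v"])
      (simp_all add: mem_edge_side cluster_def)
qed

lemma sep_rsplits:
  assumes "below (rtree T) v (snd e)" "below (rtree T) v (snd f)" "e \<in> matching T" "f \<in> matching T"
    and "\<not> below (rtree T) v (snd e')" "\<not> below (rtree T) v (snd f')" "e' \<in> matching T"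
  shows "sep rsplits {Some e, Some f} ({Some e', Some f'} \<union> {None})"
proof -
  have "v \<in> verts (rtree T)" using assms(1) R.below_verts by blast
  moreover have "v \<noteq> rt (rtree T)"
    using assms(5) R.below_rt[OF R.leaves_verts] matching_leaves[OF assms(7)] by blast
  ultimately have "edge_side (rtree T) (matching T) snd v \<in> rsplits" by (rule tree_splitsI)
  then show ?thesis
    unfolding sep_def using assms matching_leaves
    by (intro bexI[of _ "edge_side (rtree T) (matching T) snd v"])
      (simp_all add: mem_edge_side cluster_def)
qed

lemma obs_of_K1:
  assumes Y: "Y \<subseteq> matching T" and iso: "tanglegram_isomorphic (subtanglegram T Y) K1"
  obtains e1 e2 e3 e4 where "{e1, e2, e3, e4} \<subseteq> matching T"
    "obs lsplits rsplits {None} (Some e1) (Some e2) (Some e3) (Some e4)"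
proof -
  let ?U = "subtanglegram T Y"
  let ?W = "verts (underlying_graph ?U)" and ?V = "verts (underlying_graph K1)"
    and ?E = "edges (underlying_graph ?U)"
  obtain f where f: "bij_betw f ?W ?V"
    "\<And>u v. u \<in> ?W \<Longrightarrow> v \<in> ?W \<Longrightarrow> {u, v} \<in> ?E \<longleftrightarrow> {f u, f v} \<in> edges (underlying_graph K1)"
    "f (Inl (rt (ltree ?U))) = Inl (rt (ltree K1))" "f (Inr (rt (rtree ?U))) = Inr (rt (rtree K1))"
    using iso unfolding tanglegram_isomorphic_def graph_iso_def by blast
  have V: "?V = Inl ` insert Root kvs \<union> Inr ` insert Root kvs"
    unfolding underlying_graph_def K1_verts(1,2)[unfolded K1_verts(3,4)] by (simp add: K1_verts balanced_facts(1))
  have W: "?W = Inl ` verts (ltree ?U) \<union> Inr ` verts (rtree ?U)"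
    unfolding underlying_graph_def by simp
  have tr: "ltree ?U = induced_rtree (ltree T) (fst ` Y)" "rtree ?U = induced_rtree (rtree T) (snd ` Y)"
    "matching ?U = Y"
    unfolding subtanglegram_def by auto
  have "Y \<noteq> {}"
  proof
    assume "Y = {}"
    then have "?W = {}"
      unfolding W tr by (simp add: induced_rtree_def suppress_deg2_def root_paths_union_def)
    then have "?V = {}" using bij_betw_imp_surj_on[OF f(1)] by simp
    then show False unfolding V by simp
  qed
  interpret SL: binary_subtree "ltree T" "fst ` Y"
    by unfold_locales (use Y \<open>Y \<noteq> {}\<close> matching_leaves in auto)
  interpret SR: binary_subtree "rtree T" "snd ` Y"
    by unfold_locales (use Y \<open>Y \<noteq> {}\<close> matching_leaves in auto)
  have rtW: "Inl (rt (ltree T)) \<in> ?W" "Inr (rt (rtree T)) \<in> ?W"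
    unfolding W tr SL.induced_verts SR.induced_verts using SL.rt_B SR.rt_B by auto
  define g where "g = inv_into ?W f"
  have gf: "g (f u) = u" if "u \<in> ?W" for u
    unfolding g_def by (rule inv_into_f_f[OF bij_betw_imp_inj_on[OF f(1)] that])
  have bg: "bij_betw g ?V ?W" unfolding g_def by (rule bij_betw_inv_into[OF f(1)])
  have fg: "f (g x) = x" "g x \<in> ?W" if "x \<in> ?V" for x
    using that bij_betw_imp_surj_on[OF f(1)] unfolding g_def by (auto intro: f_inv_into_f inv_into_into)
  have edge: "{g x, g y} \<in> ?E" if "{x, y} \<in> edges (underlying_graph K1)" "x \<in> ?V" "y \<in> ?V" for x y
    using f(2)[OF fg(2)[OF that(2)] fg(2)[OF that(3)]] fg(1) that by simp
  have root: "g (Inl Root) = Inl (rt (ltree T))" "g (Inr Root) = Inr (rt (rtree T))"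
    using gf[OF rtW(1)] gf[OF rtW(2)] f(3,4) unfolding tr SL.induced_rt SR.induced_rt K1_verts by auto
  have kv: "k \<in> insert Root kvs \<and> k' \<in> insert Root kvs" if "{k, k'} \<in> edges balanced_rtree4" for k k'
    using that unfolding balanced_rtree4_def kvs_def by (auto simp: doubleton_eq_iff)
  have uniq: "r = r'" if "(l, r) \<in> Y" "(l, r') \<in> Y" for l r r'
    using fst_inj[of "(l, r)" "(l, r')"] that Y by auto
  have uniq': "l = l'" if "(l, r) \<in> Y" "(l', r) \<in> Y" for l l' r
    using snd_inj[of "(l, r)" "(l', r)"] that Y by auto
  \<comment> \<open>\<open>SOME\<close> names the unique matching partner, so that it becomes a
    function as required for \<open>mate\<close>.\<close>
  have nbL: "(\<exists>u'. X = Inl u' \<and> (SL.cov u u' \<or> SL.cov u' u)) \<or> (u \<in> fst ` Y \<and> X = Inr (SOME r. (u, r) \<in> Y))"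
    if "u \<in> SL.B" and e: "{Inl u, X} \<in> ?E" for u X
  proof (cases X)
    case (Inl u')
    then have "{u, u'} \<in> edges (induced_rtree (ltree T) (fst ` Y))"
      using e unfolding tr(1,2)[symmetric] by (simp add: underlying_edges)
    then show ?thesis using Inl unfolding SL.induced_edges by blast
  next
    case (Inr r)
    then have r: "(u, r) \<in> Y" using e by (simp add: underlying_edges tr)
    then have "(SOME r. (u, r) \<in> Y) = r" using uniq by (intro some_equality) auto
    then show ?thesis using r Inr by force
  qed
  have injL: "inj_on (\<lambda>k. g (Inl k)) (insert Root kvs)"
  proof (rule inj_onI)
    fix k k' assume k: "k \<in> insert Root kvs" "k' \<in> insert Root kvs" "g (Inl k) = g (Inl k')"
    have "Inl k \<in> ?V" "Inl k' \<in> ?V" unfolding V using k(1,2) by auto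
    then have "(Inl k :: kvertex + kvertex) = Inl k'"
      using inj_onD[OF bij_betw_imp_inj_on[OF bg] k(3)] by simp
    then show "k = k'" by simp
  qed
  have edgeL: "{g (Inl k), g (Inl k')} \<in> ?E" if "{k, k'} \<in> edges balanced_rtree4" for k k'
  proof (rule edge)
    show "{Inl k, Inl k'} \<in> edges (underlying_graph K1)"
      using that by (simp add: underlying_edges K1_verts)
    show "Inl k \<in> ?V" "Inl k' \<in> ?V" unfolding V using kv[OF that] by auto
  qed
  obtain v w a1 a2 a3 a4 where L: "g (Inl (Leaf 1)) = Inl a1" "g (Inl (Leaf 2)) = Inl a2"
    "g (Inl (Leaf 3)) = Inl a3" "g (Inl (Leaf 4)) = Inl a4"
    "below (ltree T) v a1" "below (ltree T) v a2" "\<not> below (ltree T) v a3" "\<not> below (ltree T) v a4"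
    "below (ltree T) w a3" "below (ltree T) w a4" "\<not> below (ltree T) w a1" "\<not> below (ltree T) w a2"
    by (rule SL.balanced_pattern[where g = "\<lambda>k. g (Inl k)" and inl = Inl and E = ?E
        and mate = "\<lambda>l. Inr (SOME r. (l, r) \<in> Y)", OF nbL injL root(1) edgeL]) blast+
  have nbR: "(\<exists>u'. X = Inr u' \<and> (SR.cov u u' \<or> SR.cov u' u)) \<or> (u \<in> snd ` Y \<and> X = Inl (SOME l. (l, u) \<in> Y))"
    if "u \<in> SR.B" and e: "{Inr u, X} \<in> ?E" for u X
  proof (cases X)
    case (Inr u')
    then have "{u, u'} \<in> edges (induced_rtree (rtree T) (snd ` Y))"
      using e unfolding tr(1,2)[symmetric] by (simp add: underlying_edges)
    then show ?thesis using Inr unfolding SR.induced_edges by blast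
  next
    case (Inl l)
    then have l: "(l, u) \<in> Y" using e by (simp add: underlying_edges tr insert_commute[of "Inr u" "Inl l"])
    then have "(SOME l. (l, u) \<in> Y) = l" using uniq' by (intro some_equality) auto
    then show ?thesis using l Inl by force
  qed
  have injR: "inj_on (\<lambda>k. g (Inr k)) (insert Root kvs)"
  proof (rule inj_onI)
    fix k k' assume k: "k \<in> insert Root kvs" "k' \<in> insert Root kvs" "g (Inr k) = g (Inr k')"
    have "Inr k \<in> ?V" "Inr k' \<in> ?V" unfolding V using k(1,2) by auto
    then have "(Inr k :: kvertex + kvertex) = Inr k'"
      using inj_onD[OF bij_betw_imp_inj_on[OF bg] k(3)] by simp
    then show "k = k'" by simp
  qed
  have edgeR: "{g (Inr k), g (Inr k')} \<in> ?E" if "{k, k'} \<in> edges balanced_rtree4" for k k'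
  proof (rule edge)
    show "{Inr k, Inr k'} \<in> edges (underlying_graph K1)"
      using that by (simp add: underlying_edges K1_verts)
    show "Inr k \<in> ?V" "Inr k' \<in> ?V" unfolding V using kv[OF that] by auto
  qed
  obtain v' w' b1 b2 b3 b4 where R: "g (Inr (Leaf 1)) = Inr b1" "g (Inr (Leaf 2)) = Inr b2"
    "g (Inr (Leaf 3)) = Inr b3" "g (Inr (Leaf 4)) = Inr b4"
    "below (rtree T) v' b1" "below (rtree T) v' b2" "\<not> below (rtree T) v' b3" "\<not> below (rtree T) v' b4"
    "below (rtree T) w' b3" "below (rtree T) w' b4" "\<not> below (rtree T) w' b1" "\<not> below (rtree T) w' b2"
    by (rule SR.balanced_pattern[where g = "\<lambda>k. g (Inr k)" and inl = Inr and E = ?E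
        and mate = "\<lambda>r. Inl (SOME l. (l, r) \<in> Y)", OF nbR injR root(2) edgeR]) blast+
  have match: "(x, y) \<in> Y" if "(Leaf i, Leaf j) \<in> matching K1" "g (Inl (Leaf i)) = Inl x" "g (Inr (Leaf j)) = Inr y" for i j x y
  proof -
    have "{Inl (Leaf i), Inr (Leaf j)} \<in> edges (underlying_graph K1)" using that(1) by (simp add: underlying_edges)
    moreover have "Leaf i \<in> kvs" "Leaf j \<in> kvs" using that(1) unfolding K1_def kvs_def by auto
    ultimately have "{g (Inl (Leaf i)), g (Inr (Leaf j))} \<in> ?E" by (intro edge) (auto simp: V)
    then show ?thesis using that(2,3) by (simp add: underlying_edges tr)
  qed
  have "(Leaf 1, Leaf 1) \<in> matching K1" "(Leaf 2, Leaf 3) \<in> matching K1"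
    "(Leaf 3, Leaf 2) \<in> matching K1" "(Leaf 4, Leaf 4) \<in> matching K1"
    unfolding K1_def by auto
  then have "(a1, b1) \<in> Y" "(a2, b3) \<in> Y" "(a3, b2) \<in> Y" "(a4, b4) \<in> Y"
    using match L(1-4) R(1-4) by blast+
  then have m: "(a1, b1) \<in> matching T" "(a2, b3) \<in> matching T" "(a3, b2) \<in> matching T" "(a4, b4) \<in> matching T"
    using Y by auto
  have "obs lsplits rsplits {None} (Some (a1, b1)) (Some (a2, b3)) (Some (a3, b2)) (Some (a4, b4))"
    unfolding obs_def
  proof (intro conjI)
    show "sep lsplits {Some (a1, b1), Some (a2, b3)} ({Some (a3, b2), Some (a4, b4)} \<union> {None})"
      by (rule sep_lsplits[of v]) (use L m in simp_all)
    show "sep lsplits {Some (a3, b2), Some (a4, b4)} ({Some (a1, b1), Some (a2, b3)} \<union> {None})"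
      by (rule sep_lsplits[of w]) (use L m in simp_all)
    show "sep rsplits {Some (a1, b1), Some (a3, b2)} ({Some (a2, b3), Some (a4, b4)} \<union> {None})"
      by (rule sep_rsplits[of v']) (use R m in simp_all)
    show "sep rsplits {Some (a2, b3), Some (a4, b4)} ({Some (a1, b1), Some (a3, b2)} \<union> {None})"
      by (rule sep_rsplits[of w']) (use R m in simp_all)
  qed
  moreover have "{(a1, b1), (a2, b3), (a3, b2), (a4, b4)} \<subseteq> matching T" using m by simp
  ultimately show thesis using that by blast
qed

end

section \<open>Drawing an ordered tree\<close>

lemma infdist_hyperplane:
  fixes n z :: "'a::euclidean_space"
  assumes "n \<noteq> 0"
  shows "infdist z {x. n \<bullet> x = c} = \<bar>n \<bullet> z - c\<bar> / norm n"
proof -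
  let ?H = "{x. n \<bullet> x = c}"
  define w where "w = z - ((n \<bullet> z - c) / (n \<bullet> n)) *\<^sub>R n"
  have nn: "n \<bullet> n = (norm n)\<^sup>2" "norm n > 0" using assms by (auto simp: dot_square_norm)
  have w: "w \<in> ?H" unfolding w_def using assms by (simp add: inner_diff_right)
  have "dist z w = \<bar>n \<bullet> z - c\<bar> / norm n"
    unfolding w_def dist_norm using nn by (simp add: power2_eq_square)
  then have le: "infdist z ?H \<le> \<bar>n \<bullet> z - c\<bar> / norm n"
    using infdist_le[OF w, of z] by simp
  have "\<bar>n \<bullet> z - c\<bar> / norm n \<le> dist z x" if "x \<in> ?H" for x
  proof -
    have "\<bar>n \<bullet> z - c\<bar> = \<bar>n \<bullet> (z - x)\<bar>" using that by (simp add: inner_diff_right)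
    also have "\<dots> \<le> norm n * norm (z - x)" by (rule Cauchy_Schwarz_ineq2)
    finally show ?thesis using nn(2) by (simp add: dist_norm pos_divide_le_eq mult.commute)
  qed
  moreover have "?H \<noteq> {}" using w by blast
  ultimately have "\<bar>n \<bullet> z - c\<bar> / norm n \<le> infdist z ?H"
    unfolding infdist_def by (auto intro: cINF_greatest)
  then show ?thesis using le by simp
qed

text \<open>Leaf positions for which every cluster is an interval; nothing more is needed for a
  plane straight-line drawing.\<close>

locale ordered_tree = binary_tree +
  fixes pos :: "'a \<Rightarrow> real"
  assumes pos_inj: "inj_on pos (leaves T)"
    and convex_cluster: "\<And>v a b x. v \<in> verts T \<Longrightarrow> a \<in> cluster T v \<Longrightarrow> b \<in> cluster T v \<Longrightarrow>
      x \<in> leaves T \<Longrightarrow> pos a < pos x \<Longrightarrow> pos x < pos b \<Longrightarrow> x \<in> cluster T v"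
begin

definition lo :: "'a \<Rightarrow> real" where "lo v = Min (pos ` cluster T v)"
definition hi :: "'a \<Rightarrow> real" where "hi v = Max (pos ` cluster T v)"

lemma cluster_leaves: "cluster T v \<subseteq> leaves T"
  unfolding cluster_def by blast

lemma fin_cluster: "finite (cluster T v)"
  using cluster_leaves fin_leaves by (rule finite_subset)

lemma lo_hi:
  assumes "v \<in> verts T"
  obtains a b where "a \<in> cluster T v" "pos a = lo v" "b \<in> cluster T v" "pos b = hi v"
proof -
  have "pos ` cluster T v \<noteq> {}" "finite (pos ` cluster T v)"
    using cluster_nonempty[OF assms] fin_cluster by auto
  then have "lo v \<in> pos ` cluster T v" "hi v \<in> pos ` cluster T v"
    unfolding lo_def hi_def by (auto intro: Min_in Max_in)
  then show thesis using that by (metis imageE)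
qed

lemma lo_le: "a \<in> cluster T v \<Longrightarrow> lo v \<le> pos a" and le_hi: "a \<in> cluster T v \<Longrightarrow> pos a \<le> hi v"
  unfolding lo_def hi_def using fin_cluster by auto

lemma lo_le_hi: "v \<in> verts T \<Longrightarrow> lo v \<le> hi v"
  using lo_hi lo_le by metis

lemma in_cluster:
  assumes "v \<in> verts T" "x \<in> leaves T" "lo v \<le> pos x" "pos x \<le> hi v"
  shows "x \<in> cluster T v"
proof -
  obtain a b where ab: "a \<in> cluster T v" "pos a = lo v" "b \<in> cluster T v" "pos b = hi v"
    by (rule lo_hi[OF assms(1)])
  consider "pos a = pos x" | "pos x = pos b" | "pos a < pos x" "pos x < pos b" using assms ab by linarith
  then show ?thesis
  proof cases
    case 1
    then show ?thesis using inj_onD[OF pos_inj, of a x] ab(1) cluster_leaves assms(2) by blast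
  next
    case 2
    then show ?thesis using inj_onD[OF pos_inj, of x b] ab(3) cluster_leaves assms(2) by blast
  next
    case 3
    then show ?thesis by (rule convex_cluster[OF assms(1) ab(1,3) assms(2)])
  qed
qed

lemma cluster_range:
  assumes "u \<in> verts T" "v \<in> verts T" "lo u \<le> lo v" "hi v \<le> hi u"
  shows "cluster T v \<subseteq> cluster T u"
proof
  fix x assume x: "x \<in> cluster T v"
  show "x \<in> cluster T u"
    by (rule in_cluster[OF assms(1)]) (use x cluster_leaves lo_le[OF x] le_hi[OF x] assms(3,4) in auto)
qed

lemma range_cluster:
  assumes "v \<in> verts T" "cluster T v \<subseteq> cluster T u"
  shows "lo u \<le> lo v" "hi v \<le> hi u"
proof -
  obtain a b where ab: "a \<in> cluster T v" "pos a = lo v" "b \<in> cluster T v" "pos b = hi v"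
    by (rule lo_hi[OF assms(1)])
  show "lo u \<le> lo v" using lo_le[of a u] ab(1,2) assms(2) by auto
  show "hi v \<le> hi u" using le_hi[of b u] ab(3,4) assms(2) by auto
qed

text \<open>A proper descendant of a non-root vertex \<open>v\<close> misses the leaves below
  another child of \<open>v\<close>. The root is excluded because its cluster equals that of its
  child.\<close>

lemma cluster_subset_below:
  assumes "v \<in> verts T" "v \<noteq> rt T" "cluster T v \<subseteq> cluster T u"
  shows "below T u v"
proof (rule ccontr)
  assume no: "\<not> below T u v"
  have "cluster T u \<inter> cluster T v \<noteq> {}" using assms(3) cluster_nonempty[OF assms(1)] by blast
  then have vu: "below T v u" using no cluster_meet by blast
  then have "v \<noteq> u" using no by blast
  with vu obtain c where c: "child T v c" "below T c u" by (rule below_child)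
  have nl: "v \<notin> leaves T" using leaf_no_child c(1) by blast
  obtain x y where xy: "child T v x" "child T v y" "x \<noteq> y"
    by (rule inner_children[OF assms(1,2) nl]) blast
  then obtain d where d: "child T v d" "d \<noteq> c" by metis
  have "cluster T d \<subseteq> cluster T v" using d(1) child_below cluster_mono by blast
  moreover have "cluster T u \<subseteq> cluster T c" by (rule cluster_mono[OF c(2)])
  moreover have "cluster T d \<inter> cluster T c = {}" by (rule cluster_children_disjoint[OF d(1) c(1) d(2)])
  moreover have "cluster T d \<noteq> {}" using cluster_nonempty child_verts[OF d(1)] by blast
  ultimately show False using assms(3) by blast
qed

lemma range_below:
  assumes "u \<in> verts T" "v \<in> verts T" "v \<noteq> rt T" "lo u \<le> lo v" "hi v \<le> hi u"
  shows "below T u v"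
  by (rule cluster_subset_below[OF assms(2,3) cluster_range[OF assms(1,2,4,5)]])

lemma below_range: "below T u v \<Longrightarrow> lo u \<le> lo v \<and> hi v \<le> hi u"
  using range_cluster cluster_mono below_verts by metis

text \<open>The intervals of the two children together reach both ends of the interval of
  \<open>u\<close>, and neither reaches both alone. This is what makes the edges axis-parallel in
  the coordinates used below.\<close>

lemma child_range:
  assumes c: "child T u c" and u: "u \<noteq> rt T"
  shows "lo c = lo u \<and> hi c < hi u \<or> hi c = hi u \<and> lo u < lo c"
proof -
  have V: "u \<in> verts T" "c \<in> verts T" using child_verts[OF c] by auto
  have nl: "u \<notin> leaves T" using leaf_no_child c by blast
  have nrt: "z \<noteq> rt T" if "child T u z" for z
    using child_below[OF that] below_rt[OF V(1)] below_antisym by blast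
  obtain x y where xy: "child T u x" "child T u y" "x \<noteq> y" "\<And>z. child T u z \<Longrightarrow> z = x \<or> z = y"
    by (rule inner_children[OF V(1) u nl]) blast
  then obtain d where d: "child T u d" "d \<noteq> c" "\<And>z. child T u z \<Longrightarrow> z = c \<or> z = d" using c by metis
  have "{z. child T u z} = {c, d}" using c d by blast
  then have cl: "cluster T u = cluster T c \<union> cluster T d"
    using cluster_children[OF V(1) nl] by simp
  have full: "\<not> (lo z = lo u \<and> hi z = hi u)" if z: "child T u z" for z
  proof
    assume "lo z = lo u \<and> hi z = hi u"
    then have "below T z u"
      using range_below[of z u] V(1) child_verts[OF z] u by simp
    then show False using child_below[OF z] below_antisym by blast
  qed
  have le: "lo u \<le> lo c" "hi c \<le> hi u" "lo u \<le> lo d" "hi d \<le> hi u"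
    using below_range child_below[OF c] child_below[OF d(1)] by auto
  obtain a b where ab: "a \<in> cluster T u" "pos a = lo u" "b \<in> cluster T u" "pos b = hi u"
    by (rule lo_hi[OF V(1)])
  have "lo c = lo u \<or> lo d = lo u"
    using ab(1,2) lo_le[of a c] lo_le[of a d] le unfolding cl by force
  moreover have "hi c = hi u \<or> hi d = hi u"
    using ab(3,4) le_hi[of b c] le_hi[of b d] le unfolding cl by force
  ultimately show ?thesis using full[OF c] full[OF d(1)] le by linarith
qed

lemma sibling_range:
  assumes "child T u c" "child T u d" "c \<noteq> d"
  shows "\<not> (lo c = lo u \<and> lo d = lo u)" "\<not> (hi c = hi u \<and> hi d = hi u)"
proof -
  have V: "c \<in> verts T" "d \<in> verts T" using child_verts assms by auto
  have dis: "cluster T c \<inter> cluster T d = {}" by (rule cluster_children_disjoint[OF assms])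
  obtain a b where ab: "a \<in> cluster T c" "pos a = lo c" "b \<in> cluster T c" "pos b = hi c"
    by (rule lo_hi[OF V(1)])
  obtain a' b' where ab': "a' \<in> cluster T d" "pos a' = lo d" "b' \<in> cluster T d" "pos b' = hi d"
    by (rule lo_hi[OF V(2)])
  have "a \<noteq> a'" "b \<noteq> b'" using ab ab' dis by auto
  then have "pos a \<noteq> pos a'" "pos b \<noteq> pos b'"
    using inj_onD[OF pos_inj, of a a'] inj_onD[OF pos_inj, of b b'] ab ab' cluster_leaves by blast+
  then show "\<not> (lo c = lo u \<and> lo d = lo u)" "\<not> (hi c = hi u \<and> hi d = hi u)" using ab ab' by auto
qed

text \<open>A vertex is drawn at the apex of an isosceles triangle over the interval spanned by its
  leaves. In the coordinates \<open>foot_l\<close>, \<open>foot_r\<close> (the ends of the base of that triangle) all edges but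
  the root edge are parallel to an axis.\<close>

definition left_end :: "'a \<Rightarrow> real" where "left_end v = lo v - (if v = rt T then 1 / 2 else 0)"
text \<open>The root spans the same leaves as its only child; the margin \<open>1 / 2\<close> at
  both ends places it strictly farther from the leaf-line.\<close>

definition right_end :: "'a \<Rightarrow> real" where "right_end v = hi v + (if v = rt T then 1 / 2 else 0)"
definition height :: "'a \<Rightarrow> real" where "height v = right_end v - left_end v"

text \<open>The leaf-line is horizontal at ordinate \<open>k\<close>, and \<open>s\<close>, which is
  1 or -1, selects the side of it on which the tree is drawn.\<close>

definition place :: "real \<Rightarrow> real \<Rightarrow> 'a \<Rightarrow> real \<times> real" where
  "place s k v = ((left_end v + right_end v) / 2, k + s * height v)"

definition foot_l :: "real \<Rightarrow> real \<Rightarrow> real \<times> real \<Rightarrow> real" where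
  "foot_l s k z = fst z - s * (snd z - k) / 2"

definition foot_r :: "real \<Rightarrow> real \<Rightarrow> real \<times> real \<Rightarrow> real" where
  "foot_r s k z = fst z + s * (snd z - k) / 2"

lemma foot_place:
  assumes "s * s = 1"
  shows "foot_l s k (place s k v) = left_end v" "foot_r s k (place s k v) = right_end v"
proof -
  have "s * (snd (place s k v) - k) = (s * s) * height v" unfolding place_def by simp
  then have "s * (snd (place s k v) - k) = height v" using assms by simp
  then show "foot_l s k (place s k v) = left_end v" "foot_r s k (place s k v) = right_end v"
    unfolding foot_l_def foot_r_def by (simp_all add: place_def height_def field_simps)
qed

lemma foot_eq:
  assumes "s * s = 1" "foot_l s k z = foot_l s k w" "foot_r s k z = foot_r s k w"
  shows "z = w"
proof -
  have 1: "fst z = fst w" using assms(2,3) unfolding foot_l_def foot_r_def by linarith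
  then have "s * (snd z - k) = s * (snd w - k)" using assms(2) unfolding foot_l_def by simp
  then have "s * s * (snd z - k) = s * s * (snd w - k)" by (simp add: mult.assoc)
  then show ?thesis using 1 assms(1) by (simp add: prod_eq_iff)
qed

lemma foot_segment:
  assumes "z \<in> closed_segment x y"
  obtains t where "0 \<le> t" "t \<le> 1"
    "foot_l s k z = (1 - t) * foot_l s k x + t * foot_l s k y"
    "foot_r s k z = (1 - t) * foot_r s k x + t * foot_r s k y"
proof -
  obtain t where t: "0 \<le> t" "t \<le> 1" "z = (1 - t) *\<^sub>R x + t *\<^sub>R y"
    using assms unfolding in_segment by blast
  have "foot_l s k z = (1 - t) * foot_l s k x + t * foot_l s k y"
    "foot_r s k z = (1 - t) * foot_r s k x + t * foot_r s k y"
    unfolding foot_l_def foot_r_def t(3) by (simp_all add: algebra_simps diff_divide_distrib add_divide_distrib)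
  then show thesis using that t(1,2) by blast
qed

text \<open>From \<open>u\<close> to \<open>c\<close> the base of the triangle shrinks linearly from
  the interval of \<open>u\<close>, widened if \<open>u\<close> is the root, to that of
  \<open>c\<close>; an end common to both stays fixed.\<close>

lemma edge_feet:
  assumes s: "s * s = 1" and c: "child T u c" and z: "z \<in> closed_segment (place s k u) (place s k c)"
  shows "foot_l s k z \<le> lo c" "hi c \<le> foot_r s k z"
    "u \<noteq> rt T \<Longrightarrow> lo u \<le> foot_l s k z \<and> foot_r s k z \<le> hi u"
    "u \<noteq> rt T \<Longrightarrow> lo c = lo u \<Longrightarrow> foot_l s k z = lo u"
    "u \<noteq> rt T \<Longrightarrow> hi c = hi u \<Longrightarrow> foot_r s k z = hi u"
proof -
  obtain t where t: "0 \<le> t" "t \<le> 1"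
    "foot_l s k z = (1 - t) * left_end u + t * left_end c"
    "foot_r s k z = (1 - t) * right_end u + t * right_end c"
    using foot_segment[OF z, of s k] foot_place[OF s] by metis
  have V: "u \<in> verts T" "c \<in> verts T" using child_verts[OF c] by auto
  have "c \<noteq> rt T" using child_below[OF c] below_rt[OF V(1)] below_antisym by blast
  then have ec: "left_end c = lo c" "right_end c = hi c" unfolding left_end_def right_end_def by auto
  have r: "lo u \<le> lo c" "hi c \<le> hi u" using below_range child_below[OF c] by auto
  have eu: "left_end u \<le> lo u" "hi u \<le> right_end u" unfolding left_end_def right_end_def by auto
  have "(1 - t) * left_end u + t * lo c \<le> (1 - t) * lo c + t * lo c"
    using t(1,2) eu r by (intro add_right_mono mult_left_mono) auto
  then show "foot_l s k z \<le> lo c" using t(3) ec by (simp add: algebra_simps)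
  have "(1 - t) * hi c + t * hi c \<le> (1 - t) * right_end u + t * hi c"
    using t(1,2) eu r by (intro add_right_mono mult_left_mono) auto
  then show "hi c \<le> foot_r s k z" using t(4) ec by (simp add: algebra_simps)
  assume nu: "u \<noteq> rt T"
  then have eu': "left_end u = lo u" "right_end u = hi u" unfolding left_end_def right_end_def by auto
  have "t * lo u \<le> t * lo c" "t * hi c \<le> t * hi u" using t(1) r by (auto intro: mult_left_mono)
  then show "lo u \<le> foot_l s k z \<and> foot_r s k z \<le> hi u"
    using t(3,4) ec eu' by (simp add: algebra_simps)
  show "lo c = lo u \<Longrightarrow> foot_l s k z = lo u" using t(3) ec eu' by (simp add: algebra_simps)
  show "hi c = hi u \<Longrightarrow> foot_r s k z = hi u" using t(4) ec eu' by (simp add: algebra_simps)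
qed

text \<open>The base at \<open>z\<close> contains the intervals of \<open>c\<close> and
  \<open>c'\<close> and lies in those of \<open>u\<close> and \<open>u'\<close>, so \<open>u\<close>
  is above \<open>c'\<close> and \<open>u'\<close> above \<open>c\<close>. If \<open>c\<close> and
  \<open>c'\<close> are comparable, the lower edge must start where the upper one ends. Otherwise
  the edges are siblings.\<close>

lemma edges_meet:
  assumes s: "s * s = 1" and c: "child T u c" "child T u' c'" "c \<noteq> c'"
    and z: "z \<in> closed_segment (place s k u) (place s k c)" "z \<in> closed_segment (place s k u') (place s k c')"
  shows "z \<in> place s k ` ({u, c} \<inter> {u', c'})"
proof -
  have V: "u \<in> verts T" "c \<in> verts T" "u' \<in> verts T" "c' \<in> verts T" using child_verts c by auto
  have crt: "c \<noteq> rt T" "c' \<noteq> rt T"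
    using child_below[OF c(1)] child_below[OF c(2)] below_rt V below_antisym by metis+
  note f = edge_feet[OF s c(1) z(1)] and f' = edge_feet[OF s c(2) z(2)]
  have uc': "below T u c'"
  proof (cases "u = rt T")
    case False
    show ?thesis by (rule range_below[OF V(1,4) crt(2)]) (use f(3)[OF False] f'(1,2) in linarith)+
  qed (use below_rt V in blast)
  have u'c: "below T u' c"
  proof (cases "u' = rt T")
    case False
    show ?thesis by (rule range_below[OF V(3,2) crt(1)]) (use f'(3)[OF False] f(1,2) in linarith)+
  qed (use below_rt V in blast)
  have comp: "z \<in> place s k ` ({a, b} \<inter> {a', b'})"
    if b: "below T b b'" "b \<noteq> b'" and ab: "child T a b" "child T a' b'"
      and za: "z \<in> closed_segment (place s k a) (place s k b)" "z \<in> closed_segment (place s k a') (place s k b')"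
    for a b a' b'
  proof -
    note g = edge_feet[OF s ab(1) za(1)] and g' = edge_feet[OF s ab(2) za(2)]
    have ba': "below T b a'" by (rule below_parent[OF ab(2) b])
    have bV: "b \<in> verts T" "a' \<in> verts T" using below_verts[OF ba'] by auto
    have brt: "b \<noteq> rt T" using child_below[OF ab(1)] below_rt child_verts[OF ab(1)] below_antisym by metis
    then have a'rt: "a' \<noteq> rt T" using ba' below_rt[OF bV(1)] below_antisym by metis
    have r: "lo b \<le> lo a'" "hi a' \<le> hi b" using below_range[OF ba'] by auto
    have eq: "foot_l s k z = lo b" "foot_r s k z = hi b" "lo b = lo a'" "hi b = hi a'"
      using g(1,2) g'(3)[OF a'rt] r by linarith+
    have "below T a' b" by (rule range_below[OF bV(2,1) brt]) (use eq in auto)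
    then have "a' = b" using ba' below_antisym by blast
    have "left_end b = lo b" "right_end b = hi b" using brt unfolding left_end_def right_end_def by auto
    then have "z = place s k b" using foot_eq[OF s] eq(1,2) foot_place[OF s] by metis
    then show ?thesis using \<open>a' = b\<close> by blast
  qed
  show ?thesis
  proof (cases "below T c c' \<or> below T c' c")
    case True
    then show ?thesis
    proof
      assume "below T c c'"
      then show ?thesis using c z by (intro comp)
    next
      assume "below T c' c"
      then have "z \<in> place s k ` ({u', c'} \<inter> {u, c})" using c z by (intro comp) auto
      then show ?thesis by (simp add: Int_commute)
    qed
  next
    case False
    have "u \<noteq> c'" using False child_below[OF c(1)] by blast
    then have uu': "below T u u'" by (rule below_parent[OF c(2) uc'])
    have "u' \<noteq> c" using False child_below[OF c(2)] by blast
    then have "below T u' u" by (rule below_parent[OF c(1) u'c])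
    then have u: "u' = u" using uu' below_antisym by blast
    have urt: "u \<noteq> rt T"
    proof
      assume "u = rt T"
      obtain d where "\<And>c'. child T (rt T) c' \<Longrightarrow> c' = d" by (rule rt_child) blast
      then show False using c \<open>u = rt T\<close> u by metis
    qed
    note sib = sibling_range[OF c(1) c(2)[unfolded u] c(3)]
    \<comment> \<open>Siblings share different ends with their parent, so each edge fixes one foot
      of \<open>z\<close> and together they fix both.\<close>
    have "foot_l s k z = lo u \<and> foot_r s k z = hi u"
      using child_range[OF c(1) urt] child_range[OF c(2)[unfolded u] urt] sib f(4,5)[OF urt] f'(4,5) urt
      unfolding u by metis
    moreover have "left_end u = lo u" "right_end u = hi u" using urt unfolding left_end_def right_end_def by auto
    ultimately have "z = place s k u" using foot_eq[OF s] foot_place[OF s] by metis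
    then show ?thesis using u by blast
  qed
qed

lemma height_below:
  assumes "below T u v" "u \<noteq> v"
  shows "height v < height u"
proof -
  have V: "u \<in> verts T" "v \<in> verts T" using below_verts[OF assms(1)] by auto
  have vrt: "v \<noteq> rt T" using assms below_rt[OF V(1)] below_antisym by blast
  have r: "lo u \<le> lo v" "hi v \<le> hi u" using below_range[OF assms(1)] by auto
  show ?thesis
  proof (cases "u = rt T")
    case True
    then show ?thesis using vrt r unfolding height_def left_end_def right_end_def by simp
  next
    case False
    have "\<not> (lo u = lo v \<and> hi v = hi u)"
    proof
      assume "lo u = lo v \<and> hi v = hi u"
      then have "below T v u" by (intro range_below[OF V(2,1) False]) auto
      then show False using assms below_antisym by blast
    qed
    then show ?thesis using False vrt r unfolding height_def left_end_def right_end_def by auto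
  qed
qed

lemma height_leaf: "l \<in> leaves T \<Longrightarrow> height l = 0" and place_leaf: "l \<in> leaves T \<Longrightarrow> place s k l = (pos l, k)"
proof -
  assume l: "l \<in> leaves T"
  then have "lo l = pos l" "hi l = pos l" unfolding lo_def hi_def using cluster_leaf by auto
  moreover have "l \<noteq> rt T" using l rt_not_leaf by blast
  ultimately show "height l = 0" "place s k l = (pos l, k)"
    unfolding place_def height_def left_end_def right_end_def by auto
qed

lemma height_nonneg: "v \<in> verts T \<Longrightarrow> 0 \<le> height v"
  using lo_le_hi unfolding height_def left_end_def right_end_def by auto

lemma height_pos:
  assumes "v \<in> verts T" "v \<notin> leaves T"
  shows "0 < height v"
proof -
  obtain l where l: "l \<in> cluster T v" using cluster_nonempty[OF assms(1)] by blast
  then have "below T v l" "l \<in> leaves T" unfolding cluster_def by auto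
  then show ?thesis using height_below[of v l] height_leaf assms(2) by auto
qed

lemma place_inj: "s * s = 1 \<Longrightarrow> inj_on (place s k) (verts T)"
proof (rule inj_onI)
  fix u v assume s: "s * s = 1" and V: "u \<in> verts T" "v \<in> verts T" and e: "place s k u = place s k v"
  have ends: "left_end u = left_end v" "right_end u = right_end v" using e foot_place[OF s] by metis+
  have rt_less: "left_end (rt T) < left_end w" if "w \<in> verts T" "w \<noteq> rt T" for w
    using below_range[OF below_rt[OF that(1)]] that(2) unfolding left_end_def by auto
  consider "u = rt T" | "v = rt T" | "u \<noteq> rt T" "v \<noteq> rt T" by blast
  then show "u = v"
  proof cases
    case 1
    then show ?thesis using rt_less[OF V(2)] ends by auto
  next
    case 2
    then show ?thesis using rt_less[OF V(1)] ends by auto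
  next
    case 3
    then have "lo u = lo v" "hi u = hi v" using ends unfolding left_end_def right_end_def by auto
    then show ?thesis
      using range_below[OF V 3(2)] range_below[OF V(2,1) 3(1)] below_antisym by simp
  qed
qed

text \<open>The normal \<open>(0, - s)\<close> has norm one and points from the tree to the
  leaf-line, so the distance of a vertex from that line is its \<open>height\<close>.\<close>

lemma plane_drawing_place:
  assumes s: "s * s = 1"
  shows "plane_drawing T (place s k) (0, - s) (- s * k)"
proof -
  let ?p = "place s k" and ?n = "(0, - s) :: real \<times> real" and ?c = "- s * k"
  have n0: "?n \<noteq> 0" using s by (auto simp: zero_prod_def)
  have "s = 1 \<or> s = - 1" using s by (simp add: square_eq_1_iff)
  then have norm: "norm ?n = 1" by (auto simp: norm_Pair)
  have inner: "?n \<bullet> ?p v = ?c - height v" for v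
  proof -
    have "?n \<bullet> ?p v = - s * k - (s * s) * height v" unfolding place_def by (simp add: algebra_simps)
    then show ?thesis using s by simp
  qed
  have dist: "infdist (?p v) {x. ?n \<bullet> x = ?c} = \<bar>height v\<bar>" for v
    unfolding infdist_hyperplane[OF n0] inner norm by simp
  show ?thesis
    unfolding plane_drawing_def
  proof (intro conjI ballI impI)
    show "inj_on ?p (verts T)" by (rule place_inj[OF s])
    show "?n \<noteq> 0" by (rule n0)
    show "?n \<bullet> ?p v = ?c" if "v \<in> leaves T" for v using inner height_leaf[OF that] by simp
    show "?n \<bullet> ?p v < ?c" if "v \<in> verts T - leaves T" for v using inner height_pos that by simp
    show "infdist (?p v) {x. ?n \<bullet> x = ?c} < infdist (?p u) {x. ?n \<bullet> x = ?c}"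
      if "u \<in> verts T" and v: "v \<in> verts T" and anc: "proper_ancestor T u v" for u v
    proof -
      obtain xs where "u \<noteq> v" "path_betw T (rt T) xs v" "u \<in> set xs"
        using anc unfolding proper_ancestor_def by blast
      then have "below T u v" using root_path_eq below_iff_set[OF v] by blast
      then have "height v < height u" using \<open>u \<noteq> v\<close> by (rule height_below)
      then show ?thesis unfolding dist using height_nonneg[OF v] by linarith
    qed
    fix e f assume e: "e \<in> edges T" and f: "f \<in> edges T" and ef: "e \<noteq> f"
    have ex: "\<exists>u c. e = {u, c} \<and> child T u c" if e: "e \<in> edges T" for e
    proof -
      obtain x y where "e = {x, y}" using tree(1) e unfolding simple_graph_def by blast
      then show ?thesis using edge_child[of x y] e by (metis insert_commute)
    qed
    obtain u c where uc: "e = {u, c}" "child T u c" using ex[OF e] by blast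
    obtain u' c' where uc': "f = {u', c'}" "child T u' c'" using ex[OF f] by blast
    have "c \<noteq> c'" using ef uc uc' parent_unique by metis
    have seg: "convex hull (?p ` {x, y}) = closed_segment (?p x) (?p y)" for x y
      by (simp add: segment_convex_hull)
    show "convex hull (?p ` e) \<inter> convex hull (?p ` f) = ?p ` (e \<inter> f)"
    proof
      show "convex hull (?p ` e) \<inter> convex hull (?p ` f) \<subseteq> ?p ` (e \<inter> f)"
        unfolding uc(1) uc'(1) seg using edges_meet[OF s uc(2) uc'(2) \<open>c \<noteq> c'\<close>] by blast
      show "?p ` (e \<inter> f) \<subseteq> convex hull (?p ` e) \<inter> convex hull (?p ` f)"
        using hull_subset[of "?p ` e" convex] hull_subset[of "?p ` f" convex] by blast
    qed
  qed
qed

end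

section \<open>The order of the leaves in a plane drawing\<close>

text \<open>Rotation by a right angle; \<open>n\<close> and \<open>perp n\<close> serve as
  coordinate axes, across and along the leaf-lines.\<close>

definition perp :: "real \<times> real \<Rightarrow> real \<times> real" where
  "perp n = (- snd n, fst n)"

lemma perp_eq:
  assumes "n \<noteq> 0" "n \<bullet> z = n \<bullet> w" "perp n \<bullet> z = perp n \<bullet> w"
  shows "z = w"
proof -
  let ?u = "fst z - fst w" and ?v = "snd z - snd w"
  have 1: "fst n * ?u + snd n * ?v = 0" "- snd n * ?u + fst n * ?v = 0"
    using assms(2,3) unfolding perp_def inner_prod_def by (simp_all add: algebra_simps)
  have "(fst n * fst n + snd n * snd n) * ?u = fst n * (fst n * ?u + snd n * ?v) - snd n * (- snd n * ?u + fst n * ?v)"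
    "(fst n * fst n + snd n * snd n) * ?v = snd n * (fst n * ?u + snd n * ?v) + fst n * (- snd n * ?u + fst n * ?v)"
    by (simp_all add: algebra_simps)
  then have "(fst n * fst n + snd n * snd n) * ?u = 0" "(fst n * fst n + snd n * snd n) * ?v = 0"
    unfolding 1 by simp_all
  moreover have "fst n * fst n + snd n * snd n \<noteq> 0"
    using assms(1) by (simp add: sum_squares_eq_zero_iff prod_eq_iff)
  ultimately show ?thesis by (auto simp: prod_eq_iff)
qed

locale drawn_tree = binary_tree +
  fixes p :: "'a \<Rightarrow> real \<times> real" and n :: "real \<times> real" and c :: real
  assumes drawing: "plane_drawing T p n c"
begin

lemma n0: "n \<noteq> 0"
  using drawing unfolding plane_drawing_def by blast

lemma below_line: "v \<in> verts T \<Longrightarrow> n \<bullet> p v \<le> c" and leaf_line: "l \<in> leaves T \<Longrightarrow> n \<bullet> p l = c"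
proof -
  show l: "n \<bullet> p l = c" if "l \<in> leaves T" for l
    using drawing that unfolding plane_drawing_def by blast
  show "n \<bullet> p v \<le> c" if "v \<in> verts T" for v
  proof (cases "v \<in> leaves T")
    case False
    then have "n \<bullet> p v < c" using drawing that unfolding plane_drawing_def by blast
    then show ?thesis by simp
  qed (simp add: l)
qed

lemma root_highest:
  assumes "v \<in> verts T" "v \<noteq> rt T"
  shows "n \<bullet> p (rt T) < n \<bullet> p v"
proof -
  have "proper_ancestor T (rt T) v"
    unfolding proper_ancestor_def using assms root_path root_path_facts(1,6) hd_in_set by metis
  then have "infdist (p v) {x. n \<bullet> x = c} < infdist (p (rt T)) {x. n \<bullet> x = c}"
    using drawing rt_in assms(1) unfolding plane_drawing_def by blast
  then have "\<bar>n \<bullet> p v - c\<bar> < \<bar>n \<bullet> p (rt T) - c\<bar>"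
    unfolding infdist_hyperplane[OF n0] using n0 by (simp add: divide_less_cancel)
  then show ?thesis using below_line[OF assms(1)] below_line[OF rt_in] by linarith
qed

definition edge_seg :: "'a \<Rightarrow> 'a \<Rightarrow> (real \<times> real) set" where
  "edge_seg x y = closed_segment (p x) (p y)"

lemma edge_segs_disjoint:
  assumes "child T x y" "child T x' y'" "{x, y} \<inter> {x', y'} = {}"
  shows "edge_seg x y \<inter> edge_seg x' y' = {}"
proof -
  have e: "{x, y} \<in> edges T" "{x', y'} \<in> edges T" "{x, y} \<noteq> {x', y'}"
    using assms child_edge by auto
  have "\<forall>e\<in>edges T. \<forall>f\<in>edges T. e \<noteq> f \<longrightarrow>
      convex hull (p ` e) \<inter> convex hull (p ` f) = p ` (e \<inter> f)"
    using drawing unfolding plane_drawing_def by (elim conjE)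
  from this[rule_format, OF e] show ?thesis
    using assms(3) unfolding edge_seg_def segment_convex_hull by simp
qed

text \<open>The edges used are recorded so that disjointness of edges yields disjointness of paths.
  The point \<open>p u\<close> is listed separately for the case \<open>u = v\<close>, where no edge
  is used.\<close>

lemma descent_path:
  assumes "below T u v"
  shows "\<exists>g. path g \<and> pathstart g = p u \<and> pathfinish g = p v \<and>
    path_image g \<subseteq> insert (p u) (\<Union>{edge_seg x y | x y. child T x y \<and> below T u x \<and> below T y v})"
  using assms
proof (induction "length (root_path T v)" arbitrary: v rule: less_induct)
  case less
  show ?case
  proof (cases "u = v")
    case True
    then show ?thesis by (intro exI[of _ "linepath (p u) (p u)"]) auto
  next
    case False
    have V: "u \<in> verts T" "v \<in> verts T" using below_verts[OF less.prems] by auto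
    have "v \<noteq> rt T" using less.prems False below_rt[OF V(1)] below_antisym by blast
    then obtain w where w: "child T w v" using parent_exists[OF V(2)] by blast
    have uw: "below T u w" by (rule below_parent[OF w less.prems False])
    have "length (root_path T w) < length (root_path T v)" using w unfolding child_def by simp
    from less.hyps[OF this uw] obtain g where g: "path g" "pathstart g = p u" "pathfinish g = p w"
      "path_image g \<subseteq> insert (p u) (\<Union>{edge_seg x y | x y. child T x y \<and> below T u x \<and> below T y w})"
      by blast
    have wv: "below T w v" using child_below[OF w] by blast
    have "path_image (g +++ linepath (p w) (p v)) \<subseteq> path_image g \<union> edge_seg w v"
      using path_image_join_subset[of g "linepath (p w) (p v)"] unfolding edge_seg_def by simp
    also have "\<dots> \<subseteq> insert (p u) (\<Union>{edge_seg x y | x y. child T x y \<and> below T u x \<and> below T y v})"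
    proof (rule Un_least)
      have "{edge_seg x y | x y. child T x y \<and> below T u x \<and> below T y w} \<subseteq>
          {edge_seg x y | x y. child T x y \<and> below T u x \<and> below T y v}"
        using below_trans[OF _ wv] by blast
      from order_trans[OF g(4) insert_mono[OF Union_mono[OF this]]]
      show "path_image g \<subseteq> insert (p u) (\<Union>{edge_seg x y | x y. child T x y \<and> below T u x \<and> below T y v})" .
      have "edge_seg w v \<in> {edge_seg x y | x y. child T x y \<and> below T u x \<and> below T y v}"
        using w uw below_refl[OF V(2)] by blast
      from subset_insertI2[OF Union_upper[OF this]]
      show "edge_seg w v \<subseteq> insert (p u) (\<Union>{edge_seg x y | x y. child T x y \<and> below T u x \<and> below T y v})" .
    qed
    finally show ?thesis
      using g(1-3) by (intro exI[of _ "g +++ linepath (p w) (p v)"]) (auto intro: path_join_imp)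
  qed
qed

text \<open>The second coordinate is zero on the leaf-line and positive on the side of the tree, so
  the leaf-line becomes the bottom of the box in \<open>fashoda_interlace\<close>.\<close>

definition coords :: "real \<times> real \<Rightarrow> real ^ 2" where
  "coords z = (\<chi> i. if i = 1 then perp n \<bullet> z else c - n \<bullet> z)"

lemma coords_nth: "coords z $ 1 = perp n \<bullet> z" "coords z $ 2 = c - n \<bullet> z"
  unfolding coords_def by simp_all

lemma coords_inj: "coords z = coords w \<Longrightarrow> z = w"
proof (rule perp_eq[OF n0])
  assume e: "coords z = coords w"
  show "perp n \<bullet> z = perp n \<bullet> w" using coords_nth(1)[of z] coords_nth(1)[of w] e by simp
  show "n \<bullet> z = n \<bullet> w" using coords_nth(2)[of z] coords_nth(2)[of w] e by simp
qed

lemma coords_path: "path g \<Longrightarrow> path (coords \<circ> g)"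
proof (rule path_continuous_image)
  have "continuous_on UNIV coords"
    unfolding coords_def
  proof (rule continuous_on_vec_lambda)
    show "continuous_on UNIV (\<lambda>x. if i = 1 then perp n \<bullet> x else c - n \<bullet> x)" for i :: 2
      by (cases "i = 1") (auto intro!: continuous_intros)
  qed
  then show "continuous_on (path_image g) coords" by (rule continuous_on_subset) simp
qed

text \<open>If \<open>l\<close> were drawn between \<open>a\<close> and \<open>b\<close>, the path from \<open>l\<close> to the root, continued to the
  leaf-line far outside the drawing, would have to cross the path from \<open>a\<close> to \<open>b\<close>.\<close>

lemma not_between:
  assumes v: "v \<in> verts T" and a: "a \<in> cluster T v" and b: "b \<in> cluster T v"
    and l: "l \<in> leaves T" "l \<notin> cluster T v"
  shows "\<not> (perp n \<bullet> p a < perp n \<bullet> p l \<and> perp n \<bullet> p l < perp n \<bullet> p b)"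
proof
  assume order: "perp n \<bullet> p a < perp n \<bullet> p l \<and> perp n \<bullet> p l < perp n \<bullet> p b"
  have va: "below T v a" "a \<in> leaves T" and vb: "below T v b" "b \<in> leaves T"
    using a b unfolding cluster_def by auto
  have lV: "l \<in> verts T" using l(1) leaves_verts by blast
  have vrt: "v \<noteq> rt T" using l cluster_rt by blast
  have notl: "\<not> below T v y" if "below T y l" for y
    using l that below_trans unfolding cluster_def by blast
  \<comment> \<open>At least one of the two leaves differs from \<open>v\<close>, so
    \<open>v\<close> has a child and \<open>p v\<close> lies on an edge of
    \<open>SF\<close>.\<close>
  have "a \<noteq> b" using order by auto
  then have "v \<noteq> a \<or> v \<noteq> b" by blast
  then obtain cv where cv: "child T v cv" using below_child va(1) vb(1) by metis
  obtain cr where cr: "child T (rt T) cr" "below T cr l"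
    using below_child[OF below_rt[OF lV]] l(1) rt_not_leaf by metis
  define SF where "SF = \<Union>{edge_seg x y | x y. child T x y \<and> below T v x}"
  define SG where "SG = \<Union>{edge_seg x y | x y. child T x y \<and> below T y l}"
  have pv: "p v \<in> SF" "p (rt T) \<in> SG"
    unfolding SF_def SG_def using cv cr below_refl[OF v] unfolding edge_seg_def by blast+
  have in_SF: "insert (p v) (\<Union>{edge_seg x y | x y. child T x y \<and> below T v x \<and> below T y w}) \<subseteq> SF" for w
  proof -
    have "{edge_seg x y | x y. child T x y \<and> below T v x \<and> below T y w} \<subseteq>
        {edge_seg x y | x y. child T x y \<and> below T v x}" by blast
    from Union_mono[OF this] show ?thesis using pv(1) unfolding SF_def by simp
  qed
  have in_SG: "insert (p (rt T)) (\<Union>{edge_seg x y | x y. child T x y \<and> below T (rt T) x \<and> below T y l}) \<subseteq> SG"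
  proof -
    have "{edge_seg x y | x y. child T x y \<and> below T (rt T) x \<and> below T y l} \<subseteq>
        {edge_seg x y | x y. child T x y \<and> below T y l}" by blast
    from Union_mono[OF this] show ?thesis using pv(2) unfolding SG_def by simp
  qed
  have exF: "\<exists>g. path g \<and> pathstart g = p v \<and> pathfinish g = p w \<and> path_image g \<subseteq> SF"
    if "below T v w" for w
    using descent_path[OF that]
    by (elim exE conjE) (intro exI conjI, assumption+, erule order_trans, rule in_SF)
  have exG: "\<exists>g. path g \<and> pathstart g = p (rt T) \<and> pathfinish g = p l \<and> path_image g \<subseteq> SG"
    using descent_path[OF below_rt[OF lV]]
    by (elim exE conjE) (intro exI conjI, assumption+, erule order_trans, rule in_SG)
  obtain ga where ga: "path ga" "pathstart ga = p v" "pathfinish ga = p a" "path_image ga \<subseteq> SF"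
    using exF[OF va(1)] by (elim exE conjE)
  obtain gb where gb: "path gb" "pathstart gb = p v" "pathfinish gb = p b" "path_image gb \<subseteq> SF"
    using exF[OF vb(1)] by (elim exE conjE)
  obtain gl where gl: "path gl" "pathstart gl = p (rt T)" "pathfinish gl = p l" "path_image gl \<subseteq> SG"
    using exG by (elim exE conjE)
  \<comment> \<open>All vertices of edges in \<open>SF\<close> are below \<open>v\<close>. A vertex
    on the root path of \<open>l\<close> is not, since \<open>l\<close> is not below
    \<open>v\<close>.\<close>
  have disj: "SF \<inter> SG = {}"
  proof -
    have "edge_seg x y \<inter> edge_seg x' y' = {}"
      if xy: "child T x y" "below T v x" and xy': "child T x' y'" "below T y' l" for x y x' y'
    proof (rule edge_segs_disjoint[OF xy(1) xy'(1)])
      have "below T v y" using below_trans[OF xy(2)] child_below[OF xy(1)] by blast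
      moreover have "\<not> below T v y'" by (rule notl[OF xy'(2)])
      moreover have "\<not> below T v x'" using notl below_trans xy'(2) child_below[OF xy'(1)] by blast
      ultimately show "{x, y} \<inter> {x', y'} = {}" using xy(2) by auto
    qed
    then show ?thesis unfolding SF_def SG_def by blast
  qed
  \<comment> \<open>Strictly beyond the lateral position of every vertex, so that the vertical side
    of the box at \<open>W\<close> stays clear of the drawing.\<close>
  define W where "W = 1 + Max ((\<lambda>w. \<bar>perp n \<bullet> p w\<bar>) ` verts T)"
  have W: "\<bar>perp n \<bullet> p w\<bar> < W" if "w \<in> verts T" for w
  proof -
    have "\<bar>perp n \<bullet> p w\<bar> \<le> Max ((\<lambda>w. \<bar>perp n \<bullet> p w\<bar>) ` verts T)"
      using fin that by (intro Max_ge) auto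
    then show ?thesis unfolding W_def by simp
  qed
  let ?h = "c - n \<bullet> p (rt T)"
  have h0: "0 \<le> ?h" using below_line[OF rt_in] by simp
  let ?box = "{z. perp n \<bullet> z < W} \<inter> {z. perp n \<bullet> z > - W} \<inter> {z. n \<bullet> z \<le> c} \<inter> {z. n \<bullet> z \<ge> n \<bullet> p (rt T)}"
  have cbox: "convex ?box"
    by (intro convex_Int convex_halfspace_lt convex_halfspace_gt convex_halfspace_le convex_halfspace_ge)
  have inbox: "p w \<in> ?box" if "w \<in> verts T" for w
    using W[OF that] below_line[OF that] root_highest[OF that] by (cases "w = rt T") auto
  have segbox: "edge_seg x y \<subseteq> ?box" if "child T x y" for x y
    unfolding edge_seg_def using closed_segment_subset[OF inbox inbox cbox] child_verts[OF that] by blast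
  have SFbox: "SF \<subseteq> ?box" and SGbox: "SG \<subseteq> ?box" unfolding SF_def SG_def using segbox by blast+
  \<comment> \<open>Vertices below \<open>v\<close> are strictly nearer to the leaf-line than the
    root, so the top side of the box is not met by \<open>SF\<close>.\<close>
  have SFlow: "SF \<subseteq> {z. n \<bullet> z > n \<bullet> p (rt T)}"
  proof -
    have "edge_seg x y \<subseteq> {z. n \<bullet> z > n \<bullet> p (rt T)}" if xy: "child T x y" "below T v x" for x y
    proof -
      have below_v: "w \<noteq> rt T" if "below T v w" for w
        using that vrt below_rt[OF v] below_antisym by blast
      have "below T v y" using below_trans[OF xy(2)] child_below[OF xy(1)] by blast
      then have "n \<bullet> p y > n \<bullet> p (rt T)" "n \<bullet> p x > n \<bullet> p (rt T)"
        using root_highest below_v child_verts[OF xy(1)] xy(2) by blast+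
      then show ?thesis
        unfolding edge_seg_def by (intro closed_segment_subset convex_halfspace_gt) auto
    qed
    then show ?thesis unfolding SF_def by blast
  qed
  let ?q1 = "vector [W, ?h] :: real ^ 2" and ?q2 = "vector [W, 0] :: real ^ 2"
  define f where "f = coords \<circ> (reversepath ga +++ gb)"
  \<comment> \<open>From \<open>l\<close> to the root, along the top of the box to the corner
    \<open>?q1\<close>, and down its side to \<open>?q2\<close> on the leaf-line. The four ends then
    interlace as \<open>a, l, b, ?q2\<close>, and the two paths must meet.\<close>
  define g where "g = (coords \<circ> reversepath gl) +++ linepath (coords (p (rt T))) ?q1 +++ linepath ?q1 ?q2"
  have imf: "path_image f \<subseteq> coords ` SF"
  proof -
    have "path_image (reversepath ga +++ gb) \<subseteq> SF"
      using path_image_join_subset[of "reversepath ga" gb] ga(4) gb(4) by auto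
    then show ?thesis unfolding f_def path_image_compose by blast
  qed
  have img: "path_image g \<subseteq> coords ` SG \<union> closed_segment (coords (p (rt T))) ?q1 \<union> closed_segment ?q1 ?q2"
  proof -
    have "path_image (coords \<circ> reversepath gl) \<subseteq> coords ` SG"
      unfolding path_image_compose using gl(4) by auto
    moreover have "path_image g \<subseteq> path_image (coords \<circ> reversepath gl) \<union>
        (path_image (linepath (coords (p (rt T))) ?q1) \<union> path_image (linepath ?q1 ?q2))"
      unfolding g_def using path_image_join_subset by blast
    ultimately show ?thesis unfolding path_image_linepath by (simp add: subset_iff) blast
  qed
  let ?A = "vector [- W, 0] :: real ^ 2" and ?B = "vector [W, ?h] :: real ^ 2"
  have box: "coords z \<in> cbox ?A ?B" if "z \<in> ?box" for z
    using that by (auto simp: mem_box_cart forall_2 coords_nth vector_2)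
  have W0: "0 \<le> W" using W[OF rt_in] by simp
  have q: "?q1 \<in> cbox ?A ?B" "?q2 \<in> cbox ?A ?B"
    using W0 h0 by (auto simp: mem_box_cart forall_2 vector_2)
  have rtbox: "coords (p (rt T)) \<in> cbox ?A ?B" by (rule box[OF inbox[OF rt_in]])
  obtain z where z: "z \<in> path_image f" "z \<in> path_image g"
  proof (rule fashoda_interlace[of f g ?A ?B])
    show "path f" unfolding f_def using ga gb by (intro coords_path path_join_imp) auto
    have "path (coords \<circ> reversepath gl)" using gl(1) by (intro coords_path) simp
    then show "path g" unfolding g_def using gl(2)
      by (intro path_join_imp) (auto simp: pathfinish_compose)
    show "path_image f \<subseteq> cbox ?A ?B" using imf SFbox box by blast
    have "closed_segment (coords (p (rt T))) ?q1 \<subseteq> cbox ?A ?B" "closed_segment ?q1 ?q2 \<subseteq> cbox ?A ?B"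
      by (rule closed_segment_subset[OF rtbox q(1) convex_box(1)], rule closed_segment_subset[OF q convex_box(1)])
    then show "path_image g \<subseteq> cbox ?A ?B" using img SGbox box by blast
    show "pathstart f $ 2 = ?A $ 2" "pathfinish f $ 2 = ?A $ 2"
      unfolding f_def using ga gb leaf_line[OF va(2)] leaf_line[OF vb(2)]
      by (simp_all add: pathstart_compose pathfinish_compose coords_nth vector_2)
    show "pathstart g $ 2 = ?A $ 2" "pathfinish g $ 2 = ?A $ 2"
      unfolding g_def using gl leaf_line[OF l(1)]
      by (simp_all add: pathstart_compose coords_nth vector_2)
    show "pathstart f $ 1 < pathstart g $ 1" "pathstart g $ 1 < pathfinish f $ 1"
      unfolding f_def g_def using ga gb gl order
      by (simp_all add: pathstart_compose pathfinish_compose coords_nth)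
    show "pathfinish f $ 1 < pathfinish g $ 1"
      unfolding f_def g_def using gb W[OF leaves_verts[OF vb(2)]]
      by (simp add: pathfinish_compose coords_nth vector_2)
  qed blast
  obtain x where x: "x \<in> SF" "z = coords x" using imf z(1) by blast
  from img z(2) consider "z \<in> coords ` SG" | "z \<in> closed_segment (coords (p (rt T))) ?q1" | "z \<in> closed_segment ?q1 ?q2"
    by blast
  then show False
  proof cases
    case 1
    then obtain y where "y \<in> SG" "coords x = coords y" using x(2) by auto
    then have "x \<in> SG" using coords_inj by blast
    then show ?thesis using disj x(1) by blast
  next
    case 2
    then obtain t where t: "z = (1 - t) *\<^sub>R coords (p (rt T)) + t *\<^sub>R ?q1"
      unfolding in_segment by blast
    have "z $ 2 = ?h" unfolding t by (simp add: coords_nth vector_2 algebra_simps)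
    then have "n \<bullet> x = n \<bullet> p (rt T)" using x(2) by (simp add: coords_nth)
    then show ?thesis using SFlow x(1) by auto
  next
    case 3
    then obtain t where t: "z = (1 - t) *\<^sub>R ?q1 + t *\<^sub>R ?q2"
      unfolding in_segment by blast
    have "z $ 1 = W" unfolding t by (simp add: vector_2 algebra_simps)
    then have "perp n \<bullet> x = W" using x(2) by (simp add: coords_nth)
    then show ?thesis using SFbox x(1) by auto
  qed
qed

end

section \<open>Crossing numbers\<close>

definition list_index :: "'a list \<Rightarrow> 'a \<Rightarrow> nat" where
  "list_index xs x = inv_into {..<length xs} ((!) xs) x"

lemma list_index:
  assumes "x \<in> set xs"
  shows "list_index xs x < length xs" "xs ! list_index xs x = x"
proof -
  have "x \<in> (!) xs ` {..<length xs}" using assms by (auto simp: in_set_conv_nth)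
  from inv_into_into[OF this] f_inv_into_f[OF this]
  show "list_index xs x < length xs" "xs ! list_index xs x = x" unfolding list_index_def by auto
qed

lemma subseq_nth3:
  assumes "i < j" "j < k" "k < length xs"
  shows "subseq [xs ! i, xs ! j, xs ! k] xs"
proof -
  have s: "xs = take j xs @ [xs ! j] @ drop (Suc j) xs"
    using assms id_take_nth_drop[of j xs] by simp
  have "xs ! i \<in> set (take j xs)"
    using assms by (auto simp: in_set_conv_nth intro!: exI[of _ i])
  moreover have "xs ! k \<in> set (drop (Suc j) xs)"
    using assms by (auto simp: in_set_conv_nth intro!: exI[of _ "k - Suc j"])
  ultimately have "subseq ([xs ! i] @ [xs ! j] @ [xs ! k]) (take j xs @ [xs ! j] @ drop (Suc j) xs)"
    by (intro list_emb_append_mono) (auto simp: subseq_singleton_left)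
  then show ?thesis using s by simp
qed

lemma subseq_nth2:
  assumes "i < j" "j < length xs"
  shows "subseq [xs ! i, xs ! j] xs"
proof -
  have s: "xs = take j xs @ [xs ! j] @ drop (Suc j) xs"
    using assms id_take_nth_drop[of j xs] by simp
  have "xs ! i \<in> set (take j xs)"
    using assms by (auto simp: in_set_conv_nth intro!: exI[of _ i])
  then have "subseq ([xs ! i] @ [xs ! j] @ []) (take j xs @ [xs ! j] @ drop (Suc j) xs)"
    by (intro list_emb_append_mono) (auto simp: subseq_singleton_left)
  then show ?thesis using s by simp
qed

lemma index_less_of_subseq:
  assumes "subseq [x, y] xs" "distinct xs"
  shows "list_index xs x < list_index xs y"
proof (rule ccontr)
  assume no: "\<not> list_index xs x < list_index xs y"
  have mem: "x \<in> set xs" "y \<in> set xs" using list_emb_set[OF assms(1)] by auto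
  have "x \<noteq> y" using subseq_distinct[OF assms] by simp
  then have "list_index xs y < list_index xs x"
    using no list_index(2)[OF mem(1)] list_index(2)[OF mem(2)] by (metis linorder_neqE_nat)
  then have "subseq [y, x] xs"
    using subseq_nth2[of "list_index xs y" "list_index xs x" xs] list_index[OF mem(1)] list_index[OF mem(2)] by simp
  then obtain us vs where "xs = us @ vs" "subseq [y] us" "subseq [x] vs"
    using list_emb_appendD[of "(=)" "[y]" "[x]" xs] by auto
  then have uv: "y \<in> set us" "x \<in> set vs" by (auto simp: subseq_singleton_left)
  obtain us' vs' where "xs = us' @ vs'" "subseq [x] us'" "subseq [y] vs'"
    using list_emb_appendD[of "(=)" "[x]" "[y]" xs] assms(1) by auto
  then have uv': "x \<in> set us'" "y \<in> set vs'" by (auto simp: subseq_singleton_left)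
  have "us @ vs = us' @ vs'" using \<open>xs = us @ vs\<close> \<open>xs = us' @ vs'\<close> by simp
  then obtain ws where "us = us' @ ws \<and> ws @ vs = vs' \<or> us @ ws = us' \<and> vs = ws @ vs'"
    unfolding append_eq_append_conv2 by blast
  then show False
  proof
    assume w: "us = us' @ ws \<and> ws @ vs = vs'"
    then have "x \<in> set us" using uv'(1) by auto
    then show False using uv(2) \<open>xs = us @ vs\<close> assms(2) by auto
  next
    assume w: "us @ ws = us' \<and> vs = ws @ vs'"
    then have "y \<in> set us'" using uv(1) by auto
    then show False using uv'(2) \<open>xs = us' @ vs'\<close> assms(2) by auto
  qed
qed

text \<open>Used to see that the left and the right order of the matching edges disagree on a single
  pair.\<close>

lemma subseq_swap:
  assumes "subseq [x, y] (us @ b # c # vs)"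
  shows "x = b \<and> y = c \<or> subseq [x, y] (us @ c # b # vs)"
proof -
  obtain t1 t2 where t: "[x, y] = t1 @ t2" "subseq t1 us" "subseq t2 (b # c # vs)"
    using assms by (rule subseq_appendE)
  have "x = b \<and> y = c \<or> subseq t2 (c # b # vs)"
  proof (cases t2)
    case Nil
    then show ?thesis by simp
  next
    case (Cons t ts)
    show ?thesis
    proof (cases ts)
      case Nil
      then have "t \<in> set (b # c # vs)" using t(3) Cons by (simp only: subseq_singleton_left)
      then show ?thesis using Cons Nil by (auto simp: subseq_singleton_left)
    next
      case (Cons t' ts')
      then have "t = x" "t' = y" "ts' = []" using t(1) \<open>t2 = t # ts\<close> by (auto simp: Cons_eq_append_conv)
      then have t2: "t2 = [x, y]" using \<open>t2 = t # ts\<close> Cons by simp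
      have "subseq [x, y] (b # c # vs)" using t(3) unfolding t2 .
      then show ?thesis unfolding t2
        by (auto simp: subseq_singleton_left split: if_splits intro: list_emb_Cons dest: subseq_Cons')
    qed
  qed
  then show ?thesis using t(1,2) list_emb_append_mono by metis
qed

text \<open>\<open>None\<close> lies outside every cluster. A leaf \<open>x\<close> outside a
  cluster but between two of its leaves \<open>a\<close> and \<open>b\<close> would give the
  alternation \<open>None, a, x, b\<close>.\<close>

lemma (in binary_tree) ordered_tree_of_circ:
  assumes inj: "inj_on f M" and img: "f ` M = leaves T"
    and c: "circ (tree_splits T M f) (None # map Some es)" and es: "distinct es" "set es = M"
  shows "ordered_tree T (\<lambda>l. real (list_index es (inv_into M f l)))"
proof
  have inv: "inv_into M f l \<in> M" "f (inv_into M f l) = l" if "l \<in> leaves T" for l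
    using that unfolding img[symmetric] by (auto intro: inv_into_into f_inv_into_f)
  show "inj_on (\<lambda>l. real (list_index es (inv_into M f l))) (leaves T)"
  proof (rule inj_onI)
    fix l l' assume l: "l \<in> leaves T" "l' \<in> leaves T"
      "real (list_index es (inv_into M f l)) = real (list_index es (inv_into M f l'))"
    then have "inv_into M f l = inv_into M f l'"
      using list_index(2)[of _ es] inv es(2) by (metis of_nat_eq_iff)
    then show "l = l'" using inv l by metis
  qed
  fix v a b x
  assume v: "v \<in> verts T" and ab: "a \<in> cluster T v" "b \<in> cluster T v" and x: "x \<in> leaves T"
    and less: "real (list_index es (inv_into M f a)) < real (list_index es (inv_into M f x))"
      "real (list_index es (inv_into M f x)) < real (list_index es (inv_into M f b))"
  show "x \<in> cluster T v"
  proof (cases "v = rt T")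
    case True
    then show ?thesis using x cluster_rt by simp
  next
    case False
    have abl: "a \<in> leaves T" "b \<in> leaves T" using ab unfolding cluster_def by auto
    let ?a = "inv_into M f a" and ?b = "inv_into M f b" and ?x = "inv_into M f x"
    have "subseq [?a, ?x, ?b] es"
      using subseq_nth3[of "list_index es ?a" "list_index es ?x" "list_index es ?b" es] less
        list_index[of _ es] inv abl x es(2) by simp
    then have "subseq (map Some [?a, ?x, ?b]) (map Some es)" by (rule subseq_map)
    then have sub: "subseq [None, Some ?a, Some ?x, Some ?b] (None # map Some es)" by simp
    have "\<forall>G\<in>tree_splits T M f. - G \<in> tree_splits T M f"
      using split_system_closed[OF split_system_tree[OF inj]] img by simp
    from circ_noalt(2)[OF c this tree_splitsI(1)[OF v False] sub]
    have "f ?x \<in> cluster T v" using inv abl x ab by (simp add: mem_edge_side)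
    then show ?thesis using inv(2)[OF x] by simp
  qed
qed

section \<open>A layout with one crossing, and the lower bound\<close>

context tangle
begin

lemma layout_of_circ:
  assumes cl: "circ lsplits (None # map Some (us @ [a, b, c, d] @ vs))"
    and cr: "circ rsplits (None # map Some (us @ [a, c, b, d] @ vs))"
    and es: "distinct (us @ [a, b, c, d] @ vs)" "set (us @ [a, b, c, d] @ vs) = matching T"
  obtains p q where "is_layout T p q" "layout_crossings T p q \<le> 1"
proof -
  let ?l = "us @ [a, b, c, d] @ vs" and ?r = "us @ [a, c, b, d] @ vs"
  have r: "distinct ?r" "set ?r = matching T" using es by auto
  have injs: "inj_on fst (matching T)" "inj_on snd (matching T)"
    using fst_inj snd_inj unfolding inj_on_def by blast+
  have imgs: "fst ` matching T = leaves (ltree T)" "snd ` matching T = leaves (rtree T)"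
    using matching_leaves fst_onto snd_onto by blast+
  define posL where "posL x = real (list_index ?l (inv_into (matching T) fst x))" for x
  define posR where "posR x = real (list_index ?r (inv_into (matching T) snd x))" for x
  interpret OL: ordered_tree "ltree T" posL
    unfolding posL_def by (rule L.ordered_tree_of_circ[OF injs(1) imgs(1) cl es])
  interpret OR: ordered_tree "rtree T" posR
    unfolding posR_def by (rule R.ordered_tree_of_circ[OF injs(2) imgs(2) cr r])
  \<comment> \<open>The leaf-lines have ordinates 0 and 1. The left tree hangs below the first one
    and the right tree stands above the second.\<close>
  define p where "p = OL.place (- 1) 0"
  define q where "q = OR.place 1 1"
  have "plane_drawing (ltree T) p (0, 1) 0"
    using OL.plane_drawing_place[of "- 1" 0] unfolding p_def by simp
  moreover have "plane_drawing (rtree T) q (- (0, 1)) (- 1)"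
    using OR.plane_drawing_place[of 1 1] unfolding q_def by simp
  ultimately have lay: "is_layout T p q"
    unfolding is_layout_def by (intro exI[of _ "(0, 1)"] exI[of _ 0] exI[of _ 1]) simp
  have pe: "p (fst e) = (real (list_index ?l e), 0)" "q (snd e) = (real (list_index ?r e), 1)"
    if "e \<in> matching T" for e
    unfolding p_def q_def using OL.place_leaf OR.place_leaf matching_leaves[OF that]
      inv_into_f_f[OF injs(1) that] inv_into_f_f[OF injs(2) that] by (simp_all add: posL_def posR_def)
  have seg: "matching_segment p q e \<inter> matching_segment p q f = {}"
    if ef: "e \<in> matching T" "f \<in> matching T" and less: "list_index ?l e < list_index ?l f" "list_index ?r e < list_index ?r f" for e f
  proof (rule ccontr)
    assume "matching_segment p q e \<inter> matching_segment p q f \<noteq> {}"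
    then obtain z where z: "z \<in> matching_segment p q e" "z \<in> matching_segment p q f" by blast
    obtain s where s: "0 \<le> s" "s \<le> 1" "z = (1 - s) *\<^sub>R p (fst e) + s *\<^sub>R q (snd e)"
      using z(1) unfolding matching_segment_def in_segment by blast
    obtain t where t: "0 \<le> t" "t \<le> 1" "z = (1 - t) *\<^sub>R p (fst f) + t *\<^sub>R q (snd f)"
      using z(2) unfolding matching_segment_def in_segment by blast
    \<comment> \<open>Since the leaf-lines have ordinates 0 and 1, the parameter on either segment
      is the ordinate of the common point; edges in the same order on both lines stay apart at every
      ordinate.\<close>
    have "s = snd z" "t = snd z" using s(3) t(3) ef by (simp_all add: pe)
    then have st: "s = t" by simp
    let ?e1 = "real (list_index ?l e)" and ?e2 = "real (list_index ?r e)"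
      and ?f1 = "real (list_index ?l f)" and ?f2 = "real (list_index ?r f)"
    have "fst z = (1 - t) * ?e1 + t * ?e2" "fst z = (1 - t) * ?f1 + t * ?f2"
      using s(3) t(3) ef st by (simp_all add: pe)
    then have "(1 - t) * (?f1 - ?e1) + t * (?f2 - ?e2) = 0" by (simp add: algebra_simps)
    moreover have "0 \<le> (1 - t) * (?f1 - ?e1)" "0 \<le> t * (?f2 - ?e2)"
      using t(1,2) less by simp_all
    ultimately have "(1 - t) * (?f1 - ?e1) = 0" "t * (?f2 - ?e2) = 0" by linarith+
    moreover have "?f1 - ?e1 \<noteq> 0" "?f2 - ?e2 \<noteq> 0" using less by auto
    ultimately show False by auto
  qed
  have one: "{e, f} = {b, c}"
    if ef: "e \<in> matching T" "f \<in> matching T" "e \<noteq> f" and x: "matching_segment p q e \<inter> matching_segment p q f \<noteq> {}" for e f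
  proof -
    have main: "{e, f} = {b, c}"
      if ef: "e \<in> matching T" "f \<in> matching T" and less: "list_index ?l e < list_index ?l f"
        and x: "matching_segment p q e \<inter> matching_segment p q f \<noteq> {}" for e f
    proof -
      have mem: "e \<in> set ?l" "f \<in> set ?l" using ef es(2) by auto
      have "subseq [?l ! list_index ?l e, ?l ! list_index ?l f] ?l"
        by (rule subseq_nth2[OF less list_index(1)[OF mem(2)]])
      then have "subseq [e, f] ((us @ [a]) @ b # c # d # vs)"
        unfolding list_index(2)[OF mem(1)] list_index(2)[OF mem(2)] by simp
      then have "e = b \<and> f = c \<or> subseq [e, f] ((us @ [a]) @ c # b # d # vs)" by (rule subseq_swap)
      then show ?thesis
      proof
        assume "subseq [e, f] ((us @ [a]) @ c # b # d # vs)"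
        then have "subseq [e, f] ?r" by simp
        then have "list_index ?r e < list_index ?r f" using r(1) by (rule index_less_of_subseq)
        then show ?thesis using seg[OF ef less] x by blast
      qed simp
    qed
    have mem: "e \<in> set ?l" "f \<in> set ?l" using ef es(2) by auto
    have "list_index ?l e \<noteq> list_index ?l f"
      using list_index(2)[OF mem(1)] list_index(2)[OF mem(2)] ef(3) by metis
    then consider "list_index ?l e < list_index ?l f" | "list_index ?l f < list_index ?l e" by linarith
    then show ?thesis
    proof cases
      case 1
      then show ?thesis using main[OF ef(1,2) 1 x] by simp
    next
      case 2
      have "matching_segment p q f \<inter> matching_segment p q e \<noteq> {}" using x by blast
      from main[OF ef(2,1) 2 this] show ?thesis by (simp add: insert_commute)
    qed
  qed
  have "{{e, f} | e f. e \<in> matching T \<and> f \<in> matching T \<and> e \<noteq> f \<and>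
      matching_segment p q e \<inter> matching_segment p q f \<noteq> {}} \<subseteq> {{b, c}}"
    using one by blast
  from card_mono[OF _ this] have "layout_crossings T p q \<le> 1"
    unfolding layout_crossings_def by simp
  with lay show thesis by (rule that)
qed

text \<open>Without crossings the lateral orders \<open>P\<close> and \<open>Q\<close> of the
  matching edges agree, so the betweenness restrictions of the left and of the right tree apply to
  one order of four numbers, which cannot exist.\<close>

lemma layout_has_crossing:
  assumes lay: "is_layout T p q" and m: "{e1, e2, e3, e4} \<subseteq> matching T"
    and ob: "obs lsplits rsplits {None} (Some e1) (Some e2) (Some e3) (Some e4)"
  shows "1 \<le> layout_crossings T p q"
proof (rule ccontr)
  assume "\<not> 1 \<le> layout_crossings T p q"
  then have card0: "card {{e, f} | e f. e \<in> matching T \<and> f \<in> matching T \<and> e \<noteq> f \<and>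
      matching_segment p q e \<inter> matching_segment p q f \<noteq> {}} = 0" (is "card ?X = 0")
    unfolding layout_crossings_def by simp
  have "?X \<subseteq> Pow (matching T)" by blast
  moreover have "finite (Pow (matching T))" using fin_matching by simp
  ultimately have "finite ?X" by (rule finite_subset)
  then have "?X = {}" using card0 by simp
  then have nocross: "matching_segment p q e \<inter> matching_segment p q f = {}"
    if "e \<in> matching T" "f \<in> matching T" "e \<noteq> f" for e f using that by blast
  obtain n c d where cd: "c < d" and pl: "plane_drawing (ltree T) p n c"
    and pr: "plane_drawing (rtree T) q (- n) (- d)"
    using lay unfolding is_layout_def by blast
  interpret DL: drawn_tree "ltree T" p n c by unfold_locales (rule pl)
  interpret DR: drawn_tree "rtree T" q "- n" "- d" by unfold_locales (rule pr)
  define P where "P e = perp n \<bullet> p (fst e)" for e :: "'a \<times> 'b"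
  define Q where "Q e = perp n \<bullet> q (snd e)" for e :: "'a \<times> 'b"
  have perp_neg: "perp (- n) \<bullet> z = - (perp n \<bullet> z)" for z unfolding perp_def inner_prod_def by simp
  have lineL: "n \<bullet> p (fst e) = c" and lineR: "n \<bullet> q (snd e) = d" if "e \<in> matching T" for e
    using DL.leaf_line DR.leaf_line matching_leaves[OF that] by auto
  have order: "P e < P f \<Longrightarrow> Q e < Q f" if ef: "e \<in> matching T" "f \<in> matching T" for e f
  proof (rule ccontr)
    assume less: "P e < P f" and "\<not> Q e < Q f"
    then have le: "Q f \<le> Q e" by simp
    \<comment> \<open>The parameter at which the linear interpolations from \<open>P\<close> to
      \<open>Q\<close> for \<open>e\<close> and \<open>f\<close> coincide; the two segments meet
      there.\<close>
    define t where "t = (P f - P e) / ((P f - P e) + (Q e - Q f))"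
    have den: "(P f - P e) + (Q e - Q f) > 0" using less le by linarith
    have t: "0 \<le> t" "t \<le> 1" unfolding t_def using less le den by (simp_all add: divide_le_eq_1)
    have eq: "(1 - t) * P e + t * Q e = (1 - t) * P f + t * Q f"
    proof -
      have "t * ((P f - P e) + (Q e - Q f)) = P f - P e" unfolding t_def using den by simp
      then show ?thesis by (simp add: algebra_simps)
    qed
    let ?z = "(1 - t) *\<^sub>R p (fst e) + t *\<^sub>R q (snd e)" and ?w = "(1 - t) *\<^sub>R p (fst f) + t *\<^sub>R q (snd f)"
    have "?z = ?w"
    proof (rule perp_eq[OF DL.n0])
      show "n \<bullet> ?z = n \<bullet> ?w" using lineL ef lineR by (simp add: inner_add_right)
      show "perp n \<bullet> ?z = perp n \<bullet> ?w" using eq unfolding P_def Q_def by (simp add: inner_add_right)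
    qed
    moreover have "?z \<in> matching_segment p q e" "?w \<in> matching_segment p q f"
      unfolding matching_segment_def in_segment using t by blast+
    moreover have "e \<noteq> f" using less by auto
    ultimately show False using nocross[OF ef] by auto
  qed
  have distinct_P: "P e \<noteq> P f" if "e \<in> matching T" "f \<in> matching T" "e \<noteq> f" for e f
  proof
    assume "P e = P f"
    then have "p (fst e) = p (fst f)"
      using perp_eq[OF DL.n0] lineL[OF that(1)] lineL[OF that(2)] unfolding P_def by simp
    moreover have "inj_on p (verts (ltree T))" using pl unfolding plane_drawing_def by blast
    ultimately have "fst e = fst f"
      using inj_onD matching_leaves that(1,2) L.leaves_verts by metis
    then show False using fst_inj that by blast
  qed
  have btwL: "\<not> (P e < P g \<and> P g < P f)"
    if s: "sep lsplits {Some e, Some f} (insert (Some g) (insert x {None}))" and g: "g \<in> matching T" for e f g x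
  proof -
    obtain v where v: "v \<in> verts (ltree T)" "v \<noteq> rt (ltree T)"
      "\<And>e'. Some e' \<in> {Some e, Some f} \<Longrightarrow> fst e' \<in> cluster (ltree T) v"
      "\<And>e'. e' \<in> matching T \<Longrightarrow> Some e' \<in> insert (Some g) (insert x {None}) \<Longrightarrow> fst e' \<notin> cluster (ltree T) v"
      by (rule L.sep_cluster[OF s]) (blast, rule that, assumption+)
    show ?thesis
      unfolding P_def
      by (rule DL.not_between[OF v(1) v(3) v(3)]) (use v(4)[OF g] matching_leaves[OF g] in auto)
  qed
  have btwR: "\<not> (Q e < Q g \<and> Q g < Q f)"
    if s: "sep rsplits {Some e, Some f} (insert (Some g) (insert x {None}))" and g: "g \<in> matching T" for e f g x
  proof -
    obtain v where v: "v \<in> verts (rtree T)" "v \<noteq> rt (rtree T)"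
      "\<And>e'. Some e' \<in> {Some e, Some f} \<Longrightarrow> snd e' \<in> cluster (rtree T) v"
      "\<And>e'. e' \<in> matching T \<Longrightarrow> Some e' \<in> insert (Some g) (insert x {None}) \<Longrightarrow> snd e' \<notin> cluster (rtree T) v"
      by (rule R.sep_cluster[OF s]) (blast, rule that, assumption+)
    \<comment> \<open>The right tree is drawn with normal \<open>- n\<close>, which reverses the
      lateral direction; hence \<open>e\<close> and \<open>f\<close> change places.\<close>
    have "\<not> (perp (- n) \<bullet> q (snd f) < perp (- n) \<bullet> q (snd g) \<and> perp (- n) \<bullet> q (snd g) < perp (- n) \<bullet> q (snd e))"
      by (rule DR.not_between[OF v(1) v(3) v(3)]) (use v(4)[OF g] matching_leaves[OF g] in auto)
    then show ?thesis unfolding Q_def perp_neg by auto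
  qed
  have s: "sep lsplits {Some e1, Some e2} ({Some e3, Some e4} \<union> {None})"
    "sep lsplits {Some e3, Some e4} ({Some e1, Some e2} \<union> {None})"
    "sep rsplits {Some e1, Some e3} ({Some e2, Some e4} \<union> {None})"
    "sep rsplits {Some e2, Some e4} ({Some e1, Some e3} \<union> {None})"
    using ob unfolding obs_def by auto
  have mm: "e1 \<in> matching T" "e2 \<in> matching T" "e3 \<in> matching T" "e4 \<in> matching T" using m by auto
  have dist: "distinct [e1, e2, e3, e4]" using obs_distinct[OF ob] by auto
  have ne: "P e1 \<noteq> P e2" "P e1 \<noteq> P e3" "P e1 \<noteq> P e4" "P e2 \<noteq> P e3"
    using distinct_P mm dist by auto
  have L: "\<not> (P e < P g \<and> P g < P f)" "\<not> (P f < P g \<and> P g < P e)"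
    if "sep lsplits {Some e, Some f} ({Some g, Some h} \<union> {None}) \<or> sep lsplits {Some e, Some f} ({Some h, Some g} \<union> {None})"
      "g \<in> matching T" for e f g h
    using that btwL[of e f g "Some h"] btwL[of f e g "Some h"] by (auto simp: insert_commute)
  have R: "\<not> (P e < P g \<and> P g < P f)" "\<not> (P f < P g \<and> P g < P e)"
    if s: "sep rsplits {Some e, Some f} ({Some g, Some h} \<union> {None}) \<or> sep rsplits {Some e, Some f} ({Some h, Some g} \<union> {None})"
      and "e \<in> matching T" "f \<in> matching T" "g \<in> matching T" for e f g h
  proof -
    have "\<not> (Q e < Q g \<and> Q g < Q f)" "\<not> (Q f < Q g \<and> Q g < Q e)"
      using s btwR[of e f g "Some h"] btwR[of f e g "Some h"] that(4) by (auto simp: insert_commute)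
    then show "\<not> (P e < P g \<and> P g < P f)" "\<not> (P f < P g \<and> P g < P e)"
      using order that(2-4) by blast+
  qed
  have f1: "\<not> (P e1 < P e3 \<and> P e3 < P e2)" "\<not> (P e2 < P e3 \<and> P e3 < P e1)"
    using L[of e1 e2 e3 e4] s(1) mm by blast+
  have f3: "\<not> (P e3 < P e1 \<and> P e1 < P e4)" "\<not> (P e4 < P e1 \<and> P e1 < P e3)"
    using L[of e3 e4 e1 e2] s(2) mm by blast+
  have f5: "\<not> (P e1 < P e2 \<and> P e2 < P e3)" "\<not> (P e3 < P e2 \<and> P e2 < P e1)"
    using R[of e1 e3 e2 e4] s(3) mm by blast+
  have f7: "\<not> (P e2 < P e1 \<and> P e1 < P e4)" "\<not> (P e4 < P e1 \<and> P e1 < P e2)"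
    using R[of e2 e4 e1 e3] s(4) mm by blast+
  \<comment> \<open>Say \<open>e1\<close> precedes \<open>e2\<close>. The row \<open>e1 e2\<close>
    and the column \<open>e1 e3\<close> force \<open>e3\<close> before \<open>e1\<close>, and the
    column \<open>e2 e4\<close> forces \<open>e4\<close> after \<open>e1\<close>. Then
    \<open>e1\<close> separates the row \<open>e3 e4\<close>. The other case is its mirror
    image.\<close>
  from ne(1) consider "P e1 < P e2" | "P e2 < P e1" by linarith
  then show False
  proof cases
    case 1
    have "P e3 < P e1" using 1 ne(2) ne(4) f1(1) f5(1) by linarith
    moreover have "P e1 < P e4" using 1 ne(3) f7(2) by linarith
    ultimately show False using f3(1) by simp
  next
    case 2
    have "P e1 < P e3" using 2 ne(2) ne(4) f1(2) f5(2) by linarith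
    moreover have "P e4 < P e1" using 2 ne(3) f7(1) by linarith
    ultimately show False using f3(2) by simp
  qed
qed

end

theorem theorem3:
  fixes T :: "('a, 'b) tanglegram" and X :: "('a \<times> 'b) set"
  assumes "is_tanglegram T"
    and "cross_responsible T X"
    and "\<And>Y. cross_responsible T Y \<Longrightarrow> Y = X"
    and "tanglegram_isomorphic (subtanglegram T X) K1"
  shows "crt T = 1"
proof -
  interpret tangle T by unfold_locales (rule assms(1))
  have "X \<subseteq> matching T" using assms(2) unfolding cross_responsible_def by blast
  then obtain e1 e2 e3 e4 where e: "{e1, e2, e3, e4} \<subseteq> matching T"
    and ob: "obs lsplits rsplits {None} (Some e1) (Some e2) (Some e3) (Some e4)"
    by (rule obs_of_K1[OF _ assms(4)])
  have N: "{None, Some e1, Some e2, Some e3, Some e4} \<subseteq> points" using e by auto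
  \<comment> \<open>Every obstruction through the root yields a cross-responsible set, which can
    only be \<open>X\<close>; this is the uniqueness that \<open>almost_circular_order\<close>
    requires.\<close>
  have eq: "{p, q, r, s, t} = insert None (Some ` X)"
    if o: "obs lsplits rsplits {p} q r s t" "{p, q, r, s, t} \<subseteq> points" "None \<in> {p, q, r, s, t}" for p q r s t
  proof -
    obtain Y where "cross_responsible T Y" "{p, q, r, s, t} = insert None (Some ` Y)"
      by (rule cross_responsible_of_obs[OF o])
    then show ?thesis using assms(3) by simp
  qed
  have X: "{None, Some e1, Some e2, Some e3, Some e4} = insert None (Some ` X)"
    by (rule eq[OF ob N]) simp
  have uniq: "{p, q, r, s, t} = {None, Some e1, Some e2, Some e3, Some e4}"
    if "obs lsplits rsplits {p} q r s t" "{p, q, r, s, t} \<subseteq> points" "None \<in> {p, q, r, s, t}" for p q r s t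
    unfolding X by (rule eq[OF that])
  have finp: "finite points" using fin_matching by simp
  obtain us vs where uv: "distinct (None # us @ [Some e1, Some e2, Some e3, Some e4] @ vs)"
    "set (None # us @ [Some e1, Some e2, Some e3, Some e4] @ vs) = points"
    "circ lsplits (None # us @ [Some e1, Some e2, Some e3, Some e4] @ vs)"
    "circ rsplits (None # us @ [Some e1, Some e3, Some e2, Some e4] @ vs)"
    by (rule almost_circular_order[OF lsplits rsplits finp N ob uniq])
  have "None \<notin> set us" "None \<notin> set vs" using uv(1) by auto
  \<comment> \<open>\<open>None\<close> occurs only at the head of the list, so the other entries
    are matching edges under \<open>Some\<close>.\<close>
  then have some: "us = map Some (map the us)" "vs = map Some (map the vs)"
    by (induction us) (auto, induction vs, auto)
  define us' vs' where "us' = map the us" and "vs' = map the vs"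
  have us: "us = map Some us'" "vs = map Some vs'" using some unfolding us'_def vs'_def by auto
  have dist: "distinct (us' @ [e1, e2, e3, e4] @ vs')"
    using uv(1) unfolding us by (auto simp: distinct_map)
  have "Some ` set (us' @ [e1, e2, e3, e4] @ vs') = Some ` matching T"
    using uv(2) unfolding us by auto
  then have st: "set (us' @ [e1, e2, e3, e4] @ vs') = matching T"
    using inj_image_eq_iff[OF inj_Some] by blast
  have "circ lsplits (None # map Some (us' @ [e1, e2, e3, e4] @ vs'))"
    "circ rsplits (None # map Some (us' @ [e1, e3, e2, e4] @ vs'))"
    using uv(3,4) unfolding us by simp_all
  then obtain p q where pq: "is_layout T p q" "layout_crossings T p q \<le> 1"
    by (rule layout_of_circ[OF _ _ dist st])
  have lower: "1 \<le> layout_crossings T p q" if "is_layout T p q" for p q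
    by (rule layout_has_crossing[OF that e ob])
  have "is_layout T p q \<and> layout_crossings T p q = 1"
    using pq lower[OF pq(1)] by linarith
  \<comment> \<open>The value 1 is attained by the layout just found and is a lower bound for every
    layout.\<close>
  then show ?thesis
    unfolding crt_def using lower by (intro Least_equality) blast+
qed

end
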